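(* Let $\mathsf M$ be a model category equipped with a natural cylinder object $Q_{\le 1}$, and suppose that the functor $Q_1:\mathsf M\to\mathsf M$ preserves finite colimits. Then $Q_{\le 1}$ is coherent if and only if the following three conditions are satisfied: 1. for any cofibration $f:X\to Y$ in $\mathsf M$, the map $Q_1(X)\coprod_{X\sqcup X}(Y\sqcup Y)\to Q_1(Y)$ is a cofibration; 2. for any cofibration $f:X\to Y$ in $\mathsf M$ and for any of the two coface morphisms $\square[0]\to\square[1]$, the induced morphism $Q_1(X)\coprod_X Y\to Q_1(Y)$ is a weak equivalence; 3. for any acyclic cofibration $f:X\to Y$ in $\mathsf M$, the map $Q_1(f)$ is a weak equivalence.
   Context: **Cubes.** $\square$ is the subcategory of posets with objects $\square[n]=\{0<1\}^n$, $n\ge 0$, whose morphisms are compositions of products of the maps $\delta^i:\ast\to\{0<1\}$ (value $i\in\{0,1\}$) and $\sigma:\{0<1\}\to\ast$. It is strict monoidal with $\square[n]\otimes\square[m]=\square[n+m]$. Cubical sets are presheaves on $\square$. Cofaces: $\delta_k^i=\mathrm{id}_{\square[k]}\otimes\delta^i\otimes \mathrm{id}:\square[n-1]\to\square[n]$, $0\le k\le n-1$. $\partial\square[n]\subset\square[n]$ is the union of the images of all cofaces ($\partial\square[0]=\emptyset$); $\sqcap^{k,\epsilon}[n]\subset\square[n]$ ($n\ge1$, $0\le k\le n-1$, $\epsilon\in\{0,1\}$) is the union of the images of all cofaces other than $\delta_k^\epsilon$. Cubical sets carry a model structure (weak equivalences: maps sent to weak homotopy equivalences by the colimit-preserving functor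 to simplicial sets with $\square[n]\mapsto\Delta[1]^n$; cofibrations: monomorphisms), in which fibrations (resp. acyclic fibrations) are the maps with the right lifting property against all $\sqcap^{k,\epsilon}[n]\to\square[n]$ (resp. all $\partial\square[n]\to\square[n]$). **Model category.** A category with finite limits and colimits, with wide subcategories of weak equivalences, cofibrations, fibrations containing all isomorphisms and satisfying the usual axioms (both factorisations; cofibrations are the maps with the left lifting property against acyclic fibrations and acyclic cofibrations those with the left lifting property against fibrations; closure under retracts; 2-out-of-3). **Natural cylinder.** Let $\square_{\le1}\subset\square$ be the full subcategory on $\square[0],\square[1]$. A natural cylinder object on $\mathsf M$ is a functor $Q_{\le1}:\square_{\le1}\to\mathrm{Fun}(\mathsf M,\mathsf M)$ sending $\square[0]$ to $\mathrm{id}_{\mathsf M}$ and $\square[1]$ to $Q_1$; so there are natural maps $X\sqcup X\to Q_1(X)\to X$. It extends uniquely to a strict monoidal functor $\square\to(\mathrm{Fun}(\mathsf M,\mathsf M),\circ)$, $\square[n]\mapsto Q_n=Q_1^{\circ n}$. **Coherent.** Define cubical sets $\mathsf M^Q(X,Y)_n=\hom_{\mathsf M}(Q_nX,Y)$. The natural cylinder $Q_{\le1}$ is coherent if the induced left square structure is homotopical, that is: for any cofibration $f:X\to X'$ and fibration $g:Y\to Y'$ in $\mathsf M$, the map of cubical sets $\mathsf M^Q(X',Y)\to\mathsf M^Q(X,Y)\times_{\mathsf M^Q(X,Y')}\mathsf M^Q(X',Y')$ is a fibration, acyclic if $f$ or $g$ is acyclic; $Q_0(X)\to X$ is a weak equivalence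 for every $X$; and $Q_0(\emptyset)$ is cofibrant (the last two hold automatically here since $Q_0=\mathrm{id}$). *)

theory Defs
  imports Main "HOL-Library.FuncSet"
begin

section \<open>Categories, functors and natural transformations\<close>

record ('o, 'm) category =
  Obj :: "'o set"
  Mor :: "'m set"
  Dom :: "'m \<Rightarrow> 'o"
  Cod :: "'m \<Rightarrow> 'o"
  Id :: "'o \<Rightarrow> 'm"
  Comp :: "'m \<Rightarrow> 'm \<Rightarrow> 'm" (infixl "\<cdot>\<index>" 70)

definition Hom :: "('o, 'm, 'z) category_scheme \<Rightarrow> 'o \<Rightarrow> 'o \<Rightarrow> 'm set" where
  "Hom C X Y = {f \<in> Mor C. Dom C f = X \<and> Cod C f = Y}"

locale category =
  fixes C :: "('o, 'm, 'z) category_scheme" (structure)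
  assumes Dom_Obj: "f \<in> Mor C \<Longrightarrow> Dom C f \<in> Obj C"
    and Cod_Obj: "f \<in> Mor C \<Longrightarrow> Cod C f \<in> Obj C"
    and Id_Hom: "X \<in> Obj C \<Longrightarrow> Id C X \<in> Hom C X X"
    and Comp_Hom: "\<lbrakk>f \<in> Hom C X Y; g \<in> Hom C Y Z\<rbrakk> \<Longrightarrow> g \<cdot> f \<in> Hom C X Z"
    and Comp_Id: "f \<in> Hom C X Y \<Longrightarrow> f \<cdot> Id C X = f"
    and Id_Comp: "f \<in> Hom C X Y \<Longrightarrow> Id C Y \<cdot> f = f"
    and Comp_assoc: "\<lbrakk>f \<in> Hom C W X; g \<in> Hom C X Y; h \<in> Hom C Y Z\<rbrakk> \<Longrightarrow> (h \<cdot> g) \<cdot> f = h \<cdot> (g \<cdot> f)"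

definition full_subcategory :: "('o, 'm, 'z) category_scheme \<Rightarrow> 'o set \<Rightarrow> ('o, 'm) category" where
  "full_subcategory C S =
     \<lparr>Obj = Obj C \<inter> S, Mor = {f \<in> Mor C. Dom C f \<in> S \<and> Cod C f \<in> S},
      Dom = Dom C, Cod = Cod C, Id = Id C, Comp = Comp C\<rparr>"

text \<open>Functors and natural transformations are extensional outside the carriers, so that equality
  in HOL is equality of functors and of natural transformations.\<close>

record ('o, 'm, 'p, 'n) cfunctor =
  omap :: "'o \<Rightarrow> 'p"
  mmap :: "'m \<Rightarrow> 'n"

definition is_functor ::
  "('o, 'm, 'y) category_scheme \<Rightarrow> ('p, 'n, 'z) category_scheme \<Rightarrow> ('o, 'm, 'p, 'n) cfunctor \<Rightarrow> bool" where
  "is_functor C D F \<longleftrightarrow>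
     omap F \<in> Obj C \<rightarrow>\<^sub>E Obj D \<and>
     mmap F \<in> extensional (Mor C) \<and>
     (\<forall>f\<in>Mor C. mmap F f \<in> Hom D (omap F (Dom C f)) (omap F (Cod C f))) \<and>
     (\<forall>X\<in>Obj C. mmap F (Id C X) = Id D (omap F X)) \<and>
     (\<forall>f\<in>Mor C. \<forall>g\<in>Mor C. Cod C f = Dom C g \<longrightarrow> mmap F (g \<cdot>\<^bsub>C\<^esub> f) = mmap F g \<cdot>\<^bsub>D\<^esub> mmap F f)"

definition id_functor :: "('o, 'm, 'z) category_scheme \<Rightarrow> ('o, 'm, 'o, 'm) cfunctor" where
  "id_functor C = \<lparr>omap = (\<lambda>X\<in>Obj C. X), mmap = (\<lambda>f\<in>Mor C. f)\<rparr>"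

text \<open>The composite of \<open>F\<close> after \<open>G\<close>, where \<open>C\<close> is the source category of \<open>G\<close>.\<close>

definition comp_functor ::
  "('o, 'm, 'z) category_scheme \<Rightarrow> ('p, 'n, 'q, 'l) cfunctor \<Rightarrow> ('o, 'm, 'p, 'n) cfunctor
     \<Rightarrow> ('o, 'm, 'q, 'l) cfunctor" where
  "comp_functor C F G =
     \<lparr>omap = (\<lambda>X\<in>Obj C. omap F (omap G X)), mmap = (\<lambda>f\<in>Mor C. mmap F (mmap G f))\<rparr>"

record ('o, 'm, 'p, 'n) nat_trans =
  nt_dom :: "('o, 'm, 'p, 'n) cfunctor"
  nt_cod :: "('o, 'm, 'p, 'n) cfunctor"
  nt_at :: "'o \<Rightarrow> 'n"

definition is_nat_trans ::
  "('o, 'm, 'y) category_scheme \<Rightarrow> ('p, 'n, 'z) category_scheme \<Rightarrow> ('o, 'm, 'p, 'n) nat_trans \<Rightarrow> bool" where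
  "is_nat_trans C D a \<longleftrightarrow>
     is_functor C D (nt_dom a) \<and> is_functor C D (nt_cod a) \<and>
     nt_at a \<in> extensional (Obj C) \<and>
     (\<forall>X\<in>Obj C. nt_at a X \<in> Hom D (omap (nt_dom a) X) (omap (nt_cod a) X)) \<and>
     (\<forall>f\<in>Mor C. mmap (nt_cod a) f \<cdot>\<^bsub>D\<^esub> nt_at a (Dom C f) = nt_at a (Cod C f) \<cdot>\<^bsub>D\<^esub> mmap (nt_dom a) f)"

definition Fun ::
  "('o, 'm, 'y) category_scheme \<Rightarrow> ('p, 'n, 'z) category_scheme
     \<Rightarrow> (('o, 'm, 'p, 'n) cfunctor, ('o, 'm, 'p, 'n) nat_trans) category" where
  "Fun C D =
     \<lparr>Obj = {F. is_functor C D F}, Mor = {a. is_nat_trans C D a}, Dom = nt_dom, Cod = nt_cod,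
      Id = (\<lambda>F. \<lparr>nt_dom = F, nt_cod = F, nt_at = (\<lambda>X\<in>Obj C. Id D (omap F X))\<rparr>),
      Comp = (\<lambda>b a. \<lparr>nt_dom = nt_dom a, nt_cod = nt_cod b,
                     nt_at = (\<lambda>X\<in>Obj C. nt_at b X \<cdot>\<^bsub>D\<^esub> nt_at a X)\<rparr>)\<rparr>"


section \<open>Limits and colimits\<close>

definition is_cone ::
  "('j, 'k) category \<Rightarrow> ('o, 'm, 'z) category_scheme \<Rightarrow> ('j, 'k, 'o, 'm) cfunctor \<Rightarrow> 'o \<Rightarrow> ('j \<Rightarrow> 'm) \<Rightarrow> bool" where
  "is_cone J C F X t \<longleftrightarrow>
     X \<in> Obj C \<and> (\<forall>j\<in>Obj J. t j \<in> Hom C X (omap F j)) \<and>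
     (\<forall>u\<in>Mor J. mmap F u \<cdot>\<^bsub>C\<^esub> t (Dom J u) = t (Cod J u))"

definition is_limit ::
  "('j, 'k) category \<Rightarrow> ('o, 'm, 'z) category_scheme \<Rightarrow> ('j, 'k, 'o, 'm) cfunctor \<Rightarrow> 'o \<Rightarrow> ('j \<Rightarrow> 'm) \<Rightarrow> bool" where
  "is_limit J C F X t \<longleftrightarrow>
     is_cone J C F X t \<and>
     (\<forall>Y s. is_cone J C F Y s \<longrightarrow> (\<exists>!h. h \<in> Hom C Y X \<and> (\<forall>j\<in>Obj J. t j \<cdot>\<^bsub>C\<^esub> h = s j)))"

definition is_cocone ::
  "('j, 'k) category \<Rightarrow> ('o, 'm, 'z) category_scheme \<Rightarrow> ('j, 'k, 'o, 'm) cfunctor \<Rightarrow> 'o \<Rightarrow> ('j \<Rightarrow> 'm) \<Rightarrow> bool" where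
  "is_cocone J C F X t \<longleftrightarrow>
     X \<in> Obj C \<and> (\<forall>j\<in>Obj J. t j \<in> Hom C (omap F j) X) \<and>
     (\<forall>u\<in>Mor J. t (Cod J u) \<cdot>\<^bsub>C\<^esub> mmap F u = t (Dom J u))"

definition is_colimit ::
  "('j, 'k) category \<Rightarrow> ('o, 'm, 'z) category_scheme \<Rightarrow> ('j, 'k, 'o, 'm) cfunctor \<Rightarrow> 'o \<Rightarrow> ('j \<Rightarrow> 'm) \<Rightarrow> bool" where
  "is_colimit J C F X t \<longleftrightarrow>
     is_cocone J C F X t \<and>
     (\<forall>Y s. is_cocone J C F Y s \<longrightarrow> (\<exists>!h. h \<in> Hom C X Y \<and> (\<forall>j\<in>Obj J. h \<cdot>\<^bsub>C\<^esub> t j = s j)))"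

text \<open>Every finite category is isomorphic to one whose objects and morphisms are natural numbers,
  so it suffices to let index categories range over these.\<close>

definition finite_category :: "(nat, nat) category \<Rightarrow> bool" where
  "finite_category J \<longleftrightarrow> category J \<and> finite (Obj J) \<and> finite (Mor J)"

definition has_finite_limits :: "('o, 'm, 'z) category_scheme \<Rightarrow> bool" where
  "has_finite_limits C \<longleftrightarrow>
     (\<forall>J F. finite_category J \<and> is_functor J C F \<longrightarrow> (\<exists>X t. is_limit J C F X t))"

definition has_finite_colimits :: "('o, 'm, 'z) category_scheme \<Rightarrow> bool" where
  "has_finite_colimits C \<longleftrightarrow>
     (\<forall>J F. finite_category J \<and> is_functor J C F \<longrightarrow> (\<exists>X t. is_colimit J C F X t))"

definition preserves_finite_colimits ::
  "('o, 'm, 'y) category_scheme \<Rightarrow> ('p, 'n, 'z) category_scheme \<Rightarrow> ('o, 'm, 'p, 'n) cfunctor \<Rightarrow> bool" where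
  "preserves_finite_colimits C D F \<longleftrightarrow>
     (\<forall>J G X t. finite_category J \<and> is_functor J C G \<and> is_colimit J C G X t \<longrightarrow>
        is_colimit J D (comp_functor J F G) (omap F X) (\<lambda>j. mmap F (t j)))"

definition is_initial :: "('o, 'm, 'z) category_scheme \<Rightarrow> 'o \<Rightarrow> bool" where
  "is_initial C I \<longleftrightarrow> I \<in> Obj C \<and> (\<forall>X\<in>Obj C. \<exists>!u. u \<in> Hom C I X)"

text \<open>\<open>i\<close> and \<open>j\<close> are the two coprojections; the coproduct object is their common codomain.\<close>

definition is_coproduct :: "('o, 'm, 'z) category_scheme \<Rightarrow> 'o \<Rightarrow> 'o \<Rightarrow> 'm \<Rightarrow> 'm \<Rightarrow> bool" where
  "is_coproduct C X Y i j \<longleftrightarrow>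
     i \<in> Mor C \<and> j \<in> Mor C \<and> Dom C i = X \<and> Dom C j = Y \<and> Cod C i = Cod C j \<and>
     (\<forall>Z. \<forall>f\<in>Hom C X Z. \<forall>g\<in>Hom C Y Z. \<exists>!h. h \<in> Hom C (Cod C i) Z \<and> h \<cdot>\<^bsub>C\<^esub> i = f \<and> h \<cdot>\<^bsub>C\<^esub> j = g)"

text \<open>\<open>a\<close> and \<open>b\<close> are the maps to the pushout of the span formed by \<open>f\<close> and \<open>g\<close>, with
  \<open>a \<cdot> f = b \<cdot> g\<close>; the pushout object is their common codomain.\<close>

definition is_pushout :: "('o, 'm, 'z) category_scheme \<Rightarrow> 'm \<Rightarrow> 'm \<Rightarrow> 'm \<Rightarrow> 'm \<Rightarrow> bool" where
  "is_pushout C f g a b \<longleftrightarrow>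
     f \<in> Mor C \<and> g \<in> Mor C \<and> Dom C f = Dom C g \<and>
     a \<in> Mor C \<and> b \<in> Mor C \<and> Dom C a = Cod C f \<and> Dom C b = Cod C g \<and> Cod C a = Cod C b \<and>
     a \<cdot>\<^bsub>C\<^esub> f = b \<cdot>\<^bsub>C\<^esub> g \<and>
     (\<forall>Z. \<forall>p\<in>Hom C (Cod C f) Z. \<forall>q\<in>Hom C (Cod C g) Z. p \<cdot>\<^bsub>C\<^esub> f = q \<cdot>\<^bsub>C\<^esub> g \<longrightarrow>
        (\<exists>!h. h \<in> Hom C (Cod C a) Z \<and> h \<cdot>\<^bsub>C\<^esub> a = p \<and> h \<cdot>\<^bsub>C\<^esub> b = q))"

text \<open>The map out of a coproduct with coprojections \<open>a\<close>, \<open>b\<close>, or out of a pushout with structure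
  maps \<open>a\<close>, \<open>b\<close>, which is given by \<open>p\<close> and \<open>q\<close> on the two pieces.\<close>

definition induced :: "('o, 'm, 'z) category_scheme \<Rightarrow> 'm \<Rightarrow> 'm \<Rightarrow> 'm \<Rightarrow> 'm \<Rightarrow> 'm" where
  "induced C a b p q = (THE h. h \<in> Hom C (Cod C a) (Cod C p) \<and> h \<cdot>\<^bsub>C\<^esub> a = p \<and> h \<cdot>\<^bsub>C\<^esub> b = q)"


section \<open>Model categories\<close>

record ('o, 'm) model_category = "('o, 'm) category" +
  weq :: "'m set"
  cof :: "'m set"
  fib :: "'m set"

definition is_iso :: "('o, 'm, 'z) category_scheme \<Rightarrow> 'm \<Rightarrow> bool" where
  "is_iso C f \<longleftrightarrow> f \<in> Mor C \<and>
     (\<exists>g\<in>Hom C (Cod C f) (Dom C f). g \<cdot>\<^bsub>C\<^esub> f = Id C (Dom C f) \<and> f \<cdot>\<^bsub>C\<^esub> g = Id C (Cod C f))"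

definition wide_subcategory_with_isos :: "('o, 'm, 'z) category_scheme \<Rightarrow> 'm set \<Rightarrow> bool" where
  "wide_subcategory_with_isos C S \<longleftrightarrow>
     S \<subseteq> Mor C \<and> (\<forall>X\<in>Obj C. Id C X \<in> S) \<and>
     (\<forall>f\<in>S. \<forall>g\<in>S. Cod C f = Dom C g \<longrightarrow> g \<cdot>\<^bsub>C\<^esub> f \<in> S) \<and>
     (\<forall>f. is_iso C f \<longrightarrow> f \<in> S)"

definition lifts :: "('o, 'm, 'z) category_scheme \<Rightarrow> 'm \<Rightarrow> 'm \<Rightarrow> bool" where
  "lifts C i p \<longleftrightarrow>
     (\<forall>u\<in>Hom C (Dom C i) (Dom C p). \<forall>v\<in>Hom C (Cod C i) (Cod C p). p \<cdot>\<^bsub>C\<^esub> u = v \<cdot>\<^bsub>C\<^esub> i \<longrightarrow>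
        (\<exists>h\<in>Hom C (Cod C i) (Dom C p). h \<cdot>\<^bsub>C\<^esub> i = u \<and> p \<cdot>\<^bsub>C\<^esub> h = v))"

definition is_retract :: "('o, 'm, 'z) category_scheme \<Rightarrow> 'm \<Rightarrow> 'm \<Rightarrow> bool" where
  "is_retract C f g \<longleftrightarrow> f \<in> Mor C \<and> g \<in> Mor C \<and>
     (\<exists>s\<in>Hom C (Dom C f) (Dom C g). \<exists>r\<in>Hom C (Dom C g) (Dom C f).
      \<exists>s'\<in>Hom C (Cod C f) (Cod C g). \<exists>r'\<in>Hom C (Cod C g) (Cod C f).
        r \<cdot>\<^bsub>C\<^esub> s = Id C (Dom C f) \<and> r' \<cdot>\<^bsub>C\<^esub> s' = Id C (Cod C f) \<and>
        g \<cdot>\<^bsub>C\<^esub> s = s' \<cdot>\<^bsub>C\<^esub> f \<and> f \<cdot>\<^bsub>C\<^esub> r = r' \<cdot>\<^bsub>C\<^esub> g)"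

locale model_category = category M for M :: "('o, 'm, 'z) model_category_scheme" (structure) +
  assumes finite_limits: "has_finite_limits M"
    and finite_colimits: "has_finite_colimits M"
    and wide: "S \<in> {weq M, cof M, fib M} \<Longrightarrow> wide_subcategory_with_isos M S"
    and factor_acyclic_cof:
      "f \<in> Mor M \<Longrightarrow> \<exists>i\<in>cof M \<inter> weq M. \<exists>p\<in>fib M. Cod M i = Dom M p \<and> f = p \<cdot> i"
    and factor_acyclic_fib:
      "f \<in> Mor M \<Longrightarrow> \<exists>i\<in>cof M. \<exists>p\<in>fib M \<inter> weq M. Cod M i = Dom M p \<and> f = p \<cdot> i"
    and cof_iff_lifts: "cof M = {i \<in> Mor M. \<forall>p\<in>fib M \<inter> weq M. lifts M i p}"
    and acyclic_cof_iff_lifts: "cof M \<inter> weq M = {i \<in> Mor M. \<forall>p\<in>fib M. lifts M i p}"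
    and retracts: "\<lbrakk>S \<in> {weq M, cof M, fib M}; is_retract M f g; g \<in> S\<rbrakk> \<Longrightarrow> f \<in> S"
    and two_out_of_three:
      "\<lbrakk>f \<in> Mor M; g \<in> Mor M; Cod M f = Dom M g\<rbrakk> \<Longrightarrow>
        (f \<in> weq M \<and> g \<in> weq M \<longrightarrow> g \<cdot> f \<in> weq M) \<and>
        (f \<in> weq M \<and> g \<cdot> f \<in> weq M \<longrightarrow> g \<in> weq M) \<and>
        (g \<in> weq M \<and> g \<cdot> f \<in> weq M \<longrightarrow> f \<in> weq M)"

definition is_cofibrant :: "('o, 'm, 'z) model_category_scheme \<Rightarrow> 'o \<Rightarrow> bool" where
  "is_cofibrant M X \<longleftrightarrow> X \<in> Obj M \<and> (\<forall>I. is_initial M I \<longrightarrow> Hom M I X \<subseteq> cof M)"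


section \<open>Strict monoidal categories and functors\<close>

record ('o, 'm) monoidal = "('o, 'm) category" +
  munit :: "'o"
  otens :: "'o \<Rightarrow> 'o \<Rightarrow> 'o"
  mtens :: "'m \<Rightarrow> 'm \<Rightarrow> 'm"

definition strict_monoidal_functor ::
  "('o, 'm, 'y) monoidal_scheme \<Rightarrow> ('p, 'n, 'z) monoidal_scheme \<Rightarrow> ('o, 'm, 'p, 'n) cfunctor \<Rightarrow> bool" where
  "strict_monoidal_functor A B F \<longleftrightarrow>
     is_functor A B F \<and> omap F (munit A) = munit B \<and>
     (\<forall>X\<in>Obj A. \<forall>Y\<in>Obj A. omap F (otens A X Y) = otens B (omap F X) (omap F Y)) \<and>
     (\<forall>f\<in>Mor A. \<forall>g\<in>Mor A. mmap F (mtens A f g) = mtens B (mmap F f) (mmap F g))"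

text \<open>Endofunctors under composition: \<open>F \<otimes> G\<close> is \<open>F\<close> after \<open>G\<close>, and the tensor product of
  natural transformations is horizontal composition.\<close>

definition End ::
  "('o, 'm, 'z) category_scheme \<Rightarrow> (('o, 'm, 'o, 'm) cfunctor, ('o, 'm, 'o, 'm) nat_trans) monoidal" where
  "End C = category.extend (Fun C C)
     \<lparr>munit = id_functor C,
      otens = comp_functor C,
      mtens = (\<lambda>a b. \<lparr>nt_dom = comp_functor C (nt_dom a) (nt_dom b),
                      nt_cod = comp_functor C (nt_cod a) (nt_cod b),
                      nt_at = (\<lambda>X\<in>Obj C. nt_at a (omap (nt_cod b) X) \<cdot>\<^bsub>C\<^esub> mmap (nt_dom a) (nt_at b X))\<rparr>)\<rparr>"


section \<open>The cube category\<close>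

text \<open>The object \<open>n\<close> stands for the poset \<open>{0<1}\<^sup>n\<close>, realised as the boolean lists of length \<open>n\<close>
  with \<open>0 = False\<close> and \<open>1 = True\<close>. A map is a triple of source, target and underlying function,
  the latter extensional outside the source.\<close>

type_synonym cube_map = "nat \<times> nat \<times> (bool list \<Rightarrow> bool list)"

definition cube_pts :: "nat \<Rightarrow> bool list set" where
  "cube_pts n = {xs. length xs = n}"

definition cube_id :: "nat \<Rightarrow> cube_map" where
  "cube_id n = (n, n, \<lambda>xs\<in>cube_pts n. xs)"

definition cube_comp :: "cube_map \<Rightarrow> cube_map \<Rightarrow> cube_map" where
  "cube_comp = (\<lambda>(n', m', g) (n, m, f). (n, m', compose (cube_pts n) g f))"

definition cube_tensor :: "cube_map \<Rightarrow> cube_map \<Rightarrow> cube_map" where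
  "cube_tensor = (\<lambda>(n, m, f) (n', m', g).
     (n + n', m + m', \<lambda>xs\<in>cube_pts (n + n'). f (take n xs) @ g (drop n xs)))"

definition delta :: "bool \<Rightarrow> cube_map" where
  "delta e = (0, 1, \<lambda>xs\<in>cube_pts 0. [e])"

definition sigma :: cube_map where
  "sigma = (1, 0, \<lambda>xs\<in>cube_pts 1. [])"

inductive_set cube_maps :: "cube_map set" where
  id: "cube_id n \<in> cube_maps"
| delta: "delta e \<in> cube_maps"
| sigma: "sigma \<in> cube_maps"
| tensor: "\<lbrakk>f \<in> cube_maps; g \<in> cube_maps\<rbrakk> \<Longrightarrow> cube_tensor f g \<in> cube_maps"
| comp: "\<lbrakk>f \<in> cube_maps; g \<in> cube_maps; fst (snd f) = fst g\<rbrakk> \<Longrightarrow> cube_comp g f \<in> cube_maps"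

definition cube :: "(nat, cube_map) monoidal" where
  "cube = \<lparr>Obj = UNIV, Mor = cube_maps, Dom = fst, Cod = (\<lambda>f. fst (snd f)), Id = cube_id, Comp = cube_comp,
           munit = 0, otens = (+), mtens = cube_tensor\<rparr>"

definition cube_le1 :: "(nat, cube_map) category" where
  "cube_le1 = full_subcategory cube {0, 1}"

definition coface :: "nat \<Rightarrow> nat \<Rightarrow> bool \<Rightarrow> cube_map" where
  "coface n k e = cube_tensor (cube_id k) (cube_tensor (delta e) (cube_id (n - 1 - k)))"


section \<open>Cubical sets\<close>

record 'x cubical_set =
  cells :: "nat \<Rightarrow> 'x set"
  act :: "cube_map \<Rightarrow> 'x \<Rightarrow> 'x"

definition is_cubical_set :: "'x cubical_set \<Rightarrow> bool" where
  "is_cubical_set K \<longleftrightarrow>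
     (\<forall>\<theta>\<in>Mor cube. \<forall>x\<in>cells K (Cod cube \<theta>). act K \<theta> x \<in> cells K (Dom cube \<theta>)) \<and>
     (\<forall>n. \<forall>x\<in>cells K n. act K (Id cube n) x = x) \<and>
     (\<forall>\<theta>\<in>Mor cube. \<forall>\<phi>\<in>Mor cube. Cod cube \<theta> = Dom cube \<phi> \<longrightarrow>
        (\<forall>x\<in>cells K (Cod cube \<phi>). act K (\<phi> \<cdot>\<^bsub>cube\<^esub> \<theta>) x = act K \<theta> (act K \<phi> x)))"

definition is_cubical_map :: "'x cubical_set \<Rightarrow> 'y cubical_set \<Rightarrow> (nat \<Rightarrow> 'x \<Rightarrow> 'y) \<Rightarrow> bool" where
  "is_cubical_map K L p \<longleftrightarrow>
     is_cubical_set K \<and> is_cubical_set L \<and>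
     (\<forall>n. \<forall>x\<in>cells K n. p n x \<in> cells L n) \<and>
     (\<forall>\<theta>\<in>Mor cube. \<forall>x\<in>cells K (Cod cube \<theta>). p (Dom cube \<theta>) (act K \<theta> x) = act L \<theta> (p (Cod cube \<theta>) x))"

definition std_cube :: "nat \<Rightarrow> cube_map cubical_set" where
  "std_cube n = \<lparr>cells = (\<lambda>m. Hom cube m n), act = (\<lambda>\<theta> x. x \<cdot>\<^bsub>cube\<^esub> \<theta>)\<rparr>"

text \<open>The union of the images of the cofaces \<open>coface n k e\<close> with \<open>(k, e) \<in> S\<close>.\<close>

definition coface_union :: "nat \<Rightarrow> (nat \<times> bool) set \<Rightarrow> cube_map cubical_set" where
  "coface_union n S =
     \<lparr>cells = (\<lambda>m. {coface n k e \<cdot>\<^bsub>cube\<^esub> x | k e x. (k, e) \<in> S \<and> x \<in> Hom cube m (n - 1)}),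
      act = (\<lambda>\<theta> x. x \<cdot>\<^bsub>cube\<^esub> \<theta>)\<rparr>"

definition boundary :: "nat \<Rightarrow> cube_map cubical_set" where
  "boundary n = coface_union n ({..<n} \<times> UNIV)"

definition open_box :: "nat \<Rightarrow> nat \<Rightarrow> bool \<Rightarrow> cube_map cubical_set" where
  "open_box n k e = coface_union n ({..<n} \<times> UNIV - {(k, e)})"

text \<open>The right lifting property of \<open>p : K \<rightarrow> L\<close> against the inclusion of a cubical subset \<open>A\<close> of \<open>B\<close>.\<close>

definition cubical_rlp ::
  "'a cubical_set \<Rightarrow> 'a cubical_set \<Rightarrow> 'x cubical_set \<Rightarrow> 'y cubical_set \<Rightarrow> (nat \<Rightarrow> 'x \<Rightarrow> 'y) \<Rightarrow> bool" where
  "cubical_rlp A B K L p \<longleftrightarrow>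
     (\<forall>u v. is_cubical_map A K u \<and> is_cubical_map B L v \<and> (\<forall>n. \<forall>a\<in>cells A n. p n (u n a) = v n a) \<longrightarrow>
        (\<exists>h. is_cubical_map B K h \<and> (\<forall>n. \<forall>a\<in>cells A n. h n a = u n a) \<and>
             (\<forall>n. \<forall>b\<in>cells B n. p n (h n b) = v n b)))"

text \<open>Fibrations and acyclic fibrations of the model structure on cubical sets, by their
  characterisation through the generating (acyclic) cofibrations.\<close>

definition cubical_fibration :: "'x cubical_set \<Rightarrow> 'y cubical_set \<Rightarrow> (nat \<Rightarrow> 'x \<Rightarrow> 'y) \<Rightarrow> bool" where
  "cubical_fibration K L p \<longleftrightarrow>
     is_cubical_map K L p \<and> (\<forall>n k e. k < n \<longrightarrow> cubical_rlp (open_box n k e) (std_cube n) K L p)"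

definition cubical_acyclic_fibration :: "'x cubical_set \<Rightarrow> 'y cubical_set \<Rightarrow> (nat \<Rightarrow> 'x \<Rightarrow> 'y) \<Rightarrow> bool" where
  "cubical_acyclic_fibration K L p \<longleftrightarrow>
     is_cubical_map K L p \<and> (\<forall>n. cubical_rlp (boundary n) (std_cube n) K L p)"

definition cubical_pullback ::
  "'x cubical_set \<Rightarrow> 'y cubical_set \<Rightarrow> (nat \<Rightarrow> 'x \<Rightarrow> 'w) \<Rightarrow> (nat \<Rightarrow> 'y \<Rightarrow> 'w) \<Rightarrow> ('x \<times> 'y) cubical_set" where
  "cubical_pullback K L p q =
     \<lparr>cells = (\<lambda>n. {(x, y) \<in> cells K n \<times> cells L n. p n x = q n y}),
      act = (\<lambda>\<theta> (x, y). (act K \<theta> x, act L \<theta> y))\<rparr>"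


section \<open>Natural cylinders and coherence\<close>

type_synonym ('o, 'm) cube_action =
  "(nat, cube_map, ('o, 'm, 'o, 'm) cfunctor, ('o, 'm, 'o, 'm) nat_trans) cfunctor"

definition natural_cylinder :: "('o, 'm, 'z) category_scheme \<Rightarrow> ('o, 'm) cube_action \<Rightarrow> bool" where
  "natural_cylinder C Q \<longleftrightarrow> is_functor cube_le1 (Fun C C) Q \<and> omap Q 0 = id_functor C"

abbreviation cyl :: "('o, 'm) cube_action \<Rightarrow> ('o, 'm, 'o, 'm) cfunctor" where
  "cyl Q \<equiv> omap Q 1"

abbreviation cyl_incl :: "('o, 'm) cube_action \<Rightarrow> bool \<Rightarrow> 'o \<Rightarrow> 'm" where
  "cyl_incl Q e X \<equiv> nt_at (mmap Q (delta e)) X"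

definition monoidal_extension ::
  "('o, 'm, 'z) category_scheme \<Rightarrow> ('o, 'm) cube_action \<Rightarrow> ('o, 'm) cube_action" where
  "monoidal_extension C Q =
     (THE E. strict_monoidal_functor cube (End C) E \<and>
        (\<forall>n\<in>Obj cube_le1. omap E n = omap Q n) \<and> (\<forall>\<theta>\<in>Mor cube_le1. mmap E \<theta> = mmap Q \<theta>))"

definition mapping_cset ::
  "('o, 'm, 'z) category_scheme \<Rightarrow> ('o, 'm) cube_action \<Rightarrow> 'o \<Rightarrow> 'o \<Rightarrow> 'm cubical_set" where
  "mapping_cset C E X Y =
     \<lparr>cells = (\<lambda>n. Hom C (omap (omap E n) X) Y), act = (\<lambda>\<theta> x. x \<cdot>\<^bsub>C\<^esub> nt_at (mmap E \<theta>) X)\<rparr>"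

text \<open>For \<open>f : X \<rightarrow> X'\<close> and \<open>g : Y \<rightarrow> Y'\<close>, with \<open>Map\<close> denoting \<open>mapping_cset C E\<close>, these are the pullback
  of \<open>Map X Y\<close> and \<open>Map X' Y'\<close> over \<open>Map X Y'\<close> and the canonical map from \<open>Map X' Y\<close> to it.\<close>

definition pullback_hom_target ::
  "('o, 'm, 'z) category_scheme \<Rightarrow> ('o, 'm) cube_action \<Rightarrow> 'm \<Rightarrow> 'm \<Rightarrow> ('m \<times> 'm) cubical_set" where
  "pullback_hom_target C E f g =
     cubical_pullback (mapping_cset C E (Dom C f) (Dom C g)) (mapping_cset C E (Cod C f) (Cod C g))
       (\<lambda>n x. g \<cdot>\<^bsub>C\<^esub> x) (\<lambda>n y. y \<cdot>\<^bsub>C\<^esub> mmap (omap E n) f)"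

definition pullback_hom ::
  "('o, 'm, 'z) category_scheme \<Rightarrow> ('o, 'm) cube_action \<Rightarrow> 'm \<Rightarrow> 'm \<Rightarrow> nat \<Rightarrow> 'm \<Rightarrow> 'm \<times> 'm" where
  "pullback_hom C E f g n x = (x \<cdot>\<^bsub>C\<^esub> mmap (omap E n) f, g \<cdot>\<^bsub>C\<^esub> x)"

text \<open>A functor \<open>E\<close> from cubes to endofunctors, augmented by \<open>\<epsilon> : E 0 \<rightarrow> id\<close>, is homotopical.\<close>

definition homotopical ::
  "('o, 'm, 'z) model_category_scheme \<Rightarrow> ('o, 'm) cube_action \<Rightarrow> ('o, 'm, 'o, 'm) nat_trans \<Rightarrow> bool" where
  "homotopical M E \<epsilon> \<longleftrightarrow>
     (\<forall>f\<in>cof M. \<forall>g\<in>fib M.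
        cubical_fibration (mapping_cset M E (Cod M f) (Dom M g)) (pullback_hom_target M E f g)
          (pullback_hom M E f g) \<and>
        (f \<in> weq M \<or> g \<in> weq M \<longrightarrow>
          cubical_acyclic_fibration (mapping_cset M E (Cod M f) (Dom M g)) (pullback_hom_target M E f g)
            (pullback_hom M E f g))) \<and>
     (\<forall>X\<in>Obj M. nt_at \<epsilon> X \<in> weq M) \<and>
     (\<forall>I. is_initial M I \<longrightarrow> is_cofibrant M (omap (omap E 0) I))"

text \<open>Since \<open>Q 0\<close> is the identity functor, the augmentation is the identity transformation.\<close>

definition coherent :: "('o, 'm, 'z) model_category_scheme \<Rightarrow> ('o, 'm) cube_action \<Rightarrow> bool" where
  "coherent M Q \<longleftrightarrow> homotopical M (monoidal_extension M Q) (Id (Fun M M) (id_functor M))"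

end

theory Submission
  imports Defs
begin

text \<open>Everything is expressed through lifting problems in \<open>M\<close>. A lifting problem of
  \<open>\<partial>\<box>[n] \<rightarrow> \<box>[n]\<close>, or of an open box, against the pullback-hom map of \<open>f\<close> and \<open>g\<close> is a compatible family
  of maps on faces of \<open>Q\<^sub>n (Cod f)\<close> together with a square from \<open>Q\<^sub>n f\<close> to \<open>g\<close>. For \<open>n = 1\<close> such a problem
  is a lifting problem against \<open>g\<close> of the corner map \<open>L\<close> from the cylinder of \<open>Dom f\<close>, with \<open>Cod f\<close> glued
  to one or both ends, to the cylinder of \<open>Cod f\<close>; this gives the three conditions, the third because
  the cylinder of \<open>Dom f\<close> includes into the source of \<open>L\<close> by a cobase change of \<open>f\<close>. Conversely,
  \<open>Q\<^sub>n\<close> preserves the pushouts that define the source of \<open>L\<close>, so a problem of dimension \<open>n + 1\<close> for \<open>f\<close>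
  is a problem of dimension \<open>n\<close> for \<open>L\<close>, the faces in the last direction having been absorbed into \<open>L\<close>.
  By induction on \<open>n\<close>, all lifting problems reduce to \<open>n = 0\<close>: an acyclic cofibration against a
  fibration, or a cofibration against an acyclic fibration.\<close>

section \<open>Endofunctors as a strict monoidal category\<close>

text \<open>The extension of \<open>Q\<close> to all cubes is a definite description, so nothing can
  be said about \<open>Q\<^sub>n\<close> until a presentation of the cube category has shown that
  the extension exists and is unique. The tensor product of endofunctors is composition, which puts
  the last direction of a cube innermost: its two faces are \<open>Q\<^sub>n\<close> of the end
  inclusions of \<open>X\<close>, and every other face of \<open>Q\<^sub>n\<^sub>+\<^sub>1 X\<close>
  is a face of \<open>Q\<^sub>n\<close> at the object \<open>Q\<^sub>1 X\<close>. This is why it is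
  the last direction that is absorbed, and why colimits must be preserved: the glued object is
  formed first and \<open>Q\<^sub>n\<close> is applied to it. The induction has to run over all
  cofibrations at once, since its step replaces \<open>f\<close> by \<open>L\<close>. The second
  condition speaks of weak equivalences only; that the map with one end is also a cofibration
  follows from the first condition, by lifting at the opposite end beforehand.\<close>

context category
begin

lemma Id_simps [simp]:
  assumes "X \<in> Obj C"
  shows "Id C X \<in> Mor C" "Dom C (Id C X) = X" "Cod C (Id C X) = X"
  using Id_Hom[OF assms] by (simp_all add: Hom_def)

lemma Dom_Cod_Obj [simp]:
  assumes "f \<in> Mor C"
  shows "Dom C f \<in> Obj C" "Cod C f \<in> Obj C"
  using assms Dom_Obj Cod_Obj by auto

lemma Comp_simps [simp]:
  assumes "f \<in> Mor C" "g \<in> Mor C" "Cod C f = Dom C g"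
  shows "g \<cdot> f \<in> Mor C" "Dom C (g \<cdot> f) = Dom C f" "Cod C (g \<cdot> f) = Cod C g"
  using Comp_Hom[of f "Dom C f" "Cod C f" g "Cod C g"] assms by (auto simp: Hom_def)

lemma Comp_assoc_simp [simp]:
  assumes "f \<in> Mor C" "g \<in> Mor C" "h \<in> Mor C" "Cod C f = Dom C g" "Cod C g = Dom C h"
  shows "(h \<cdot> g) \<cdot> f = h \<cdot> (g \<cdot> f)"
  using Comp_assoc[of f "Dom C f" "Cod C f" g "Cod C g" h "Cod C h"] assms by (auto simp: Hom_def)

lemma Comp_Id_simps [simp]:
  assumes "f \<in> Mor C"
  shows "Dom C f = X \<Longrightarrow> f \<cdot> Id C X = f" "Cod C f = X \<Longrightarrow> Id C X \<cdot> f = f"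
  using Comp_Id[of f "Dom C f" "Cod C f"] Id_Comp[of f "Dom C f" "Cod C f"] assms
  by (auto simp: Hom_def)

lemma functor_simps [simp]:
  assumes "is_functor C C F"
  shows "X \<in> Obj C \<Longrightarrow> omap F X \<in> Obj C"
    and "f \<in> Mor C \<Longrightarrow> mmap F f \<in> Mor C"
    and "f \<in> Mor C \<Longrightarrow> Dom C (mmap F f) = omap F (Dom C f)"
    and "f \<in> Mor C \<Longrightarrow> Cod C (mmap F f) = omap F (Cod C f)"
    and "X \<in> Obj C \<Longrightarrow> mmap F (Id C X) = Id C (omap F X)"
    and "\<lbrakk>f \<in> Mor C; g \<in> Mor C; Cod C f = Dom C g\<rbrakk> \<Longrightarrow> mmap F (g \<cdot> f) = mmap F g \<cdot> mmap F f"
  using assms unfolding is_functor_def Hom_def by blast+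

lemma nat_trans_simps [simp]:
  assumes "is_nat_trans C C a"
  shows "is_functor C C (nt_dom a)" "is_functor C C (nt_cod a)"
    and "X \<in> Obj C \<Longrightarrow> nt_at a X \<in> Mor C"
    and "X \<in> Obj C \<Longrightarrow> Dom C (nt_at a X) = omap (nt_dom a) X"
    and "X \<in> Obj C \<Longrightarrow> Cod C (nt_at a X) = omap (nt_cod a) X"
  using assms unfolding is_nat_trans_def Hom_def by blast+

lemma naturality:
  assumes "is_nat_trans C C a" "f \<in> Mor C" "Dom C f = X" "Cod C f = Y"
  shows "mmap (nt_cod a) f \<cdot> nt_at a X = nt_at a Y \<cdot> mmap (nt_dom a) f"
  using assms unfolding is_nat_trans_def by blast

lemma functor_eqI:
  assumes "is_functor C C F" "is_functor C C G"
    and "\<And>X. X \<in> Obj C \<Longrightarrow> omap F X = omap G X"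
    and "\<And>f. f \<in> Mor C \<Longrightarrow> mmap F f = mmap G f"
  shows "F = (G :: ('o, 'm, 'o, 'm) cfunctor)"
proof (rule cfunctor.equality)
  have "omap F \<in> extensional (Obj C)" "omap G \<in> extensional (Obj C)"
    "mmap F \<in> extensional (Mor C)" "mmap G \<in> extensional (Mor C)"
    using assms(1,2) unfolding is_functor_def PiE_def by blast+
  then show "omap F = omap G" "mmap F = mmap G"
    using assms(3,4) by (blast intro: extensionalityI)+
qed simp

lemma nat_trans_eqI:
  assumes "is_nat_trans C C a" "is_nat_trans C C b"
    and "nt_dom a = nt_dom b" "nt_cod a = nt_cod b"
    and "\<And>X. X \<in> Obj C \<Longrightarrow> nt_at a X = nt_at b X"
  shows "a = (b :: ('o, 'm, 'o, 'm) nat_trans)"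
proof (rule nat_trans.equality)
  have "nt_at a \<in> extensional (Obj C)" "nt_at b \<in> extensional (Obj C)"
    using assms(1,2) unfolding is_nat_trans_def by blast+
  then show "nt_at a = nt_at b"
    using assms(5) by (blast intro: extensionalityI)
qed (use assms in simp_all)

lemma is_functor_id [simp]: "is_functor C C (id_functor C)"
  by (auto simp: is_functor_def id_functor_def Hom_def)

lemma is_functor_comp [simp]:
  assumes "is_functor C C F" "is_functor C C G"
  shows "is_functor C C (comp_functor C F G)"
  using assms by (subst is_functor_def) (auto simp: comp_functor_def Hom_def)

lemma id_functor_simps [simp]:
  "X \<in> Obj C \<Longrightarrow> omap (id_functor C) X = X" "f \<in> Mor C \<Longrightarrow> mmap (id_functor C) f = f"
  by (simp_all add: id_functor_def)

lemma comp_functor_simps [simp]: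
  "X \<in> Obj C \<Longrightarrow> omap (comp_functor C F G) X = omap F (omap G X)"
  "f \<in> Mor C \<Longrightarrow> mmap (comp_functor C F G) f = mmap F (mmap G f)"
  by (simp_all add: comp_functor_def)

lemma End_simps [simp]:
  "Obj (End C) = {F. is_functor C C F}" "Mor (End C) = {a. is_nat_trans C C a}"
  "Dom (End C) = nt_dom" "Cod (End C) = nt_cod" "munit (End C) = id_functor C"
  "otens (End C) = comp_functor C"
  by (simp_all add: End_def Fun_def category.extend_def)

lemma Id_End: "Id (End C) F = \<lparr>nt_dom = F, nt_cod = F, nt_at = (\<lambda>X\<in>Obj C. Id C (omap F X))\<rparr>"
  by (simp add: End_def Fun_def category.extend_def)

lemma Comp_End: "b \<cdot>\<^bsub>End C\<^esub> a = \<lparr>nt_dom = nt_dom a, nt_cod = nt_cod b,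
                     nt_at = (\<lambda>X\<in>Obj C. nt_at b X \<cdot> nt_at a X)\<rparr>"
  by (simp add: End_def Fun_def category.extend_def)

lemma mtens_End: "mtens (End C) a b = \<lparr>nt_dom = comp_functor C (nt_dom a) (nt_dom b),
                      nt_cod = comp_functor C (nt_cod a) (nt_cod b),
                      nt_at = (\<lambda>X\<in>Obj C. nt_at a (omap (nt_cod b) X) \<cdot> mmap (nt_dom a) (nt_at b X))\<rparr>"
  by (simp add: End_def Fun_def category.extend_def)

lemma nt_End_simps [simp]:
  "nt_dom (Id (End C) F) = F" "nt_cod (Id (End C) F) = F"
  "X \<in> Obj C \<Longrightarrow> nt_at (Id (End C) F) X = Id C (omap F X)"
  "nt_dom (b \<cdot>\<^bsub>End C\<^esub> a) = nt_dom a" "nt_cod (b \<cdot>\<^bsub>End C\<^esub> a) = nt_cod b"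
  "X \<in> Obj C \<Longrightarrow> nt_at (b \<cdot>\<^bsub>End C\<^esub> a) X = nt_at b X \<cdot> nt_at a X"
  "nt_dom (mtens (End C) a b) = comp_functor C (nt_dom a) (nt_dom b)"
  "nt_cod (mtens (End C) a b) = comp_functor C (nt_cod a) (nt_cod b)"
  "X \<in> Obj C \<Longrightarrow> nt_at (mtens (End C) a b) X = nt_at a (omap (nt_cod b) X) \<cdot> mmap (nt_dom a) (nt_at b X)"
  by (simp_all add: Id_End Comp_End mtens_End)

lemma is_nat_trans_Id [simp]: "is_functor C C F \<Longrightarrow> is_nat_trans C C (Id (End C) F)"
  by (auto simp: is_nat_trans_def Id_End Hom_def)

lemma is_nat_trans_Comp [simp]:
  assumes "is_nat_trans C C a" "is_nat_trans C C b" "nt_cod a = nt_dom b"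
  shows "is_nat_trans C C (b \<cdot>\<^bsub>End C\<^esub> a)"
proof -
  have "mmap (nt_cod b) f \<cdot> (nt_at b (Dom C f) \<cdot> nt_at a (Dom C f))
      = nt_at b (Cod C f) \<cdot> nt_at a (Cod C f) \<cdot> mmap (nt_dom a) f" if f: "f \<in> Mor C" for f
  proof -
    have "mmap (nt_cod b) f \<cdot> (nt_at b (Dom C f) \<cdot> nt_at a (Dom C f))
        = (mmap (nt_cod b) f \<cdot> nt_at b (Dom C f)) \<cdot> nt_at a (Dom C f)"
      using assms f by simp
    also have "\<dots> = nt_at b (Cod C f) \<cdot> (mmap (nt_cod a) f \<cdot> nt_at a (Dom C f))"
      using naturality[OF assms(2) f] assms f by simp
    also have "\<dots> = nt_at b (Cod C f) \<cdot> nt_at a (Cod C f) \<cdot> mmap (nt_dom a) f"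
      using naturality[OF assms(1) f] assms f by simp
    finally show ?thesis .
  qed
  then show ?thesis
    using assms by (subst is_nat_trans_def) (auto simp: Comp_End Hom_def)
qed

text \<open>Naturality of \<open>a\<close> at the image of \<open>f\<close> under
  \<open>nt_cod b\<close>, followed by the image under \<open>nt_dom a\<close> of the naturality of
  \<open>b\<close>.\<close>

lemma is_nat_trans_mtens [simp]:
  assumes a: "is_nat_trans C C a" and b: "is_nat_trans C C b"
  shows "is_nat_trans C C (mtens (End C) a b)"
proof -
  have "mmap (nt_cod a) (mmap (nt_cod b) f)
          \<cdot> (nt_at a (omap (nt_cod b) (Dom C f)) \<cdot> mmap (nt_dom a) (nt_at b (Dom C f)))
      = nt_at a (omap (nt_cod b) (Cod C f)) \<cdot> mmap (nt_dom a) (nt_at b (Cod C f))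
          \<cdot> mmap (nt_dom a) (mmap (nt_dom b) f)" if f: "f \<in> Mor C" for f
  proof -
    have "mmap (nt_cod a) (mmap (nt_cod b) f)
          \<cdot> (nt_at a (omap (nt_cod b) (Dom C f)) \<cdot> mmap (nt_dom a) (nt_at b (Dom C f)))
        = (mmap (nt_cod a) (mmap (nt_cod b) f) \<cdot> nt_at a (omap (nt_cod b) (Dom C f)))
          \<cdot> mmap (nt_dom a) (nt_at b (Dom C f))"
      using assms f by simp
    also have "mmap (nt_cod a) (mmap (nt_cod b) f) \<cdot> nt_at a (omap (nt_cod b) (Dom C f))
        = nt_at a (omap (nt_cod b) (Cod C f)) \<cdot> mmap (nt_dom a) (mmap (nt_cod b) f)"
      using assms f by (intro naturality) auto
    also have "nt_at a (omap (nt_cod b) (Cod C f)) \<cdot> mmap (nt_dom a) (mmap (nt_cod b) f)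
          \<cdot> mmap (nt_dom a) (nt_at b (Dom C f))
        = nt_at a (omap (nt_cod b) (Cod C f)) \<cdot> mmap (nt_dom a) (mmap (nt_cod b) f \<cdot> nt_at b (Dom C f))"
      using assms f by simp
    also have "mmap (nt_cod b) f \<cdot> nt_at b (Dom C f) = nt_at b (Cod C f) \<cdot> mmap (nt_dom b) f"
      using b f by (intro naturality) auto
    finally show ?thesis using assms f by simp
  qed
  then show ?thesis
    using assms by (subst is_nat_trans_def) (auto simp: mtens_End Hom_def)
qed

lemma category_End: "category (End C)"
proof
  fix f X Y assume "f \<in> Hom (End C) X Y"
  then show "f \<cdot>\<^bsub>End C\<^esub> Id (End C) X = f" "Id (End C) Y \<cdot>\<^bsub>End C\<^esub> f = f"
    by (auto intro!: nat_trans_eqI simp: Hom_def)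
next
  fix f g h W X Y Z assume "f \<in> Hom (End C) W X" "g \<in> Hom (End C) X Y" "h \<in> Hom (End C) Y Z"
  then show "h \<cdot>\<^bsub>End C\<^esub> g \<cdot>\<^bsub>End C\<^esub> f = h \<cdot>\<^bsub>End C\<^esub> (g \<cdot>\<^bsub>End C\<^esub> f)"
    by (intro nat_trans_eqI) (auto simp: Hom_def)
qed (auto simp: Hom_def)

end

text \<open>The record \<open>monoidal\<close> carries no laws. Stating them abstractly keeps
  components of natural transformations out of the extension argument.\<close>

locale strict_monoidal_category = category V for V :: "('p, 'n, 'z) monoidal_scheme" (structure) +
  assumes munit_Obj [simp]: "munit V \<in> Obj V"
    and otens_Obj [simp]: "\<lbrakk>X \<in> Obj V; Y \<in> Obj V\<rbrakk> \<Longrightarrow> otens V X Y \<in> Obj V"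
    and mtens_Mor [simp]: "\<lbrakk>f \<in> Mor V; g \<in> Mor V\<rbrakk> \<Longrightarrow> mtens V f g \<in> Mor V"
    and Dom_mtens [simp]: "\<lbrakk>f \<in> Mor V; g \<in> Mor V\<rbrakk> \<Longrightarrow> Dom V (mtens V f g) = otens V (Dom V f) (Dom V g)"
    and Cod_mtens [simp]: "\<lbrakk>f \<in> Mor V; g \<in> Mor V\<rbrakk> \<Longrightarrow> Cod V (mtens V f g) = otens V (Cod V f) (Cod V g)"
    and otens_assoc: "\<lbrakk>X \<in> Obj V; Y \<in> Obj V; Z \<in> Obj V\<rbrakk> \<Longrightarrow>
      otens V (otens V X Y) Z = otens V X (otens V Y Z)"
    and mtens_assoc: "\<lbrakk>f \<in> Mor V; g \<in> Mor V; h \<in> Mor V\<rbrakk> \<Longrightarrow>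
      mtens V (mtens V f g) h = mtens V f (mtens V g h)"
    and otens_munit [simp]: "X \<in> Obj V \<Longrightarrow> otens V (munit V) X = X" "X \<in> Obj V \<Longrightarrow> otens V X (munit V) = X"
    and mtens_munit [simp]: "f \<in> Mor V \<Longrightarrow> mtens V (Id V (munit V)) f = f"
      "f \<in> Mor V \<Longrightarrow> mtens V f (Id V (munit V)) = f"
    and mtens_Id [simp]: "\<lbrakk>X \<in> Obj V; Y \<in> Obj V\<rbrakk> \<Longrightarrow> mtens V (Id V X) (Id V Y) = Id V (otens V X Y)"
    and interchange: "\<lbrakk>f \<in> Mor V; g \<in> Mor V; f' \<in> Mor V; g' \<in> Mor V; Cod V f = Dom V f'; Cod V g = Dom V g'\<rbrakk> \<Longrightarrow>
      mtens V f' g' \<cdot> mtens V f g = mtens V (f' \<cdot> f) (g' \<cdot> g)"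

context category
begin

lemma mtens_End_interchange:
  assumes *: "is_nat_trans C C a" "is_nat_trans C C b" "is_nat_trans C C a'" "is_nat_trans C C b'"
    and **: "nt_cod a = nt_dom a'" "nt_cod b = nt_dom b'"
  shows "mtens (End C) a' b' \<cdot>\<^bsub>End C\<^esub> mtens (End C) a b
    = mtens (End C) (a' \<cdot>\<^bsub>End C\<^esub> a) (b' \<cdot>\<^bsub>End C\<^esub> b)" (is "?l = ?r")
proof (rule nat_trans_eqI)
  fix X assume X: "X \<in> Obj C"
  \<comment> \<open>Naturality of \<open>a\<close> at the component of \<open>b'\<close> exchanges
    the two middle factors; everything else is associativity and functoriality.\<close>
  have n: "mmap (nt_dom a') (nt_at b' X) \<cdot> nt_at a (omap (nt_dom b') X)
      = nt_at a (omap (nt_cod b') X) \<cdot> mmap (nt_dom a) (nt_at b' X)"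
    using * X naturality[of a "nt_at b' X"] by (simp add: **[symmetric])
  have "nt_at ?l X = nt_at a' (omap (nt_cod b') X) \<cdot>
      ((mmap (nt_dom a') (nt_at b' X) \<cdot> nt_at a (omap (nt_dom b') X)) \<cdot> mmap (nt_dom a) (nt_at b X))"
    using * ** X by simp
  also have "\<dots> = nt_at ?r X"
    unfolding n using * ** X by simp
  finally show "nt_at ?l X = nt_at ?r X" .
qed (use assms in simp_all)

text \<open>The laws hold as equalities and not merely up to isomorphism, because functors and
  transformations are extensional outside their carriers.\<close>

lemma strict_monoidal_category_End: "strict_monoidal_category (End C)"
proof (rule strict_monoidal_category.intro[OF category_End], unfold_locales)
  fix F G H assume "F \<in> Obj (End C)" "G \<in> Obj (End C)" "H \<in> Obj (End C)"
  then show "otens (End C) (otens (End C) F G) H = otens (End C) F (otens (End C) G H)"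
    by (auto intro!: functor_eqI)
next
  fix a b c assume "a \<in> Mor (End C)" "b \<in> Mor (End C)" "c \<in> Mor (End C)"
  then show "mtens (End C) (mtens (End C) a b) c = mtens (End C) a (mtens (End C) b c)"
    by (intro nat_trans_eqI functor_eqI) auto
next
  fix F assume "F \<in> Obj (End C)"
  then show "otens (End C) (munit (End C)) F = F" "otens (End C) F (munit (End C)) = F"
    by (auto intro!: functor_eqI)
next
  fix a assume "a \<in> Mor (End C)"
  then show "mtens (End C) (Id (End C) (munit (End C))) a = a"
    "mtens (End C) a (Id (End C) (munit (End C))) = a"
    by (auto intro!: nat_trans_eqI functor_eqI)
next
  fix F G assume "F \<in> Obj (End C)" "G \<in> Obj (End C)"
  then show "mtens (End C) (Id (End C) F) (Id (End C) G) = Id (End C) (otens (End C) F G)"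
    by (intro nat_trans_eqI) auto
qed (auto intro: mtens_End_interchange)

end

section \<open>Strict monoidal extension from cubes of dimension at most one\<close>

text \<open>Every map of cubes is a tensor product of identities of \<open>\<box>[1]\<close> (\<open>Wire\<close>), \<open>\<sigma>\<close> (\<open>Drop\<close>) and \<open>\<delta>\<^sup>e\<close>
  (\<open>Point e\<close>), hence a word in these letters. The word is unique up to exchanging adjacent letters
  \<open>Drop\<close> and \<open>Point e\<close>, which is an instance of the interchange law.\<close>

datatype letter = Wire | Drop | Point bool

fun src :: "letter list \<Rightarrow> nat" where
  "src [] = 0"
| "src (Wire # w) = Suc (src w)"
| "src (Drop # w) = Suc (src w)"
| "src (Point e # w) = src w"

fun tgt :: "letter list \<Rightarrow> nat" where
  "tgt [] = 0"
| "tgt (Wire # w) = Suc (tgt w)"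
| "tgt (Drop # w) = tgt w"
| "tgt (Point e # w) = Suc (tgt w)"

fun word_fun :: "letter list \<Rightarrow> bool list \<Rightarrow> bool list" where
  "word_fun [] xs = []"
| "word_fun (Wire # w) xs = hd xs # word_fun w (tl xs)"
| "word_fun (Drop # w) xs = word_fun w (tl xs)"
| "word_fun (Point e # w) xs = e # word_fun w xs"

definition word_map :: "letter list \<Rightarrow> cube_map" where
  "word_map w = (src w, tgt w, restrict (word_fun w) (cube_pts (src w)))"

text \<open>\<open>v\<close> after \<open>w\<close>, read from the left. A \<open>Point\<close> of
  \<open>v\<close> needs no input and a \<open>Drop\<close> of \<open>w\<close> gives no output, so
  these are passed on; otherwise an output of \<open>w\<close> meets an input of \<open>v\<close>.
  The order of the first two clauses fixes one of the possible words. For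
  \<open>tgt w = src v\<close> the last clause is reached only with both words empty.\<close>

fun word_comp :: "letter list \<Rightarrow> letter list \<Rightarrow> letter list" where
  "word_comp (Point e # v) w = Point e # word_comp v w"
| "word_comp v (Drop # w) = Drop # word_comp v w"
| "word_comp (Wire # v) (Wire # w) = Wire # word_comp v w"
| "word_comp (Wire # v) (Point e # w) = Point e # word_comp v w"
| "word_comp (Drop # v) (Wire # w) = Drop # word_comp v w"
| "word_comp (Drop # v) (Point e # w) = word_comp v w"
| "word_comp v w = []"

section \<open>Words as normal forms for maps of cubes\<close>

lemma src_tgt_append [simp]: "src (v @ w) = src v + src w" "tgt (v @ w) = tgt v + tgt w"
  by (induction v rule: src.induct) simp_all

lemma length_word_fun [simp]: "length (word_fun w xs) = tgt w"
  by (induction w xs rule: word_fun.induct) simp_all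

lemma word_fun_append:
  "length xs = src v + src w \<Longrightarrow>
    word_fun (v @ w) xs = word_fun v (take (src v) xs) @ word_fun w (drop (src v) xs)"
proof (induction v xs rule: word_fun.induct)
  case (2 v xs) then show ?case by (cases xs) simp_all
next
  case (3 v xs) then show ?case by (cases xs) simp_all
qed simp_all

lemma src_tgt_word_comp:
  "tgt w = src v \<Longrightarrow> src (word_comp v w) = src w \<and> tgt (word_comp v w) = tgt v"
  by (induction v w rule: word_comp.induct) simp_all

lemma word_fun_comp:
  "tgt w = src v \<Longrightarrow> word_fun (word_comp v w) xs = word_fun v (word_fun w xs)"
  by (induction v w arbitrary: xs rule: word_comp.induct) simp_all

lemma word_map_append: "word_map (v @ w) = cube_tensor (word_map v) (word_map w)"
  by (auto simp: word_map_def cube_tensor_def fun_eq_iff restrict_def cube_pts_def word_fun_append)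

lemma word_map_comp: "tgt w = src v \<Longrightarrow> word_map (word_comp v w) = cube_comp (word_map v) (word_map w)"
  by (auto simp: word_map_def cube_comp_def src_tgt_word_comp fun_eq_iff restrict_def compose_def
      cube_pts_def word_fun_comp)

lemma word_map_wires: "word_map (replicate n Wire) = cube_id n"
proof -
  have "src (replicate n Wire) = n" "tgt (replicate n Wire) = n" by (induction n) simp_all
  moreover have "length xs = n \<Longrightarrow> word_fun (replicate n Wire) xs = xs" for xs
    by (induction n arbitrary: xs) (auto simp: length_Suc_conv)
  ultimately show ?thesis
    by (auto simp: word_map_def cube_id_def cube_pts_def restrict_def fun_eq_iff)
qed

lemma word_map_letters:
  "word_map [] = cube_id 0" "word_map [Wire] = cube_id 1"
  "word_map [Drop] = sigma" "word_map [Point e] = delta e"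
  using word_map_wires[of 0] word_map_wires[of 1]
  by (auto simp: word_map_def sigma_def delta_def restrict_def fun_eq_iff cube_pts_def)

lemma fst_word_map [simp]: "fst (word_map w) = src w" "fst (snd (word_map w)) = tgt w"
  by (simp_all add: word_map_def)

text \<open>Words are closed under both operations of the inductive definition: concatenation yields
  tensor products and \<open>word_comp\<close> yields composites.\<close>

lemma cube_maps_eq: "cube_maps = range word_map"
proof
  show "cube_maps \<subseteq> range word_map"
  proof
    fix f assume "f \<in> cube_maps"
    then show "f \<in> range word_map"
    proof induction
      case (id n)
      show ?case unfolding word_map_wires[symmetric] by (rule rangeI)
    next
      case (delta e)
      show ?case unfolding word_map_letters(3,4)[symmetric] by (rule rangeI)
    next
      case sigma
      show ?case unfolding word_map_letters(3,4)[symmetric] by (rule rangeI)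
    next
      case (tensor f g)
      then obtain v w where "f = word_map v" "g = word_map w" by blast
      then show ?case by (simp flip: word_map_append)
    next
      case (comp f g)
      then obtain v w where "f = word_map v" "g = word_map w" by blast
      then show ?case using comp by (simp flip: word_map_comp)
    qed
  qed
  have "word_map w \<in> cube_maps" for w
  proof (induction w)
    case (Cons x w)
    have "word_map [x] \<in> cube_maps"
      by (cases x) (auto simp: word_map_letters intro: cube_maps.intros)
    then show ?case using Cons word_map_append[of "[x]" w] by (simp add: cube_maps.tensor)
  qed (simp add: word_map_letters cube_maps.id)
  then show "range word_map \<subseteq> cube_maps" by blast
qed

lemma word_map_eq_iff:
  "word_map v = word_map w \<longleftrightarrow>
    src v = src w \<and> tgt v = tgt w \<and> (\<forall>xs. length xs = src v \<longrightarrow> word_fun v xs = word_fun w xs)"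
  by (auto simp: word_map_def restrict_def fun_eq_iff cube_pts_def)

text \<open>Every input of the shorter words is the tail of an input of the longer ones, with an
  arbitrary first entry, which \<open>Wire\<close> or \<open>Drop\<close> strips off again.\<close>

lemma word_map_Cons_eqD: "word_map (x # v) = word_map (x # w) \<Longrightarrow> word_map v = word_map w"
proof (cases x)
  case (Point e)
  then show "word_map (x # v) = word_map (x # w) \<Longrightarrow> word_map v = word_map w"
    by (auto simp: word_map_eq_iff)
next
  case Wire
  assume *: "word_map (x # v) = word_map (x # w)"
  then have "word_fun v xs = word_fun w xs" if "length xs = src v" for xs
    using Wire that by (simp add: word_map_eq_iff) (metis list.sel(3) length_Cons)
  then show ?thesis using * Wire by (simp add: word_map_eq_iff)
next
  case Drop
  assume *: "word_map (x # v) = word_map (x # w)"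
  then have "word_fun v xs = word_fun w xs" if "length xs = src v" for xs
    using Drop that by (simp add: word_map_eq_iff) (metis list.sel(3) length_Cons)
  then show ?thesis using * Drop by (simp add: word_map_eq_iff)
qed

lemma word_fun_points [simp]: "word_fun (map Point es @ w) xs = es @ word_fun w xs"
  by (induction es) simp_all

lemma word_fun_drops [simp]: "word_fun (replicate k Drop @ w) xs = word_fun w (drop k xs)"
  by (induction k arbitrary: xs) (simp_all add: drop_Suc)

lemma src_tgt_blocks [simp]:
  "src (map Point es) = 0" "tgt (map Point es) = length es"
  "src (replicate k Drop) = k" "tgt (replicate k Drop) = 0"
  by (induction es, simp_all) (induction k, simp_all)+

text \<open>Before the first \<open>Point\<close> only \<open>Drop\<close> can occur: a
  \<open>Wire\<close> would copy an input to the first output, and that input takes both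
  values.\<close>

lemma constant_head_word:
  assumes "tgt w > 0" "\<And>xs. length xs = src w \<Longrightarrow> hd (word_fun w xs) = e"
  shows "\<exists>k w'. w = replicate k Drop @ Point e # w'"
  using assms
proof (induction w rule: src.induct)
  case (2 w)
  have "hd (word_fun (Wire # w) (False # replicate (src w) False)) = e"
    "hd (word_fun (Wire # w) (True # replicate (src w) False)) = e"
    by (rule 2; simp)+
  then show ?case by simp
next
  case (3 w)
  have "hd (word_fun w xs) = e" if "length xs = src w" for xs
    using 3(3)[of "False # xs"] that by simp
  then obtain k w' where "w = replicate k Drop @ Point e # w'" using 3 by auto
  then have "Drop # w = replicate (Suc k) Drop @ Point e # w'" by simp
  then show ?case by blast
next
  case (4 e' w)
  have "e' = e" using 4(3)[of "replicate (src w) False"] by simp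
  then have "Point e' # w = replicate 0 Drop @ Point e # w" by simp
  then show ?case by blast
qed simp

text \<open>An input without influence cannot meet a \<open>Wire\<close>, which copies it. A
  \<open>Point\<close> reads nothing, so only points can precede the \<open>Drop\<close> that reads
  the first input.\<close>

lemma independent_head_word:
  assumes "src w > 0"
    "\<And>xs. Suc (length xs) = src w \<Longrightarrow> word_fun w (False # xs) = word_fun w (True # xs)"
  shows "\<exists>es w'. w = map Point es @ Drop # w'"
  using assms
proof (induction w rule: src.induct)
  case (2 w)
  show ?case using 2(3)[of "replicate (src w) False"] by simp
next
  case (3 w)
  have "Drop # w = map Point [] @ Drop # w" by simp
  then show ?case by blast
next
  case (4 e w)
  then obtain es w' where "w = map Point es @ Drop # w'" by auto
  then have "Point e # w = map Point (e # es) @ Drop # w'" by simp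
  then show ?case by blast
qed simp

lemma cube_simps [simp]:
  "Obj cube = UNIV" "Mor cube = cube_maps" "Dom cube = fst" "Cod cube = (\<lambda>f. fst (snd f))"
  "Id cube = cube_id" "Comp cube = cube_comp" "munit cube = 0" "otens cube = (+)" "mtens cube = cube_tensor"
  by (simp_all add: cube_def)

lemma cube_id_word: "cube_id n = word_map (replicate n Wire)"
  by (simp add: word_map_wires)

context strict_monoidal_category
begin

fun otens_power :: "'p \<Rightarrow> nat \<Rightarrow> 'p" where
  "otens_power A 0 = munit V"
| "otens_power A (Suc n) = otens V A (otens_power A n)"

lemma otens_power_Obj [simp]: "A \<in> Obj V \<Longrightarrow> otens_power A n \<in> Obj V"
  by (induction n) simp_all

lemma otens_power_add:
  "A \<in> Obj V \<Longrightarrow> otens_power A (n + m) = otens V (otens_power A n) (otens_power A m)"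
  by (induction n) (simp_all add: otens_assoc)

end

section \<open>Existence and uniqueness of the strict monoidal extension\<close>

locale cubical_cylinder = strict_monoidal_category V
  for V :: "('p, 'n, 'z) monoidal_scheme" (structure) +
  fixes F :: "(nat, cube_map, 'p, 'n) cfunctor"
  assumes functor_F: "is_functor cube_le1 V F"
    and omap_F_0 [simp]: "omap F 0 = munit V"
begin

lemma cube_le1_simps:
  "Obj cube_le1 = {0, 1}" "Mor cube_le1 = {f \<in> cube_maps. fst f \<in> {0, 1} \<and> fst (snd f) \<in> {0, 1}}"
  "Dom cube_le1 = fst" "Cod cube_le1 = (\<lambda>f. fst (snd f))" "Id cube_le1 = cube_id" "Comp cube_le1 = cube_comp"
  by (auto simp: cube_le1_def full_subcategory_def)

lemma word_Mor_le1: "word_map w \<in> Mor cube_le1 \<longleftrightarrow> src w \<in> {0, 1} \<and> tgt w \<in> {0, 1}"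
  by (auto simp: cube_le1_simps cube_maps_eq)

lemma F_Mor:
  assumes "src w \<in> {0, 1}" "tgt w \<in> {0, 1}"
  shows "mmap F (word_map w) \<in> Hom V (omap F (src w)) (omap F (tgt w))"
proof -
  have "word_map w \<in> Mor cube_le1" using assms word_Mor_le1 by simp
  then have "mmap F (word_map w) \<in> Hom V (omap F (Dom cube_le1 (word_map w))) (omap F (Cod cube_le1 (word_map w)))"
    using functor_F unfolding is_functor_def by blast
  then show ?thesis by (simp add: cube_le1_simps)
qed

lemma F_Obj [simp]: "omap F (Suc 0) \<in> Obj V"
  using functor_F by (auto simp: is_functor_def cube_le1_simps)

lemma F_Comp:
  assumes "tgt w = src v" "src w \<in> {0, 1}" "tgt w \<in> {0, 1}" "tgt v \<in> {0, 1}"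
  shows "mmap F (word_map (word_comp v w)) = mmap F (word_map v) \<cdot> mmap F (word_map w)"
proof -
  have "word_map v \<in> Mor cube_le1" "word_map w \<in> Mor cube_le1"
    "Cod cube_le1 (word_map w) = Dom cube_le1 (word_map v)"
    using assms by (simp_all add: word_Mor_le1) (simp add: cube_le1_simps)
  then have "mmap F (word_map v \<cdot>\<^bsub>cube_le1\<^esub> word_map w) = mmap F (word_map v) \<cdot> mmap F (word_map w)"
    using functor_F unfolding is_functor_def by blast
  then have "mmap F (cube_comp (word_map v) (word_map w)) = mmap F (word_map v) \<cdot> mmap F (word_map w)"
    by (simp add: cube_le1_simps)
  then show ?thesis using assms by (simp add: word_map_comp)
qed

lemma F_Id: "mmap F (cube_id 0) = Id V (munit V)" "mmap F (cube_id 1) = Id V (omap F 1)"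
proof -
  have "\<forall>n\<in>{0, 1}. mmap F (cube_id n) = Id V (omap F n)"
    using functor_F unfolding is_functor_def cube_le1_simps by blast
  then show "mmap F (cube_id 0) = Id V (munit V)" "mmap F (cube_id 1) = Id V (omap F 1)"
    by simp_all
qed

definition letter_mor :: "letter \<Rightarrow> 'n" where
  "letter_mor x = mmap F (word_map [x])"

lemma letter_mor_simps [simp]:
  "letter_mor x \<in> Mor V" "Dom V (letter_mor x) = omap F (src [x])" "Cod V (letter_mor x) = omap F (tgt [x])"
  using F_Mor[of "[x]"] by (cases x; simp add: letter_mor_def Hom_def)+

lemma letter_mor_Wire [simp]: "letter_mor Wire = Id V (omap F (Suc 0))"
  using F_Id by (simp add: letter_mor_def word_map_letters)

text \<open>Together with the interchange law, this relation between the generators presents the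
  cube category.\<close>

lemma letter_mor_cancel [simp]: "letter_mor Drop \<cdot> letter_mor (Point e) = Id V (munit V)"
  using F_Comp[of "[Point e]" "[Drop]"] F_Id by (simp add: letter_mor_def word_map_letters)

abbreviation P :: "nat \<Rightarrow> 'p" where
  "P \<equiv> otens_power (omap F (Suc 0))"

fun word_mor :: "letter list \<Rightarrow> 'n" where
  "word_mor [] = Id V (munit V)"
| "word_mor (x # w) = mtens V (letter_mor x) (word_mor w)"

lemma word_mor_simps [simp]:
  "word_mor w \<in> Mor V" "Dom V (word_mor w) = P (src w)" "Cod V (word_mor w) = P (tgt w)"
proof -
  have "word_mor w \<in> Mor V \<and> Dom V (word_mor w) = P (src w) \<and> Cod V (word_mor w) = P (tgt w)"
    by (induction w rule: src.induct) simp_all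
  then show "word_mor w \<in> Mor V" "Dom V (word_mor w) = P (src w)" "Cod V (word_mor w) = P (tgt w)"
    by simp_all
qed

lemma word_mor_append: "word_mor (v @ w) = mtens V (word_mor v) (word_mor w)"
  by (induction v) (simp_all add: mtens_assoc)

lemma word_mor_wires: "word_mor (replicate n Wire) = Id V (P n)"
  by (induction n) simp_all

text \<open>The source of \<open>Point e\<close> is the unit, so the identity of the unit can be
  placed beside \<open>g\<close>. In \<open>Drop_interchange\<close> the unit is the target
  instead.\<close>

lemma Point_interchange:
  assumes "g \<in> Mor V" "g' \<in> Mor V" "Cod V g = Dom V g'"
  shows "mtens V (letter_mor (Point e)) (g' \<cdot> g) = mtens V (letter_mor (Point e)) g' \<cdot> g"
  using interchange[of "Id V (munit V)" g "letter_mor (Point e)" g'] assms by simp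

lemma Drop_interchange:
  assumes "g \<in> Mor V" "g' \<in> Mor V" "Cod V g = Dom V g'"
  shows "mtens V (letter_mor Drop) (g' \<cdot> g) = g' \<cdot> mtens V (letter_mor Drop) g"
  using interchange[of "letter_mor Drop" g "Id V (munit V)" g'] assms by simp

text \<open>Each clause of \<open>word_comp\<close> is an instance of the interchange law: an
  unpaired \<open>Point\<close> or \<open>Drop\<close> is composed with the identity of the unit,
  and a \<open>Drop\<close> meeting a \<open>Point e\<close> cancels.\<close>

lemma word_mor_comp:
  "tgt w = src v \<Longrightarrow> word_mor (word_comp v w) = word_mor v \<cdot> word_mor w"
proof (induction v w rule: word_comp.induct)
  case (1 e v w)
  then show ?case by (simp add: Point_interchange)
qed (simp_all add: Point_interchange Drop_interchange interchange)

text \<open>Both tensor products equal the composite of \<open>Drop\<close> and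
  \<open>Point e\<close> through the unit.\<close>

lemma word_mor_swap: "word_mor (Drop # Point e # w) = word_mor (Point e # Drop # w)"
proof -
  have "mtens V (letter_mor Drop) (letter_mor (Point e)) = letter_mor (Point e) \<cdot> letter_mor Drop"
    using Drop_interchange[of "Id V (munit V)" "letter_mor (Point e)"] by simp
  also have "\<dots> = mtens V (letter_mor (Point e)) (letter_mor Drop)"
    using Point_interchange[of "letter_mor Drop" "Id V (munit V)" e] by simp
  finally show ?thesis by (simp add: mtens_assoc[symmetric])
qed

lemma word_mor_drops: "word_mor (replicate k Drop @ Point e # w) = word_mor (Point e # replicate k Drop @ w)"
proof (induction k)
  case (Suc k)
  then show ?case using word_mor_swap[of e "replicate k Drop @ w"] by simp
qed simp

lemma word_mor_points: "word_mor (map Point es @ Drop # w) = word_mor (Drop # map Point es @ w)"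
proof (induction es)
  case (Cons e es)
  then show ?case using word_mor_swap[of e "map Point es @ w"] by simp
qed simp

text \<open>The first letter of \<open>v\<close> can be read off the function: constant first output, irrelevant first input,
  or neither. In each case \<open>w\<close> can be rearranged to begin with that letter, which is then cancelled.\<close>

lemma word_mor_cong: "word_map v = word_map w \<Longrightarrow> word_mor v = word_mor w"
proof (induction v arbitrary: w)
  case Nil
  then have "src w = 0" "tgt w = 0" by (simp_all add: word_map_eq_iff)
  then have "w = []" by (cases w rule: src.cases) simp_all
  then show ?case by simp
next
  case (Cons x v)
  have *: "src (x # v) = src w" "tgt (x # v) = tgt w"
    "\<And>xs. length xs = src (x # v) \<Longrightarrow> word_fun (x # v) xs = word_fun w xs"
    using Cons.prems by (auto simp: word_map_eq_iff)
  have "\<exists>w'. word_mor w = word_mor (x # w') \<and> word_map w = word_map (x # w')"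
  proof (cases x)
    case Wire
    show ?thesis
    proof (cases w rule: src.cases)
      case 1
      then show ?thesis using * Wire by simp
    next
      case (3 w')
      have "word_fun w (False # replicate (src v) False) = word_fun w (True # replicate (src v) False)"
        using 3 by simp
      then show ?thesis
        using *(3)[of "False # replicate (src v) False"] *(3)[of "True # replicate (src v) False"] Wire
        by simp (metis list.inject)
    next
      case (4 e w')
      then have "hd (word_fun w xs) = e" for xs by simp
      then show ?thesis
        using *(3)[of "(\<not> e) # replicate (src v) False"] Wire
        by (metis (full_types) length_Cons length_replicate list.sel(1) src.simps(2) word_fun.simps(2))
    qed (use Wire in blast)
  next
    case Drop
    have "src w > 0" using * Drop by simp
    moreover have "word_fun w (False # xs) = word_fun w (True # xs)" if "Suc (length xs) = src w" for xs
      using *(3)[of "False # xs"] *(3)[of "True # xs"] that *(1) Drop by simp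
    ultimately obtain es w' where w: "w = map Point es @ Drop # w'"
      using independent_head_word by blast
    have "word_map w = word_map (Drop # map Point es @ w')"
      unfolding w by (simp add: word_map_eq_iff)
    then show ?thesis using w word_mor_points Drop by metis
  next
    case (Point e)
    have "tgt w > 0" using * Point by simp
    moreover have "hd (word_fun w xs) = e" if "length xs = src w" for xs
      using *(3)[of xs] that *(1) Point by (metis list.sel(1) word_fun.simps(4))
    ultimately obtain k w' where w: "w = replicate k Drop @ Point e # w'"
      using constant_head_word by blast
    have "word_map w = word_map (Point e # replicate k Drop @ w')"
      unfolding w by (simp add: word_map_eq_iff)
    then show ?thesis using w word_mor_drops Point by metis
  qed
  then obtain w' where w': "word_mor w = word_mor (x # w')" "word_map w = word_map (x # w')" by blast
  then have "word_map v = word_map w'" using Cons.prems word_map_Cons_eqD by metis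
  then show ?case using Cons.IH w' by simp
qed

text \<open>The chosen word does not matter, by \<open>word_mor_cong\<close>. The restriction to
  \<open>cube_maps\<close> provides the extensionality that \<open>is_functor\<close>
  demands.\<close>

definition ext :: "(nat, cube_map, 'p, 'n) cfunctor" where
  "ext = \<lparr>omap = P, mmap = (\<lambda>f\<in>cube_maps. word_mor (SOME w. word_map w = f))\<rparr>"

lemma ext_word: "mmap ext (word_map w) = word_mor w"
proof -
  have "word_map (SOME v. word_map v = word_map w) = word_map w" by (rule someI) simp
  then show ?thesis using word_mor_cong[of "SOME v. word_map v = word_map w" w] by (simp add: ext_def cube_maps_eq)
qed

lemma omap_ext [simp]: "omap ext = P"
  by (simp add: ext_def)

lemma strict_monoidal_functor_ext: "strict_monoidal_functor cube V ext"
proof -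
  have "mmap ext \<in> extensional cube_maps" by (simp add: ext_def)
  moreover have "\<forall>f\<in>cube_maps. mmap ext f \<in> Hom V (P (fst f)) (P (fst (snd f)))"
    by (auto simp: cube_maps_eq ext_word Hom_def)
  moreover have "mmap ext (cube_id n) = Id V (P n)" for n
    by (simp add: cube_id_word ext_word word_mor_wires)
  moreover have "\<forall>f\<in>cube_maps. \<forall>g\<in>cube_maps. fst (snd f) = fst g \<longrightarrow>
      mmap ext (cube_comp g f) = mmap ext g \<cdot> mmap ext f"
    by (auto simp: cube_maps_eq word_map_comp[symmetric] ext_word word_mor_comp)
  moreover have "\<forall>f\<in>cube_maps. \<forall>g\<in>cube_maps. mmap ext (cube_tensor f g) = mtens V (mmap ext f) (mmap ext g)"
    by (auto simp: cube_maps_eq word_map_append[symmetric] ext_word word_mor_append)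
  ultimately show ?thesis
    by (simp add: strict_monoidal_functor_def is_functor_def otens_power_add PiE_def)
qed

text \<open>\<open>F\<close> is given on all maps between cubes of dimension at most one, not only
  on generators. The words in question are the empty one, the single letters, and
  \<open>Drop\<close> and \<open>Point e\<close> in either order. The last two denote a constant
  endomap of \<box>[1], on which functoriality determines \<open>F\<close>.\<close>

lemma ext_le1:
  assumes "\<theta> \<in> Mor cube_le1"
  shows "mmap ext \<theta> = mmap F \<theta>"
proof -
  obtain w where w: "\<theta> = word_map w" using assms by (auto simp: cube_le1_simps cube_maps_eq)
  then have "src w \<le> 1" "tgt w \<le> 1" using assms word_Mor_le1 by auto
  then have "word_mor w = mmap F (word_map w)"
  proof (induction w rule: length_induct)
    case (1 w)
    note st = \<open>src w \<le> 1\<close> \<open>tgt w \<le> 1\<close>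
    have empty: "v = []" if "src v = 0" "tgt v = 0" for v
      using that by (cases v rule: src.cases) simp_all
    have drop: "v = [Drop]" if "src v = 1" "tgt v = 0" for v
      using that empty by (cases v rule: src.cases) simp_all
    have point: "\<exists>e. v = [Point e]" if "src v = 0" "tgt v = 1" for v
      using that empty by (cases v rule: src.cases) simp_all
    have dp: "mmap F (word_map [Drop, Point e]) = mmap F (word_map [Point e, Drop])" for e
      by (rule arg_cong[of _ _ "mmap F"]) (simp add: word_map_eq_iff length_Suc_conv)
    have pd: "mmap F (word_map [Point e, Drop]) = word_mor [Point e, Drop]" for e
      using F_Comp[of "[Drop]" "[Point e]", folded letter_mor_def]
        Point_interchange[of "letter_mor Drop" "Id V (munit V)" e]
      by simp
    show ?case
    proof (cases w rule: src.cases)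
      case 1
      then show ?thesis by (simp add: word_map_letters F_Id)
    next
      case (2 v)
      then have "v = []" using st empty by simp
      then show ?thesis using 2 F_Id(2) by (simp add: word_map_letters)
    next
      case (3 v)
      then consider "v = []" | e where "v = [Point e]" using st empty point
        by (cases "tgt v") auto
      then show ?thesis
      proof cases
        case 1
        then show ?thesis using 3 by (simp flip: letter_mor_def)
      next
        case (2 e)
        then show ?thesis using 3 word_mor_swap[of e "[]"] dp pd by metis
      qed
    next
      case (4 e v)
      then consider "v = []" | "v = [Drop]" using st empty drop
        by (cases "src v") auto
      then show ?thesis
      proof cases
        case 1
        then show ?thesis using 4 by (simp flip: letter_mor_def)
      next
        case 2
        then show ?thesis using 4 pd by metis
      qed
    qed
  qed
  then show ?thesis using w ext_word by simp
qed

definition extends :: "(nat, cube_map, 'p, 'n) cfunctor \<Rightarrow> bool" where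
  "extends E \<longleftrightarrow> strict_monoidal_functor cube V E \<and>
     (\<forall>n\<in>Obj cube_le1. omap E n = omap F n) \<and> (\<forall>\<theta>\<in>Mor cube_le1. mmap E \<theta> = mmap F \<theta>)"

lemma extends_ext: "extends ext"
  using strict_monoidal_functor_ext ext_le1 by (auto simp: extends_def cube_le1_simps)

text \<open>Strict monoidality forces tensor powers on objects. On maps, \<open>delta\<close> and
  \<open>sigma\<close> lie in dimension at most one, identities are preserved, and the two closure
  rules are preserved by any strict monoidal functor.\<close>

lemma extends_unique:
  assumes "extends E"
  shows "E = ext"
proof (rule cfunctor.equality)
  note * = extends_ext[unfolded extends_def] assms[unfolded extends_def]
  have "omap E n = P n" for n
  proof (induction n)
    case 0
    then show ?case using * by (simp add: strict_monoidal_functor_def)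
  next
    case (Suc n)
    have "\<forall>m. omap E (m + n) = otens V (omap E m) (omap E n)"
      using * unfolding strict_monoidal_functor_def by simp
    from spec[OF this, of 1] have "omap E (Suc n) = otens V (omap E 1) (omap E n)" by simp
    moreover have "omap E 1 = omap F 1" using * by (simp add: cube_le1_simps)
    ultimately show ?case using Suc by simp
  qed
  then show o: "omap E = omap ext" by auto
  have le1: "mmap E f = mmap ext f" if "f \<in> Mor cube_le1" for f
    using * that by simp
  have "mmap E f = mmap ext f" if "f \<in> cube_maps" for f
    using that
  proof induction
    case (id n)
    have "mmap E (Id cube n) = Id V (omap E n)" "mmap ext (Id cube n) = Id V (omap ext n)"
      using * unfolding strict_monoidal_functor_def is_functor_def by auto
    then show ?case using o by simp
  next
    case (delta e)
    show ?case by (rule le1) (simp add: cube_le1_simps cube_maps.delta, simp add: delta_def)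
  next
    case sigma
    show ?case by (rule le1) (simp add: cube_le1_simps cube_maps.sigma, simp add: sigma_def)
  next
    case (tensor f g)
    then have "mmap E (mtens cube f g) = mtens V (mmap E f) (mmap E g)"
      "mmap ext (mtens cube f g) = mtens V (mmap ext f) (mmap ext g)"
      using * unfolding strict_monoidal_functor_def by auto
    then show ?case using tensor by simp
  next
    case (comp f g)
    then have "mmap E (g \<cdot>\<^bsub>cube\<^esub> f) = mmap E g \<cdot> mmap E f"
      "mmap ext (g \<cdot>\<^bsub>cube\<^esub> f) = mmap ext g \<cdot> mmap ext f"
      using * unfolding strict_monoidal_functor_def is_functor_def by auto
    then show ?case using comp by simp
  qed
  moreover have "mmap E \<in> extensional cube_maps" "mmap ext \<in> extensional cube_maps"
    using * by (auto simp: strict_monoidal_functor_def is_functor_def)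
  ultimately show "mmap E = mmap ext"
    by (intro extensionalityI[of _ cube_maps]) auto
qed simp

lemma ex1_extends: "\<exists>!E. extends E"
  using extends_ext extends_unique by blast

end

lemma (in category) monoidal_extension:
  assumes "natural_cylinder C Q"
  shows "strict_monoidal_functor cube (End C) (monoidal_extension C Q)"
    and "n \<in> Obj cube_le1 \<Longrightarrow> omap (monoidal_extension C Q) n = omap Q n"
    and "\<theta> \<in> Mor cube_le1 \<Longrightarrow> mmap (monoidal_extension C Q) \<theta> = mmap Q \<theta>"
proof -
  interpret V: strict_monoidal_category "End C" by (rule strict_monoidal_category_End)
  \<comment> \<open>\<open>End C\<close> is \<open>Fun C C\<close> with monoidal fields added, so
    functors into either are the same.\<close>
  have "is_functor cube_le1 (End C) Q \<longleftrightarrow> is_functor cube_le1 (Fun C C) Q"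
    unfolding is_functor_def by (simp add: Hom_def End_def Fun_def category.extend_def)
  then interpret cubical_cylinder "End C" Q
    using assms by unfold_locales (auto simp: natural_cylinder_def)
  have "monoidal_extension C Q = (THE E. extends E)"
    unfolding monoidal_extension_def extends_def ..
  then have "extends (monoidal_extension C Q)" using theI'[OF ex1_extends] by simp
  then show "strict_monoidal_functor cube (End C) (monoidal_extension C Q)"
    "n \<in> Obj cube_le1 \<Longrightarrow> omap (monoidal_extension C Q) n = omap Q n"
    "\<theta> \<in> Mor cube_le1 \<Longrightarrow> mmap (monoidal_extension C Q) \<theta> = mmap Q \<theta>"
    by (auto simp: extends_def)
qed

section \<open>Pushouts, initial objects and coproducts\<close>

text \<open>The objects \<open>1 \<leftarrow> 0 \<rightarrow> 2\<close>, their identities under the same numbers, and the two arrows \<open>3\<close> and \<open>4\<close>.\<close>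

definition span_shape :: "(nat, nat) category" where
  "span_shape = \<lparr>Obj = {0, 1, 2}, Mor = {0, 1, 2, 3, 4}, Dom = (\<lambda>u. if u \<ge> 3 then 0 else u),
     Cod = (\<lambda>u. if u = 3 then 1 else if u = 4 then 2 else u), Id = (\<lambda>u. u),
     Comp = (\<lambda>v u. if v \<le> 2 then u else v)\<rparr>"

definition empty_shape :: "(nat, nat) category" where
  "empty_shape = \<lparr>Obj = {}, Mor = {}, Dom = id, Cod = id, Id = id, Comp = (\<lambda>v u. u)\<rparr>"

lemma span_shape_simps [simp]:
  "Obj span_shape = {0, 1, 2}" "Mor span_shape = {0, 1, 2, 3, 4}"
  "Dom span_shape = (\<lambda>u. if u \<ge> 3 then 0 else u)"
  "Cod span_shape = (\<lambda>u. if u = 3 then 1 else if u = 4 then 2 else u)"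
  "Id span_shape = (\<lambda>u. u)" "Comp span_shape = (\<lambda>v u. if v \<le> 2 then u else v)"
  by (simp_all add: span_shape_def)

lemma finite_span_shape: "finite_category span_shape"
proof -
  have "category span_shape"
    by unfold_locales (auto simp: Hom_def split: if_splits)
  then show ?thesis by (simp add: finite_category_def)
qed

lemma finite_empty_shape: "finite_category empty_shape"
proof -
  have "category empty_shape"
    by unfold_locales (auto simp: Hom_def empty_shape_def)
  then show ?thesis by (simp add: finite_category_def empty_shape_def)
qed

definition span :: "('o, 'm, 'z) category_scheme \<Rightarrow> 'm \<Rightarrow> 'm \<Rightarrow> (nat, nat, 'o, 'm) cfunctor" where
  "span C f g =
     \<lparr>omap = (\<lambda>j\<in>{0, 1, 2}. if j = 0 then Dom C f else if j = 1 then Cod C f else Cod C g),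
      mmap = (\<lambda>u\<in>{0, 1, 2, 3, 4}. if u = 0 then Id C (Dom C f) else if u = 1 then Id C (Cod C f)
        else if u = 2 then Id C (Cod C g) else if u = 3 then f else g)\<rparr>"

context category
begin

lemma is_functor_span:
  assumes "f \<in> Mor C" "g \<in> Mor C" "Dom C f = Dom C g"
  shows "is_functor span_shape C (span C f g)"
  using assms unfolding is_functor_def by (simp add: span_def Hom_def)

lemma is_cocone_span_iff:
  assumes "f \<in> Mor C" "g \<in> Mor C" "Dom C f = Dom C g"
  shows "is_cocone span_shape C (span C f g) X t \<longleftrightarrow>
    t 0 = t 1 \<cdot> f \<and> t 1 \<cdot> f = t 2 \<cdot> g \<and> t 1 \<in> Hom C (Cod C f) X \<and> t 2 \<in> Hom C (Cod C g) X"
  using assms unfolding is_cocone_def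
  by (auto simp: span_def Hom_def)

text \<open>Preservation of colimits is stated for functors on index categories, so pushout squares
  are translated to that form and back. The leg at the vertex \<open>0\<close> of the span is forced
  to be \<open>a \<cdot> f\<close>.\<close>

lemma pushout_colimit:
  assumes po: "is_pushout C f g a b"
  shows "is_colimit span_shape C (span C f g) (Cod C a) (\<lambda>j. if j = 0 then a \<cdot> f else if j = 1 then a else b)"
    (is "is_colimit _ _ _ _ ?t")
proof -
  have fg: "f \<in> Mor C" "g \<in> Mor C" "Dom C f = Dom C g" using po by (auto simp: is_pushout_def)
  show ?thesis
    unfolding is_colimit_def is_cocone_span_iff[OF fg]
  proof (intro conjI allI impI)
    show "?t 1 \<in> Hom C (Cod C f) (Cod C a)" "?t 2 \<in> Hom C (Cod C g) (Cod C a)"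
      "?t 0 = ?t 1 \<cdot> f" "?t 1 \<cdot> f = ?t 2 \<cdot> g"
      using po by (auto simp: is_pushout_def Hom_def)
    fix Y and s :: "nat \<Rightarrow> 'm"
    assume s: "s 0 = s 1 \<cdot> f \<and> s 1 \<cdot> f = s 2 \<cdot> g \<and> s 1 \<in> Hom C (Cod C f) Y \<and> s 2 \<in> Hom C (Cod C g) Y"
    have "\<exists>!h. h \<in> Hom C (Cod C a) Y \<and> h \<cdot> a = s 1 \<and> h \<cdot> b = s 2"
      using po s unfolding is_pushout_def by blast
    moreover have "(\<forall>j\<in>Obj span_shape. h \<cdot> ?t j = s j) \<longleftrightarrow> h \<cdot> a = s 1 \<and> h \<cdot> b = s 2"
      if "h \<in> Hom C (Cod C a) Y" for h
    proof -
      have "h \<cdot> (a \<cdot> f) = (h \<cdot> a) \<cdot> f" using that po by (simp add: is_pushout_def Hom_def)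
      then show ?thesis using s by auto
    qed
    ultimately show "\<exists>!h. h \<in> Hom C (Cod C a) Y \<and> (\<forall>j\<in>Obj span_shape. h \<cdot> ?t j = s j)"
      by (metis (no_types, lifting))
  qed
qed

lemma colimit_pushout:
  assumes fg: "f \<in> Mor C" "g \<in> Mor C" "Dom C f = Dom C g"
    and colim: "is_colimit span_shape C (span C f g) X t"
  shows "is_pushout C f g (t 1) (t 2)"
proof -
  have t: "t 0 = t 1 \<cdot> f" "t 1 \<cdot> f = t 2 \<cdot> g" "t 1 \<in> Hom C (Cod C f) X" "t 2 \<in> Hom C (Cod C g) X"
    using colim unfolding is_colimit_def is_cocone_span_iff[OF fg] by blast+
  have "\<exists>!h. h \<in> Hom C X Z \<and> h \<cdot> t 1 = p \<and> h \<cdot> t 2 = q"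
    if "p \<in> Hom C (Cod C f) Z" "q \<in> Hom C (Cod C g) Z" "p \<cdot> f = q \<cdot> g" for Z p q
  proof -
    define s where "s j = (if j = 0 then p \<cdot> f else if j = 1 then p else q)" for j :: nat
    have "is_cocone span_shape C (span C f g) Z s"
      unfolding is_cocone_span_iff[OF fg] using that by (simp add: s_def)
    then have "\<exists>!h. h \<in> Hom C X Z \<and> (\<forall>j\<in>Obj span_shape. h \<cdot> t j = s j)"
      using colim unfolding is_colimit_def by blast
    moreover have "(\<forall>j\<in>Obj span_shape. h \<cdot> t j = s j) \<longleftrightarrow> h \<cdot> t 1 = p \<and> h \<cdot> t 2 = q"
      if "h \<in> Hom C X Z" for h
    proof -
      have "h \<cdot> t 0 = (h \<cdot> t 1) \<cdot> f" using that t fg by (simp add: Hom_def)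
      then show ?thesis by (auto simp: s_def)
    qed
    ultimately show ?thesis by (metis (no_types, lifting))
  qed
  then show ?thesis using fg t unfolding is_pushout_def by (simp add: Hom_def)
qed

lemma preserves_pushouts:
  assumes F: "is_functor C C F" "preserves_finite_colimits C C F" and po: "is_pushout C f g a b"
  shows "is_pushout C (mmap F f) (mmap F g) (mmap F a) (mmap F b)"
proof -
  have fg: "f \<in> Mor C" "g \<in> Mor C" "Dom C f = Dom C g" using po by (auto simp: is_pushout_def)
  have "comp_functor span_shape F (span C f g) = span C (mmap F f) (mmap F g)"
    using fg F(1) by (simp add: comp_functor_def span_def restrict_def fun_eq_iff)
  moreover have "is_colimit span_shape C (comp_functor span_shape F (span C f g)) (omap F (Cod C a))
      (\<lambda>j. mmap F (if j = 0 then a \<cdot> f else if j = 1 then a else b))"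
    using F(2) pushout_colimit[OF po] finite_span_shape is_functor_span[OF fg]
    unfolding preserves_finite_colimits_def by blast
  ultimately show ?thesis
    using colimit_pushout[of "mmap F f" "mmap F g"] fg F(1) by fastforce
qed

lemma pushout_exists:
  assumes "has_finite_colimits C" and fg: "f \<in> Mor C" "g \<in> Mor C" "Dom C f = Dom C g"
  shows "\<exists>a b. is_pushout C f g a b"
proof -
  obtain X t where "is_colimit span_shape C (span C f g) X t"
    using assms(1) finite_span_shape is_functor_span[OF fg] unfolding has_finite_colimits_def by blast
  then show ?thesis using colimit_pushout[OF fg] by blast
qed

lemma initial_exists:
  assumes "has_finite_colimits C"
  shows "\<exists>I. is_initial C I"
proof -
  \<comment> \<open>Over empty carriers extensionality forces the value \<open>undefined\<close>
    everywhere.\<close>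
  define F :: "(nat, nat, 'o, 'm) cfunctor" where "F = \<lparr>omap = \<lambda>_. undefined, mmap = \<lambda>_. undefined\<rparr>"
  have "is_functor empty_shape C F"
    unfolding is_functor_def by (simp add: empty_shape_def F_def)
  then obtain X t where X: "is_colimit empty_shape C F X t"
    using assms finite_empty_shape unfolding has_finite_colimits_def by blast
  then have "is_initial C X"
    by (simp add: is_initial_def is_colimit_def is_cocone_def empty_shape_def)
  then show ?thesis ..
qed

text \<open>A pushout over an initial object, where any two maps are automatically
  compatible.\<close>

lemma coproduct_exists:
  assumes "has_finite_colimits C" "X \<in> Obj C" "Y \<in> Obj C"
  shows "\<exists>i j. is_coproduct C X Y i j"
proof -
  obtain I where I: "is_initial C I" using initial_exists[OF assms(1)] by blast
  then obtain x y where x: "x \<in> Hom C I X" and y: "y \<in> Hom C I Y"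
    using assms by (meson is_initial_def)
  then obtain a b where po: "is_pushout C x y a b"
    using pushout_exists[OF assms(1), of x y] by (auto simp: Hom_def)
  have "p \<cdot> x = q \<cdot> y" if "p \<in> Hom C X Z" "q \<in> Hom C Y Z" for p q Z
  proof -
    have "p \<cdot> x \<in> Hom C I Z" "q \<cdot> y \<in> Hom C I Z" "Z \<in> Obj C"
      using x y that by (auto simp: Hom_def)
    then show ?thesis using I unfolding is_initial_def by blast
  qed
  moreover have "Cod C x = X" "Cod C y = Y" using x y by (simp_all add: Hom_def)
  ultimately have "is_coproduct C X Y a b"
    using po unfolding is_coproduct_def is_pushout_def by (elim conjE) simp
  then show ?thesis by blast
qed

text \<open>Serves the cofibrancy clause of \<open>homotopical\<close>, which ranges over all
  initial objects.\<close>

lemma initial_Hom_iso: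
  assumes "is_initial C I" "is_initial C J" "f \<in> Hom C I J"
  shows "is_iso C f"
proof -
  have "\<exists>!u. u \<in> Hom C I I" "\<exists>!u. u \<in> Hom C J J" "\<exists>!u. u \<in> Hom C J I"
    using assms by (auto simp: is_initial_def)
  then obtain g where g: "g \<in> Hom C J I" by blast
  then have "g \<cdot> f \<in> Hom C I I" "f \<cdot> g \<in> Hom C J J" "Id C I \<in> Hom C I I" "Id C J \<in> Hom C J J"
    using assms by (auto simp: Hom_def is_initial_def)
  then have "g \<cdot> f = Id C I" "f \<cdot> g = Id C J"
    using assms by (auto simp: is_initial_def)
  then show ?thesis using g assms(3) by (auto simp: is_iso_def Hom_def)
qed

section \<open>Universal properties of pushouts and coproducts as rules for
  \<open>induced\<close>\<close>

lemma pushoutD: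
  assumes "is_pushout C f g a b"
  shows "f \<in> Mor C" "g \<in> Mor C" "Dom C g = Dom C f" "a \<in> Mor C" "b \<in> Mor C"
    "Dom C a = Cod C f" "Dom C b = Cod C g" "Cod C b = Cod C a" "a \<cdot> f = b \<cdot> g"
  using assms by (auto simp: is_pushout_def)

lemma pushout_ex1:
  assumes "is_pushout C f g a b" "p \<in> Hom C (Cod C f) Z" "q \<in> Hom C (Cod C g) Z" "p \<cdot> f = q \<cdot> g"
  shows "\<exists>!h. h \<in> Hom C (Cod C a) Z \<and> h \<cdot> a = p \<and> h \<cdot> b = q"
  using assms unfolding is_pushout_def by blast

lemma induced_pushout:
  assumes "is_pushout C f g a b" "p \<in> Hom C (Cod C f) Z" "q \<in> Hom C (Cod C g) Z" "p \<cdot> f = q \<cdot> g"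
  shows "induced C a b p q \<in> Hom C (Cod C a) Z" "induced C a b p q \<cdot> a = p" "induced C a b p q \<cdot> b = q"
proof -
  have "Cod C p = Z" using assms(2) by (simp add: Hom_def)
  then show "induced C a b p q \<in> Hom C (Cod C a) Z" "induced C a b p q \<cdot> a = p" "induced C a b p q \<cdot> b = q"
    using theI'[OF pushout_ex1[OF assms]] by (simp_all add: induced_def)
qed

lemma coproductD:
  assumes "is_coproduct C X Y i j"
  shows "i \<in> Mor C" "j \<in> Mor C" "Dom C i = X" "Dom C j = Y" "Cod C j = Cod C i"
  using assms by (auto simp: is_coproduct_def)

lemma coproduct_ex1:
  assumes "is_coproduct C X Y i j" "p \<in> Hom C X Z" "q \<in> Hom C Y Z"
  shows "\<exists>!h. h \<in> Hom C (Cod C i) Z \<and> h \<cdot> i = p \<and> h \<cdot> j = q"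
  using assms unfolding is_coproduct_def by blast

lemma induced_coproduct:
  assumes "is_coproduct C X Y i j" "p \<in> Hom C X Z" "q \<in> Hom C Y Z"
  shows "induced C i j p q \<in> Hom C (Cod C i) Z" "induced C i j p q \<cdot> i = p" "induced C i j p q \<cdot> j = q"
proof -
  have "Cod C p = Z" using assms(2) by (simp add: Hom_def)
  then show "induced C i j p q \<in> Hom C (Cod C i) Z" "induced C i j p q \<cdot> i = p" "induced C i j p q \<cdot> j = q"
    using theI'[OF coproduct_ex1[OF assms]] by (simp_all add: induced_def)
qed

lemma coproduct_eqI:
  assumes "is_coproduct C X Y i j" "p \<in> Hom C (Cod C i) Z" "q \<in> Hom C (Cod C i) Z"
    and "p \<cdot> i = q \<cdot> i" "p \<cdot> j = q \<cdot> j"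
  shows "p = q"
proof -
  have "q \<cdot> i \<in> Hom C X Z" "q \<cdot> j \<in> Hom C Y Z"
    using coproductD[OF assms(1)] assms(3) by (auto simp: Hom_def)
  from coproduct_ex1[OF assms(1) this] show ?thesis using assms(2-) by blast
qed

end

section \<open>Iterated cylinders and their faces\<close>

lemma word_coface: "k < n \<Longrightarrow> coface n k e = word_map (replicate k Wire @ Point e # replicate (n - 1 - k) Wire)"
  unfolding coface_def cube_id_word word_map_letters(4)[symmetric] word_map_append[symmetric] by simp

lemma src_tgt_wires [simp]: "src (replicate k Wire) = k" "tgt (replicate k Wire) = k"
  by (induction k) simp_all

lemma word_fun_wires:
  "word_fun (replicate k Wire @ w) xs = take k xs @ word_fun w (drop k xs)" if "k \<le> length xs"
  using that
proof (induction k arbitrary: xs)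
  case (Suc k)
  then show ?case by (cases xs) simp_all
qed simp

lemma word_fun_only_wires: "length xs = k \<Longrightarrow> word_fun (replicate k Wire) xs = xs"
  using word_fun_wires[of k xs "[]"] by simp

lemma coface_Mor: "k < n \<Longrightarrow> coface n k e \<in> cube_maps"
  by (simp add: word_coface cube_maps_eq)

lemma coface_Dom_Cod [simp]: "k < n \<Longrightarrow> fst (coface n k e) = n - 1" "k < n \<Longrightarrow> fst (snd (coface n k e)) = n"
  by (simp_all add: word_coface)

text \<open>Both sides insert \<open>e\<close> at position \<open>k\<close> and \<open>e'\<close> at
  position \<open>l + 1\<close> of the resulting list. This identity governs how the faces of a box
  agree on their intersections.\<close>

lemma coface_coface:
  assumes "k \<le> l" "l \<le> n"
  shows "cube_comp (coface (Suc (Suc n)) (Suc l) e') (coface (Suc n) k e)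
    = cube_comp (coface (Suc (Suc n)) k e) (coface (Suc n) l e')"
proof -
  let ?w = "\<lambda>n k e. replicate k Wire @ Point e # replicate (n - k) Wire"
  have c: "coface (Suc n) k e = word_map (?w n k e)" if "k \<le> n" for n k e
    using that by (simp add: word_coface)
  have f: "word_fun (?w n k e) xs = take k xs @ e # drop k xs" if "length xs = n" "k \<le> n" for n k e xs
    using that by (simp add: word_fun_wires word_fun_only_wires)
  have "word_map (word_comp (?w (Suc n) (Suc l) e') (?w n k e)) = word_map (word_comp (?w (Suc n) k e) (?w n l e'))"
    unfolding word_map_eq_iff
  proof (intro conjI allI impI)
    fix xs :: "bool list" assume "length xs = src (word_comp (?w (Suc n) (Suc l) e') (?w n k e))"
    then have xs: "length xs = n" using assms by (simp add: src_tgt_word_comp)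
    obtain d where d: "l = k + d" using assms le_Suc_ex by blast
    let ?ys = "take k xs @ e # drop k xs" and ?zs = "take l xs @ e' # drop l xs"
    have "word_fun (?w (Suc n) (Suc l) e') ?ys = take (Suc l) ?ys @ e' # drop (Suc l) ?ys"
      using xs assms by (intro f) simp_all
    also have "\<dots> = take k xs @ e # take d (drop k xs) @ e' # drop l xs"
      using xs assms by (simp add: d Suc_diff_le add.commute)
    also have "\<dots> = take k ?zs @ e # drop k ?zs"
      using xs assms by (simp add: d take_add)
    also have "\<dots> = word_fun (?w (Suc n) k e) ?zs"
      using xs assms by (intro f[symmetric]) simp_all
    also have "?zs = word_fun (?w n l e') xs"
      using xs assms by (intro f[symmetric]) simp_all
    also have "?ys = word_fun (?w n k e) xs"
      using xs assms by (intro f[symmetric]) simp_all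
    finally show "word_fun (word_comp (?w (Suc n) (Suc l) e') (?w n k e)) xs =
        word_fun (word_comp (?w (Suc n) k e) (?w n l e')) xs"
      using assms by (simp add: word_fun_comp)
  qed (use assms in \<open>simp_all add: src_tgt_word_comp\<close>)
  then show ?thesis using assms by (simp add: c word_map_comp)
qed

lemma coface_1: "coface (Suc 0) 0 e = delta e"
  by (simp add: word_coface word_map_letters)

locale model_cylinder = model_category M for M :: "('o, 'm, 'z) model_category_scheme" (structure) +
  fixes Q :: "('o, 'm) cube_action"
  assumes cylinder: "natural_cylinder M Q"
    and preserves: "preserves_finite_colimits M M (cyl Q)"
begin

section \<open>Components of the extension and of its structure maps\<close>

definition E :: "('o, 'm) cube_action" where
  "E = monoidal_extension M Q"

abbreviation QO :: "nat \<Rightarrow> 'o \<Rightarrow> 'o" where "QO n \<equiv> omap (omap E n)"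
abbreviation QM :: "nat \<Rightarrow> 'm \<Rightarrow> 'm" where "QM n \<equiv> mmap (omap E n)"
abbreviation NT :: "cube_map \<Rightarrow> 'o \<Rightarrow> 'm" where "NT \<theta> \<equiv> nt_at (mmap E \<theta>)"

lemma strict_monoidal_functor_E: "strict_monoidal_functor cube (End M) E"
  unfolding E_def by (rule monoidal_extension[OF cylinder])

lemma functor_E: "is_functor cube (End M) E"
  using strict_monoidal_functor_E unfolding strict_monoidal_functor_def by blast

lemma functor_power [simp]: "is_functor M M (omap E n)"
  using functor_E unfolding is_functor_def[of cube] by auto

lemma omap_E_0 [simp]: "omap E 0 = id_functor M"
  using strict_monoidal_functor_E unfolding strict_monoidal_functor_def by simp

lemma omap_E_1: "omap E (Suc 0) = cyl Q" "omap E 1 = cyl Q"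
  using monoidal_extension(2)[OF cylinder, of 1] unfolding E_def
  by (simp_all add: cube_le1_def full_subcategory_def)

lemma omap_E_add: "omap E (n + m) = comp_functor M (omap E n) (omap E m)"
  using strict_monoidal_functor_E unfolding strict_monoidal_functor_def by simp

lemma QO_add: "X \<in> Obj M \<Longrightarrow> QO (n + m) X = QO n (QO m X)"
  by (simp add: omap_E_add)

lemma QM_add: "f \<in> Mor M \<Longrightarrow> QM (n + m) f = QM n (QM m f)"
  by (simp add: omap_E_add)

text \<open>The cylinder is split off on the inside, because a corner map is formed first and
  \<open>QM n\<close> is applied to it afterwards.\<close>

lemma QO_Suc: "X \<in> Obj M \<Longrightarrow> QO n (QO (Suc 0) X) = QO (Suc n) X"
  using QO_add[of X n 1] by simp

lemma QM_Suc: "f \<in> Mor M \<Longrightarrow> QM n (QM (Suc 0) f) = QM (Suc n) f"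
  using QM_add[of f n 1] by simp

lemma NT_Mor:
  assumes "\<theta> \<in> cube_maps"
  shows "is_nat_trans M M (mmap E \<theta>)" "nt_dom (mmap E \<theta>) = omap E (fst \<theta>)"
    "nt_cod (mmap E \<theta>) = omap E (fst (snd \<theta>))"
proof -
  have "mmap E \<theta> \<in> Hom (End M) (omap E (Dom cube \<theta>)) (omap E (Cod cube \<theta>))"
    using functor_E assms unfolding is_functor_def[of cube] by simp
  then show "is_nat_trans M M (mmap E \<theta>)" "nt_dom (mmap E \<theta>) = omap E (fst \<theta>)"
    "nt_cod (mmap E \<theta>) = omap E (fst (snd \<theta>))" by (simp_all add: Hom_def)
qed

lemma NT_simps [simp]:
  assumes "\<theta> \<in> cube_maps" "X \<in> Obj M"
  shows "NT \<theta> X \<in> Mor M" "Dom M (NT \<theta> X) = QO (fst \<theta>) X" "Cod M (NT \<theta> X) = QO (fst (snd \<theta>)) X"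
  using NT_Mor[OF assms(1)] assms(2) by simp_all

lemma NT_natural:
  assumes "\<theta> \<in> cube_maps" "f \<in> Hom M X Y"
  shows "QM (fst (snd \<theta>)) f \<cdot> NT \<theta> X = NT \<theta> Y \<cdot> QM (fst \<theta>) f"
  using naturality[OF NT_Mor(1)[OF assms(1)], of f X Y] assms NT_Mor[OF assms(1)] by (simp add: Hom_def)

lemma NT_comp:
  assumes "\<theta> \<in> cube_maps" "\<phi> \<in> cube_maps" "fst (snd \<theta>) = fst \<phi>" "X \<in> Obj M"
  shows "NT (cube_comp \<phi> \<theta>) X = NT \<phi> X \<cdot> NT \<theta> X"
proof -
  have "mmap E (cube_comp \<phi> \<theta>) = mmap E \<phi> \<cdot>\<^bsub>End M\<^esub> mmap E \<theta>"
    using functor_E assms unfolding is_functor_def[of cube] by simp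
  then show ?thesis using assms by simp
qed

lemma mmap_E_id: "mmap E (cube_id n) = Id (End M) (omap E n)"
  using functor_E unfolding is_functor_def[of cube] by simp

lemma NT_id [simp]: "X \<in> Obj M \<Longrightarrow> NT (cube_id n) X = Id M (QO n X)"
  by (simp add: mmap_E_id)

lemma mmap_E_tensor: "\<theta> \<in> cube_maps \<Longrightarrow> \<phi> \<in> cube_maps \<Longrightarrow>
    mmap E (cube_tensor \<theta> \<phi>) = mtens (End M) (mmap E \<theta>) (mmap E \<phi>)"
  using strict_monoidal_functor_E unfolding strict_monoidal_functor_def by simp

definition inc :: "bool \<Rightarrow> 'o \<Rightarrow> 'm" where
  "inc e = NT (delta e)"

text \<open>Relates the end inclusions in the theorem, which are taken from \<open>Q\<close>, to
  those of the extension \<open>E\<close>.\<close>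

lemma inc_cyl_incl: "inc e X = cyl_incl Q e X"
proof -
  have "delta e \<in> Mor cube_le1"
    by (simp add: cube_le1_def full_subcategory_def cube_maps.delta) (simp add: delta_def)
  then show ?thesis unfolding inc_def E_def using monoidal_extension(3)[OF cylinder] by simp
qed

lemma delta_Dom_Cod [simp]: "fst (delta e) = 0" "fst (snd (delta e)) = Suc 0"
  by (simp_all add: delta_def)

lemma inc_simps [simp]:
  assumes "X \<in> Obj M"
  shows "inc e X \<in> Mor M" "Dom M (inc e X) = X" "Cod M (inc e X) = QO (Suc 0) X"
  using assms by (simp_all add: inc_def cube_maps.delta)

lemma inc_natural: "f \<in> Hom M X Y \<Longrightarrow> QM (Suc 0) f \<cdot> inc e X = inc e Y \<cdot> f"
  using NT_natural[of "delta e" f X Y] by (simp add: inc_def cube_maps.delta Hom_def)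

text \<open>Indexed by the dimension of its source: \<open>face n k e X\<close> goes from \<open>Q\<^sub>n X\<close> to \<open>Q\<^sub>n\<^sub>+\<^sub>1 X\<close>.\<close>

definition face :: "nat \<Rightarrow> nat \<Rightarrow> bool \<Rightarrow> 'o \<Rightarrow> 'm" where
  "face n k e = NT (coface (Suc n) k e)"

lemma face_simps [simp]:
  assumes "X \<in> Obj M" "k \<le> n"
  shows "face n k e X \<in> Mor M" "Dom M (face n k e X) = QO n X" "Cod M (face n k e X) = QO (Suc n) X"
  using assms by (simp_all add: face_def coface_Mor)

lemma face_natural: "f \<in> Hom M X Y \<Longrightarrow> k \<le> n \<Longrightarrow> QM (Suc n) f \<cdot> face n k e X = face n k e Y \<cdot> QM n f"
  using NT_natural[of "coface (Suc n) k e" f X Y] by (simp add: face_def coface_Mor)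

text \<open>The identity to the left of \<open>delta e\<close> in \<open>coface\<close> acts
  outside, hence through \<open>QM k\<close>; the one to the right acts inside, hence through the
  object \<open>QO (n - k) X\<close>.\<close>

lemma face_eq:
  assumes "X \<in> Obj M" "k \<le> n"
  shows "face n k e X = QM k (inc e (QO (n - k) X))"
proof -
  have *: "delta e \<in> cube_maps" "cube_id m \<in> cube_maps" "cube_tensor (delta e) (cube_id m) \<in> cube_maps" for m
    by (auto intro: cube_maps.intros)
  have "QO (Suc (n - k)) X = QO (Suc 0) (QO (n - k) X)"
    using assms QO_add[of X "Suc 0" "n - k"] by simp
  then show ?thesis
    using assms * by (simp add: face_def coface_def mmap_E_tensor mmap_E_id NT_Mor inc_def)
qed

text \<open>Directions are counted from the outside, so moving the innermost cylinder into the
  object leaves the number \<open>k\<close> unchanged. A face condition on \<open>Cod f\<close>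
  thereby becomes one on the codomain of a corner map.\<close>

lemma face_shift: "X \<in> Obj M \<Longrightarrow> k \<le> n \<Longrightarrow> face n k e (QO (Suc 0) X) = face (Suc n) k e X"
  by (simp add: face_eq QO_Suc Suc_diff_le)

text \<open>The faces in the innermost direction are images under \<open>QM n\<close>, and so belong
  to the image under \<open>QM n\<close> of a corner.\<close>

lemma face_last: "X \<in> Obj M \<Longrightarrow> face n n e X = QM n (inc e X)"
  by (simp add: face_eq)

lemma face_0: "face 0 0 e X = inc e X"
  by (simp add: face_def inc_def coface_1)

lemma power_preserves_pushouts:
  "is_pushout M f g a b \<Longrightarrow> is_pushout M (QM n f) (QM n g) (QM n a) (QM n b)"
proof (induction n)
  case 0
  then show ?case using pushoutD[OF 0] by simp
next
  case (Suc n)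
  have "is_pushout M (QM 1 (QM n f)) (QM 1 (QM n g)) (QM 1 (QM n a)) (QM 1 (QM n b))"
    using Suc preserves_pushouts[OF functor_power, of 1] preserves omap_E_1 by metis
  then show ?case using pushoutD[OF Suc.prems] QM_add[of _ 1 n] by simp
qed

end

section \<open>Box problems and corner maps\<close>

lemma (in category) Comp_reduce:
  assumes "f \<cdot> g = h" "f \<in> Mor C" "g \<in> Mor C" "x \<in> Mor C" "Cod C g = Dom C f" "Cod C x = Dom C g"
  shows "f \<cdot> (g \<cdot> x) = h \<cdot> x"
  using assms by (simp flip: Comp_assoc_simp)

context model_cylinder
begin

text \<open>A problem consists of maps \<open>u k e\<close> on the faces \<open>(k, e) \<in> S\<close> of the cylinder \<open>Q\<^sub>n\<close> of \<open>Cod f\<close>, which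
  agree on their intersections, together with a square from \<open>Q\<^sub>n f\<close> to \<open>g\<close>. This is a lifting
  problem of \<open>coface_union n S \<rightarrow> std_cube n\<close> against \<open>pullback_hom M E f g\<close>, as data in \<open>M\<close>.\<close>

definition box_problem ::
  "nat \<Rightarrow> (nat \<times> bool) set \<Rightarrow> 'm \<Rightarrow> 'm \<Rightarrow> (nat \<Rightarrow> bool \<Rightarrow> 'm) \<Rightarrow> 'm \<Rightarrow> 'm \<Rightarrow> bool" where
  "box_problem n S f g u v w \<longleftrightarrow>
     (\<forall>k e. (k, e) \<in> S \<longrightarrow> u k e \<in> Hom M (QO (n - 1) (Cod M f)) (Dom M g) \<and>
        u k e \<cdot> QM (n - 1) f = v \<cdot> face (n - 1) k e (Dom M f) \<and> g \<cdot> u k e = w \<cdot> face (n - 1) k e (Cod M f)) \<and>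
     (\<forall>k e l e'. (k, e) \<in> S \<longrightarrow> (l, e') \<in> S \<longrightarrow> k < l \<longrightarrow>
        u l e' \<cdot> face (n - 2) k e (Cod M f) = u k e \<cdot> face (n - 2) (l - 1) e' (Cod M f)) \<and>
     v \<in> Hom M (QO n (Dom M f)) (Dom M g) \<and> w \<in> Hom M (QO n (Cod M f)) (Cod M g) \<and> g \<cdot> v = w \<cdot> QM n f"

definition box_lifts :: "nat \<Rightarrow> (nat \<times> bool) set \<Rightarrow> 'm \<Rightarrow> 'm \<Rightarrow> bool" where
  "box_lifts n S f g \<longleftrightarrow>
     (\<forall>u v w. box_problem n S f g u v w \<longrightarrow>
        (\<exists>h\<in>Hom M (QO n (Cod M f)) (Dom M g). h \<cdot> QM n f = v \<and> g \<cdot> h = w \<and>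
           (\<forall>k e. (k, e) \<in> S \<longrightarrow> h \<cdot> face (n - 1) k e (Cod M f) = u k e)))"

text \<open>The faces of \<box>[1] are its ends: \<open>UNIV\<close> gives the boundary, and a
  single end is an open box.\<close>

abbreviation end_lifts :: "bool set \<Rightarrow> 'm \<Rightarrow> 'm \<Rightarrow> bool" where
  "end_lifts T \<equiv> box_lifts (Suc 0) ({0} \<times> T)"

lemma box_lifts_0:
  assumes "f \<in> Mor M" "g \<in> Mor M"
  shows "box_lifts 0 {} f g \<longleftrightarrow> lifts M f g"
  using assms unfolding box_lifts_def box_problem_def lifts_def
  by (auto simp: Hom_def)

lemma end_problem:
  assumes "f \<in> Mor M" "g \<in> Mor M"
  shows "box_problem (Suc 0) ({0} \<times> T) f g u v w \<longleftrightarrow>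
    (\<forall>e\<in>T. u 0 e \<in> Hom M (Cod M f) (Dom M g) \<and>
        u 0 e \<cdot> f = v \<cdot> inc e (Dom M f) \<and> g \<cdot> u 0 e = w \<cdot> inc e (Cod M f)) \<and>
     v \<in> Hom M (QO (Suc 0) (Dom M f)) (Dom M g) \<and> w \<in> Hom M (QO (Suc 0) (Cod M f)) (Cod M g) \<and>
     g \<cdot> v = w \<cdot> QM (Suc 0) f"
  using assms unfolding box_problem_def by (auto simp: face_0)

lemma end_lifts_iff:
  assumes "f \<in> Mor M" "g \<in> Mor M"
  shows "end_lifts T f g \<longleftrightarrow>
    (\<forall>u v w. (\<forall>e\<in>T. u e \<in> Hom M (Cod M f) (Dom M g) \<and>
        u e \<cdot> f = v \<cdot> inc e (Dom M f) \<and> g \<cdot> u e = w \<cdot> inc e (Cod M f)) \<and>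
     v \<in> Hom M (QO (Suc 0) (Dom M f)) (Dom M g) \<and> w \<in> Hom M (QO (Suc 0) (Cod M f)) (Cod M g) \<and>
     g \<cdot> v = w \<cdot> QM (Suc 0) f \<longrightarrow>
     (\<exists>h\<in>Hom M (QO (Suc 0) (Cod M f)) (Dom M g). h \<cdot> QM (Suc 0) f = v \<and> g \<cdot> h = w \<and>
           (\<forall>e\<in>T. h \<cdot> inc e (Cod M f) = u e)))" (is "_ \<longleftrightarrow> (\<forall>u v w. ?p u v w \<longrightarrow> ?s u v w)")
proof -
  have "end_lifts T f g \<longleftrightarrow> (\<forall>u v w. ?p (u 0) v w \<longrightarrow> ?s (u (0::nat)) v w)"
    unfolding box_lifts_def end_problem[OF assms] by (simp add: face_0 Ball_def)
  also have "\<dots> \<longleftrightarrow> (\<forall>u v w. ?p u v w \<longrightarrow> ?s u v w)"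
  proof
    assume *: "\<forall>u v w. ?p (u 0) v w \<longrightarrow> ?s (u (0::nat)) v w"
    show "\<forall>u v w. ?p u v w \<longrightarrow> ?s u v w"
    proof
      \<comment> \<open>A family indexed by ends becomes a family indexed by faces that ignores the
        direction.\<close>
      fix u show "\<forall>v w. ?p u v w \<longrightarrow> ?s u v w" using spec[OF *, of "\<lambda>_. u"] .
    qed
  qed simp
  finally show ?thesis .
qed

text \<open>The object \<open>P\<close> is the cylinder on \<open>Dom f\<close> with \<open>Cod f\<close> glued to its ends \<open>e \<in> T\<close>.\<close>

definition corner :: "bool set \<Rightarrow> 'm \<Rightarrow> 'o \<Rightarrow> 'm \<Rightarrow> (bool \<Rightarrow> 'm) \<Rightarrow> bool" where
  "corner T f P a c \<longleftrightarrow> f \<in> Mor M \<and> P \<in> Obj M \<and> a \<in> Hom M (QO (Suc 0) (Dom M f)) P \<and>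
     (\<forall>e\<in>T. c e \<in> Hom M (Cod M f) P \<and> c e \<cdot> f = a \<cdot> inc e (Dom M f))"

text \<open>\<open>QO n P\<close> is the colimit of the image under \<open>Q\<^sub>n\<close> of the
  gluing diagram. All \<open>n\<close> are covered because the descent in dimension needs maps out
  of \<open>QO n P\<close>; a set \<open>T\<close> of ends treats one end and both ends
  alike.\<close>

definition corner_univ :: "nat \<Rightarrow> bool set \<Rightarrow> 'm \<Rightarrow> 'o \<Rightarrow> 'm \<Rightarrow> (bool \<Rightarrow> 'm) \<Rightarrow> bool" where
  "corner_univ n T f P a c \<longleftrightarrow>
     (\<forall>Z v u. v \<in> Hom M (QO (Suc n) (Dom M f)) Z \<longrightarrow>
        (\<forall>e\<in>T. u e \<in> Hom M (QO n (Cod M f)) Z \<and> u e \<cdot> QM n f = v \<cdot> QM n (inc e (Dom M f))) \<longrightarrow>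
        (\<exists>!h. h \<in> Hom M (QO n P) Z \<and> h \<cdot> QM n a = v \<and> (\<forall>e\<in>T. h \<cdot> QM n (c e) = u e)))"

definition corner_map :: "bool set \<Rightarrow> 'm \<Rightarrow> 'o \<Rightarrow> 'm \<Rightarrow> (bool \<Rightarrow> 'm) \<Rightarrow> 'm \<Rightarrow> bool" where
  "corner_map T f P a c L \<longleftrightarrow> L \<in> Hom M P (QO (Suc 0) (Cod M f)) \<and> L \<cdot> a = QM (Suc 0) f \<and>
     (\<forall>e\<in>T. L \<cdot> c e = inc e (Cod M f))"

lemma cornerD:
  assumes "corner T f P a c"
  shows "f \<in> Mor M" "P \<in> Obj M" "a \<in> Mor M" "Dom M a = QO (Suc 0) (Dom M f)" "Cod M a = P"
    and "e \<in> T \<Longrightarrow> c e \<in> Mor M" "e \<in> T \<Longrightarrow> Dom M (c e) = Cod M f" "e \<in> T \<Longrightarrow> Cod M (c e) = P"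
    and "e \<in> T \<Longrightarrow> c e \<cdot> f = a \<cdot> inc e (Dom M f)"
  using assms by (auto simp: corner_def Hom_def)

lemma QM_corner:
  assumes "corner T f P a c" "e \<in> T"
  shows "QM n (c e) \<cdot> QM n f = QM n a \<cdot> QM n (inc e (Dom M f))"
proof -
  have "QM n (c e \<cdot> f) = QM n (a \<cdot> inc e (Dom M f))" using cornerD(9)[OF assms] by simp
  then show ?thesis using cornerD(1-8)[OF assms(1)] assms(2) by simp
qed

lemma corner_mapD:
  assumes "corner_map T f P a c L"
  shows "L \<in> Mor M" "Dom M L = P" "Cod M L = QO (Suc 0) (Cod M f)" "L \<cdot> a = QM (Suc 0) f"
    and "e \<in> T \<Longrightarrow> L \<cdot> c e = inc e (Cod M f)"
  using assms by (auto simp: corner_map_def Hom_def)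

lemma QM_corner_map:
  assumes "corner T f P a c" "corner_map T f P a c L"
  shows "QM n L \<cdot> QM n a = QM (Suc n) f"
    and "e \<in> T \<Longrightarrow> QM n L \<cdot> QM n (c e) = QM n (inc e (Cod M f))"
proof -
  note * = cornerD[OF assms(1)] corner_mapD[OF assms(2)]
  have "QM n L \<cdot> QM n a = QM n (L \<cdot> a)" using *(1-5,10-12) by simp
  then show "QM n L \<cdot> QM n a = QM (Suc n) f" using * QM_Suc by simp
  assume e: "e \<in> T"
  have "QM n L \<cdot> QM n (c e) = QM n (L \<cdot> c e)" using *(1-8,10-12) e by simp
  then show "QM n L \<cdot> QM n (c e) = QM n (inc e (Cod M f))" using * e by simp
qed

lemma corner_eqI:
  assumes c: "corner T f P a c" "corner_univ n T f P a c"
    and pq: "p \<in> Hom M (QO n P) Z" "q \<in> Hom M (QO n P) Z"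
    and eq: "p \<cdot> QM n a = q \<cdot> QM n a" "\<And>e. e \<in> T \<Longrightarrow> p \<cdot> QM n (c e) = q \<cdot> QM n (c e)"
  shows "p = q"
proof -
  note * = cornerD[OF c(1)]
  have "q \<cdot> QM n a \<in> Hom M (QO (Suc n) (Dom M f)) Z"
    using * pq QO_Suc by (simp add: Hom_def)
  moreover have "q \<cdot> QM n (c e) \<in> Hom M (QO n (Cod M f)) Z \<and>
      (q \<cdot> QM n (c e)) \<cdot> QM n f = (q \<cdot> QM n a) \<cdot> QM n (inc e (Dom M f))" if "e \<in> T" for e
    using *(1-8) pq QM_corner[OF c(1) that, of n] that by (simp add: Hom_def)
  ultimately have "\<exists>!h. h \<in> Hom M (QO n P) Z \<and> h \<cdot> QM n a = q \<cdot> QM n a \<and>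
      (\<forall>e\<in>T. h \<cdot> QM n (c e) = q \<cdot> QM n (c e))"
    using c(2)[unfolded corner_univ_def, rule_format, of "q \<cdot> QM n a" Z "\<lambda>e. q \<cdot> QM n (c e)"] by blast
  then show ?thesis using pq eq by blast
qed

text \<open>Gluing a further end is a pushout of \<open>f\<close> along that end of the cylinder in
  \<open>P\<close>. As \<open>QM n\<close> preserves it, a map out of the new object is a map out of
  the old one with a compatible value on the new end.\<close>

lemma corner_insert:
  assumes c: "corner T f P a c" "\<And>n. corner_univ n T f P a c"
    and po: "is_pushout M (a \<cdot> inc e (Dom M f)) f p q" and e: "e \<notin> T"
  shows "corner (insert e T) f (Cod M p) (p \<cdot> a) (\<lambda>e'. if e' = e then q else p \<cdot> c e')"
    and "corner_univ n (insert e T) f (Cod M p) (p \<cdot> a) (\<lambda>e'. if e' = e then q else p \<cdot> c e')"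
proof -
  note * = cornerD[OF c(1)] and ** = pushoutD[OF po]
  let ?c = "\<lambda>e'. if e' = e then q else p \<cdot> c e'"
  have D: "Dom M p = P" "Dom M q = Cod M f" using * ** by simp_all
  have pa: "p \<cdot> (a \<cdot> inc e (Dom M f)) = q \<cdot> f" using **(9) by simp
  show corner: "corner (insert e T) f (Cod M p) (p \<cdot> a) ?c"
    unfolding corner_def
  proof (intro conjI ballI)
    fix e' assume "e' \<in> insert e T"
    then show "?c e' \<in> Hom M (Cod M f) (Cod M p)" "?c e' \<cdot> f = p \<cdot> a \<cdot> inc e' (Dom M f)"
      using * **(4-8) D pa e by (auto simp: Hom_def)
  qed (use * ** D in \<open>simp_all add: Hom_def\<close>)
  have pon: "is_pushout M (QM n (a \<cdot> inc e (Dom M f))) (QM n f) (QM n p) (QM n q)"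
    by (rule power_preserves_pushouts[OF po])
  show "corner_univ n (insert e T) f (Cod M p) (p \<cdot> a) ?c"
    unfolding corner_univ_def
  proof (intro allI impI)
    fix Z v u
    assume v: "v \<in> Hom M (QO (Suc n) (Dom M f)) Z"
      and u: "\<forall>e'\<in>insert e T. u e' \<in> Hom M (QO n (Cod M f)) Z \<and> u e' \<cdot> QM n f = v \<cdot> QM n (inc e' (Dom M f))"
    obtain h where h: "h \<in> Hom M (QO n P) Z" "h \<cdot> QM n a = v" "\<forall>e'\<in>T. h \<cdot> QM n (c e') = u e'"
      using c(2)[of n, unfolded corner_univ_def, rule_format, OF v, of u] u by blast
    have "h \<cdot> QM n (a \<cdot> inc e (Dom M f)) = (h \<cdot> QM n a) \<cdot> QM n (inc e (Dom M f))"
      using *(1-5) h(1) by (simp add: Hom_def)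
    also have "\<dots> = u e \<cdot> QM n f" using h(2) u by simp
    finally have "\<exists>!k. k \<in> Hom M (Cod M (QM n p)) Z \<and> k \<cdot> QM n p = h \<and> k \<cdot> QM n q = u e"
      using h(1) u * by (intro pushout_ex1[OF pon]) simp_all
    then obtain k where k: "k \<in> Hom M (QO n (Cod M p)) Z" "k \<cdot> QM n p = h" "k \<cdot> QM n q = u e"
      using ** by auto
    have kc: "k \<cdot> QM n (p \<cdot> x) = h \<cdot> QM n x" if "x \<in> Mor M" "Cod M x = P" for x
      using that k(1) k(2)[symmetric] **(4) D by (simp add: Hom_def)
    have k_ok: "k \<cdot> QM n (p \<cdot> a) = v" "\<forall>e'\<in>insert e T. k \<cdot> QM n (?c e') = u e'"
      using kc * h k by auto
    show "\<exists>!h. h \<in> Hom M (QO n (Cod M p)) Z \<and> h \<cdot> QM n (p \<cdot> a) = v \<and>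
        (\<forall>e'\<in>insert e T. h \<cdot> QM n (?c e') = u e')"
    proof (rule ex1I[of _ k])
      fix k' assume k': "k' \<in> Hom M (QO n (Cod M p)) Z \<and> k' \<cdot> QM n (p \<cdot> a) = v \<and>
        (\<forall>e'\<in>insert e T. k' \<cdot> QM n (?c e') = u e')"
      have k'c: "(k' \<cdot> QM n p) \<cdot> QM n x = k' \<cdot> QM n (p \<cdot> x)" if "x \<in> Mor M" "Cod M x = P" for x
        using that k' **(4) D by (simp add: Hom_def)
      have "k' \<cdot> QM n p = h"
      proof (rule corner_eqI[OF c(1) c(2)])
        show "k' \<cdot> QM n p \<in> Hom M (QO n P) Z" using k' ** D by (simp add: Hom_def)
        show "k' \<cdot> QM n p \<cdot> QM n a = h \<cdot> QM n a"
          using k'c[of a] k' h * by simp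
        fix e' assume e': "e' \<in> T"
        then have "k' \<cdot> QM n (?c e') = u e'" using k' by blast
        moreover have "e' \<noteq> e" using e e' by blast
        ultimately show "k' \<cdot> QM n p \<cdot> QM n (c e') = h \<cdot> QM n (c e')"
          using k'c[of "c e'"] h * e' by simp
      qed (rule h)
      moreover have "k' \<cdot> QM n q = u e" using k' by auto
      ultimately show "k' = k"
        using \<open>\<exists>!k. k \<in> Hom M (Cod M (QM n p)) Z \<and> k \<cdot> QM n p = h \<and> k \<cdot> QM n q = u e\<close> k k' ** by auto
    qed (use k k_ok in blast)
  qed
qed

text \<open>The ends are glued one at a time, by induction on the finite set \<open>T\<close>,
  beginning with the bare cylinder.\<close>

lemma corner_exists:
  assumes f: "f \<in> Mor M"
  shows "\<exists>P a c. corner T f P a c \<and> (\<forall>n. corner_univ n T f P a c)"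
proof -
  have "finite T" by simp
  then show ?thesis
  proof (induction T)
    case empty
    let ?P = "QO (Suc 0) (Dom M f)"
    have "corner {} f ?P (Id M ?P) c" for c
      using f by (simp add: corner_def Hom_def)
    moreover have "corner_univ n {} f ?P (Id M ?P) c" for n c
      using f unfolding corner_univ_def by (auto simp: Hom_def QO_Suc)
    ultimately show ?case by blast
  next
    case (insert e T)
    then obtain P a c where c: "corner T f P a c" "\<And>n. corner_univ n T f P a c" by blast
    obtain p q where "is_pushout M (a \<cdot> inc e (Dom M f)) f p q"
      using pushout_exists[OF finite_colimits, of "a \<cdot> inc e (Dom M f)" f] cornerD[OF c(1)] by auto
    from corner_insert[OF c this insert(2)] show ?case by blast
  qed
qed

lemma corner_map_exists:
  assumes c: "corner T f P a c" "corner_univ 0 T f P a c"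
  shows "\<exists>L. corner_map T f P a c L"
proof -
  note * = cornerD[OF c(1)]
  have "QM (Suc 0) f \<in> Hom M (QO (Suc 0) (Dom M f)) (QO (Suc 0) (Cod M f))"
    using * by (simp add: Hom_def)
  moreover have "inc e (Cod M f) \<cdot> f = QM (Suc 0) f \<cdot> inc e (Dom M f)" for e
    using inc_natural[of f "Dom M f" "Cod M f" e] * by (simp add: Hom_def)
  ultimately have "\<exists>!h. h \<in> Hom M (QO 0 P) (QO (Suc 0) (Cod M f)) \<and> h \<cdot> QM 0 a = QM (Suc 0) f \<and>
      (\<forall>e\<in>T. h \<cdot> QM 0 (c e) = inc e (Cod M f))"
    using c(2)[unfolded corner_univ_def, rule_format, of "QM (Suc 0) f" "QO (Suc 0) (Cod M f)" "\<lambda>e. inc e (Cod M f)"] *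
    by (simp add: Hom_def)
  then show ?thesis using * unfolding corner_map_def by auto
qed

text \<open>The descent in dimension. The faces in direction \<open>n\<close> and the map
  \<open>v\<close> glue to a map \<open>m\<close> on \<open>QO n P\<close>; the other faces of the
  box for \<open>f\<close> are already faces of a box for \<open>L\<close>. Since
  \<open>QO n\<close> of the codomain of \<open>L\<close> is \<open>QO (Suc n) (Cod M f)\<close>,
  the solution \<open>h\<close> for \<open>L\<close> also solves the original problem.\<close>

lemma box_lifts_step:
  assumes g: "g \<in> Mor M" and S: "S \<subseteq> {..<n} \<times> UNIV"
    and c: "corner T f P a c" "\<And>n. corner_univ n T f P a c" and L: "corner_map T f P a c L"
    and lift: "box_lifts n S L g"
  shows "box_lifts (Suc n) (S \<union> {n} \<times> T) f g"
  unfolding box_lifts_def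
proof (intro allI impI)
  fix u v w assume prob: "box_problem (Suc n) (S \<union> {n} \<times> T) f g u v w"
  define X Y Z Z' where "X = Dom M f" and "Y = Cod M f" and "Z = Dom M g" and "Z' = Cod M g"
  note C = cornerD[OF c(1), folded X_def Y_def] and D = corner_mapD[OF L, folded Y_def]
  have XY: "X \<in> Obj M" "Y \<in> Obj M" using C(1) by (simp_all add: X_def Y_def)
  have u: "u k e \<in> Hom M (QO n Y) Z" "u k e \<cdot> QM n f = v \<cdot> face n k e X" "g \<cdot> u k e = w \<cdot> face n k e Y"
    if "(k, e) \<in> S \<or> k = n \<and> e \<in> T" for k e
    using prob that unfolding box_problem_def X_def Y_def Z_def by auto
  have rel: "u l e' \<cdot> face (n - 1) k e Y = u k e \<cdot> face (n - 1) (l - 1) e' Y"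
    if "(k, e) \<in> S" "(l, e') \<in> S \<or> l = n \<and> e' \<in> T" "k < l" for k e l e'
    using prob that unfolding box_problem_def Y_def by auto
  have v: "v \<in> Hom M (QO (Suc n) X) Z" and w: "w \<in> Hom M (QO (Suc n) Y) Z'"
    and gv: "g \<cdot> v = w \<cdot> QM (Suc n) f"
    using prob unfolding box_problem_def X_def Y_def Z_def Z'_def by auto
  \<comment> \<open>By \<open>face_last\<close>, the face conditions in direction \<open>n\<close>
    are exactly the compatibility that \<open>corner_univ\<close> asks for.\<close>
  have "u n e \<cdot> QM n f = v \<cdot> QM n (inc e X)" if "e \<in> T" for e
    using u(2) that face_last[OF XY(1), of n e] by simp
  then obtain m where m: "m \<in> Hom M (QO n P) Z" "m \<cdot> QM n a = v" "\<And>e. e \<in> T \<Longrightarrow> m \<cdot> QM n (c e) = u n e"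
    using c(2)[of n, unfolded corner_univ_def, rule_format, folded X_def Y_def, OF v, of "u n"] u(1) by blast
  note arrows = C(1-8) D(1-3) XY X_def[symmetric] Y_def[symmetric] Z_def[symmetric] Z'_def[symmetric] g
    and homs = m(1) v w
  \<comment> \<open>Tested on the pieces of \<open>QO n P\<close>: on the cylinder this is the given
    square for \<open>f\<close>, on an end it is the condition on
    \<open>g \<cdot> u n e\<close>.\<close>
  have gm: "g \<cdot> m = w \<cdot> QM n L"
  proof (rule corner_eqI[OF c])
    show "g \<cdot> m \<in> Hom M (QO n P) Z'" "w \<cdot> QM n L \<in> Hom M (QO n P) Z'"
      using arrows homs by (simp_all add: Hom_def QO_Suc)
    have "(g \<cdot> m) \<cdot> QM n a = g \<cdot> v" using arrows homs m(2)[symmetric] by (simp add: Hom_def)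
    also have "\<dots> = w \<cdot> (QM n L \<cdot> QM n a)" unfolding gv QM_corner_map(1)[OF c(1) L] ..
    also have "\<dots> = w \<cdot> QM n L \<cdot> QM n a" using arrows homs by (simp add: Hom_def QO_Suc)
    finally show "(g \<cdot> m) \<cdot> QM n a = w \<cdot> QM n L \<cdot> QM n a" .
    fix e assume e: "e \<in> T"
    have "(g \<cdot> m) \<cdot> QM n (c e) = g \<cdot> u n e" using arrows homs e m(3)[OF e, symmetric] by (simp add: Hom_def)
    also have "\<dots> = w \<cdot> QM n (inc e Y)" using u(3) e face_last[OF XY(2), of n e] by simp
    also have "\<dots> = w \<cdot> (QM n L \<cdot> QM n (c e))" using QM_corner_map(2)[OF c(1) L e] by (simp add: Y_def)
    also have "\<dots> = w \<cdot> QM n L \<cdot> QM n (c e)" using arrows homs e by (simp add: Hom_def QO_Suc)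
    finally show "(g \<cdot> m) \<cdot> QM n (c e) = w \<cdot> QM n L \<cdot> QM n (c e)" .
  qed
  \<comment> \<open>Tested on the pieces again: on the cylinder this is the condition on the face
    \<open>(k, e)\<close> over \<open>Dom f\<close>, on the end \<open>e'\<close> it is the
    agreement of the faces \<open>(k, e)\<close> and \<open>(n, e')\<close>.\<close>
  have um: "u k e \<cdot> QM (n - 1) L = m \<cdot> face (n - 1) k e P" if ke: "(k, e) \<in> S" for k e
  proof -
    obtain j where n: "n = Suc j" and kj: "k \<le> j" using ke S by (cases n) auto
    have uk: "u k e \<in> Mor M" "Dom M (u k e) = QO (Suc j) Y" "Cod M (u k e) = Z"
      using u(1)[of k e] ke n by (auto simp: Hom_def)
    have "u k e \<cdot> QM j L = m \<cdot> face j k e P"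
    proof (rule corner_eqI[OF c])
      show "u k e \<cdot> QM j L \<in> Hom M (QO j P) Z" "m \<cdot> face j k e P \<in> Hom M (QO j P) Z"
        using arrows homs uk kj n by (simp_all add: Hom_def QO_Suc)
      have "u k e \<cdot> QM j L \<cdot> QM j a = u k e \<cdot> (QM j L \<cdot> QM j a)"
        using arrows uk by (simp add: QO_Suc)
      also have "\<dots> = v \<cdot> face n k e X"
        using QM_corner_map(1)[OF c(1) L, of j] u(2) ke n by simp
      also have "\<dots> = (m \<cdot> QM n a) \<cdot> face j k e (QO (Suc 0) X)"
        using m(2) face_shift[OF XY(1) kj] n by simp
      also have "\<dots> = m \<cdot> (QM n a \<cdot> face j k e (QO (Suc 0) X))"
        using arrows homs n kj by (simp add: Hom_def)
      also have "\<dots> = m \<cdot> (face j k e P \<cdot> QM j a)"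
        using face_natural[of a "QO (Suc 0) X" P k j e] arrows kj n by (simp add: Hom_def)
      also have "\<dots> = m \<cdot> face j k e P \<cdot> QM j a"
        using arrows homs n kj by (simp add: Hom_def)
      finally show "u k e \<cdot> QM j L \<cdot> QM j a = m \<cdot> face j k e P \<cdot> QM j a" .
      fix e' assume e': "e' \<in> T"
      have "u k e \<cdot> QM j L \<cdot> QM j (c e') = u k e \<cdot> (QM j L \<cdot> QM j (c e'))"
        using arrows uk e' by (simp add: QO_Suc)
      also have "\<dots> = u k e \<cdot> face j j e' Y"
        using QM_corner_map(2)[OF c(1) L e', of j] face_last[OF XY(2), of j e'] by (simp add: Y_def)
      also have "\<dots> = u n e' \<cdot> face j k e Y"
        using rel[of k e n e'] ke e' n kj by simp
      also have "\<dots> = m \<cdot> QM n (c e') \<cdot> face j k e Y"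
        using m(3)[OF e'] by simp
      also have "\<dots> = m \<cdot> (QM n (c e') \<cdot> face j k e Y)"
        using arrows homs n kj e' by (simp add: Hom_def)
      also have "\<dots> = m \<cdot> (face j k e P \<cdot> QM j (c e'))"
        using face_natural[of "c e'" Y P k j e] arrows kj n e' by (simp add: Hom_def)
      also have "\<dots> = m \<cdot> face j k e P \<cdot> QM j (c e')"
        using arrows homs n kj e' by (simp add: Hom_def)
      finally show "u k e \<cdot> QM j L \<cdot> QM j (c e') = m \<cdot> face j k e P \<cdot> QM j (c e')" .
    qed
    then show ?thesis using n by simp
  qed
  have "box_problem n S L g u m w"
    unfolding box_problem_def D(2,3)
  proof (intro conjI allI impI)
    fix k e assume ke: "(k, e) \<in> S"
    then obtain j where n: "n = Suc j" and kj: "k \<le> j" using S by (cases n) auto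
    show "u k e \<in> Hom M (QO (n - 1) (QO (Suc 0) Y)) (Dom M g)"
      using u(1) ke XY n by (simp add: QO_Suc Z_def)
    show "u k e \<cdot> QM (n - 1) L = m \<cdot> face (n - 1) k e P" using um[OF ke] .
    show "g \<cdot> u k e = w \<cdot> face (n - 1) k e (QO (Suc 0) Y)"
      using u(3) ke XY n kj by (simp add: face_shift)
    \<comment> \<open>Two distinct directions below \<open>n\<close> force \<open>n \<ge> 2\<close>,
      so the truncated subtractions are true predecessors.\<close>
    fix l e' assume l: "(l, e') \<in> S" "k < l"
    then obtain i where "j = Suc i" "l - 1 \<le> i" "k \<le> i" using n S by (cases j) auto
    then show "u l e' \<cdot> face (n - 2) k e (QO (Suc 0) Y) = u k e \<cdot> face (n - 2) (l - 1) e' (QO (Suc 0) Y)"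
      using rel[of k e l e'] ke l XY n by (simp add: face_shift)
  qed (use m(1) w XY gm in \<open>simp_all add: QO_Suc Z_def Z'_def\<close>)
  then obtain h where h: "h \<in> Hom M (QO (Suc n) Y) Z" "h \<cdot> QM n L = m" "g \<cdot> h = w"
    "\<And>k e. (k, e) \<in> S \<Longrightarrow> h \<cdot> face (n - 1) k e (QO (Suc 0) Y) = u k e"
    using lift XY unfolding box_lifts_def D(2,3) Z_def by (metis QO_Suc)
  have "h \<cdot> QM (Suc n) f = h \<cdot> QM n L \<cdot> QM n a"
    using QM_corner_map(1)[OF c(1) L, of n, symmetric] arrows h(1) by (simp add: Hom_def QO_Suc)
  then have 1: "h \<cdot> QM (Suc n) f = v" using h(2) m(2) by simp
  have 2: "h \<cdot> face n k e Y = u k e" if "(k, e) \<in> S \<union> {n} \<times> T" for k e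
  proof (cases "(k, e) \<in> S")
    case True
    then obtain j where n: "n = Suc j" and kj: "k \<le> j" using S by (cases n) auto
    then show ?thesis using h(4)[OF True] XY by (simp add: face_shift)
  next
    case False
    then have e: "k = n" "e \<in> T" using that by auto
    have "h \<cdot> face n n e Y = h \<cdot> QM n L \<cdot> QM n (c e)"
      using QM_corner_map(2)[OF c(1) L e(2), of n, symmetric] arrows e h(1) face_last[OF XY(2), of n e]
      by (simp add: Hom_def QO_Suc)
    then show ?thesis using h(2) m(3) e by simp
  qed
  show "\<exists>h\<in>Hom M (QO (Suc n) (Cod M f)) (Dom M g). h \<cdot> QM (Suc n) f = v \<and> g \<cdot> h = w \<and>
      (\<forall>k e. (k, e) \<in> S \<union> {n} \<times> T \<longrightarrow> h \<cdot> face (Suc n - 1) k e (Cod M f) = u k e)"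
    using h(1,3) 1 2 by (auto simp: Y_def[symmetric] Z_def[symmetric])
qed

end

section \<open>The cylinder conditions\<close>

context model_category
begin

lemma cof_iff: "f \<in> cof M \<longleftrightarrow> f \<in> Mor M \<and> (\<forall>p\<in>fib M \<inter> weq M. lifts M f p)"
  using cof_iff_lifts by blast

lemma acyclic_cof_iff: "f \<in> cof M \<inter> weq M \<longleftrightarrow> f \<in> Mor M \<and> (\<forall>p\<in>fib M. lifts M f p)"
  using acyclic_cof_iff_lifts by blast

lemma cof_Mor: "f \<in> cof M \<Longrightarrow> f \<in> Mor M"
  using cof_iff by blast

lemma fib_Mor: "f \<in> fib M \<Longrightarrow> f \<in> Mor M"
  using wide[of "fib M"] by (auto simp: wide_subcategory_with_isos_def)

end

context model_cylinder
begin

lemma corner_univ_0: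
  assumes "corner_univ 0 T f P a c" and c: "corner T f P a c"
    and v: "v \<in> Hom M (QO (Suc 0) (Dom M f)) Z"
    and u: "\<And>e. e \<in> T \<Longrightarrow> u e \<in> Hom M (Cod M f) Z" "\<And>e. e \<in> T \<Longrightarrow> u e \<cdot> f = v \<cdot> inc e (Dom M f)"
  obtains h where "h \<in> Hom M P Z" "h \<cdot> a = v" "\<And>e. e \<in> T \<Longrightarrow> h \<cdot> c e = u e"
proof -
  note * = cornerD[OF c]
  have "u e \<in> Hom M (QO 0 (Cod M f)) Z \<and> u e \<cdot> QM 0 f = v \<cdot> QM 0 (inc e (Dom M f))" if "e \<in> T" for e
    using u[OF that] *(1) by simp
  then obtain h where h: "h \<in> Hom M (QO 0 P) Z" "h \<cdot> QM 0 a = v" "\<And>e. e \<in> T \<Longrightarrow> h \<cdot> QM 0 (c e) = u e"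
    using assms(1)[unfolded corner_univ_def, rule_format, OF v, of u] by blast
  have "h \<cdot> c e = u e" if "e \<in> T" for e using h(3)[OF that] *(6)[OF that] by simp
  moreover have "h \<in> Hom M P Z" "h \<cdot> a = v" using h *(2,3) by simp_all
  ultimately show ?thesis using that by blast
qed

lemma corner_eqI_0:
  assumes c: "corner T f P a c" "corner_univ 0 T f P a c"
    and pq: "p \<in> Hom M P Z" "q \<in> Hom M P Z"
    and eq: "p \<cdot> a = q \<cdot> a" "\<And>e. e \<in> T \<Longrightarrow> p \<cdot> c e = q \<cdot> c e"
  shows "p = q"
  using corner_eqI[OF c, of p Z q] pq eq cornerD[OF c(1)] by simp

text \<open>By the universal property of \<open>P\<close>, a map \<open>m\<close> from
  \<open>P\<close> amounts to \<open>v\<close> on the cylinder and compatible \<open>u e\<close> on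
  the ends. The outer square and both triangles split in the same way.\<close>

lemma lifts_corner_map_iff:
  assumes c: "corner T f P a c" "corner_univ 0 T f P a c" and L: "corner_map T f P a c L" and g: "g \<in> Mor M"
  shows "lifts M L g \<longleftrightarrow> end_lifts T f g"
proof
  note C = cornerD[OF c(1)] and D = corner_mapD[OF L]
  have inc_Y: "x \<cdot> inc e (Cod M f) = (x \<cdot> L) \<cdot> c e"
    if "e \<in> T" "x \<in> Hom M (QO (Suc 0) (Cod M f)) Z" for x e Z
    using that C(1-8) D(1-3) by (simp add: Hom_def D(5)[OF that(1), symmetric])
  have Qf: "x \<cdot> QM (Suc 0) f = (x \<cdot> L) \<cdot> a" if "x \<in> Hom M (QO (Suc 0) (Cod M f)) Z" for x Z
    using that C(1-8) D(1-3) by (simp add: Hom_def D(4)[symmetric])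
  show "end_lifts T f g" if lift: "lifts M L g"
    unfolding end_lifts_iff[OF C(1) g]
  proof (intro allI impI; elim conjE)
    fix u v w
    assume u: "\<forall>e\<in>T. u e \<in> Hom M (Cod M f) (Dom M g) \<and>
        u e \<cdot> f = v \<cdot> inc e (Dom M f) \<and> g \<cdot> u e = w \<cdot> inc e (Cod M f)"
      and v: "v \<in> Hom M (QO (Suc 0) (Dom M f)) (Dom M g)"
      and w: "w \<in> Hom M (QO (Suc 0) (Cod M f)) (Cod M g)"
      and gv: "g \<cdot> v = w \<cdot> QM (Suc 0) f"
    obtain m where m: "m \<in> Hom M P (Dom M g)" "m \<cdot> a = v" "\<And>e. e \<in> T \<Longrightarrow> m \<cdot> c e = u e"
      using corner_univ_0[OF c(2,1) v, of u] u by blast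
    have "g \<cdot> m = w \<cdot> L"
    proof (rule corner_eqI_0[OF c])
      show "g \<cdot> m \<in> Hom M P (Cod M g)" "w \<cdot> L \<in> Hom M P (Cod M g)"
        using m(1) w g D(1-3) by (simp_all add: Hom_def)
      have "g \<cdot> m \<cdot> a = g \<cdot> (m \<cdot> a)" using m(1) g C(1-5) by (simp add: Hom_def)
      then show "g \<cdot> m \<cdot> a = w \<cdot> L \<cdot> a" using m(2) gv Qf[OF w] by simp
      fix e assume e: "e \<in> T"
      have "g \<cdot> m \<cdot> c e = g \<cdot> (m \<cdot> c e)" using m(1) g C(1-8) e by (simp add: Hom_def)
      then show "g \<cdot> m \<cdot> c e = w \<cdot> L \<cdot> c e" using m(3)[OF e] u e inc_Y[OF e w] by simp
    qed
    then obtain h where h: "h \<in> Hom M (QO (Suc 0) (Cod M f)) (Dom M g)" "h \<cdot> L = m" "g \<cdot> h = w"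
      using lift m(1) w D(2,3) unfolding lifts_def by metis
    then show "\<exists>h\<in>Hom M (QO (Suc 0) (Cod M f)) (Dom M g). h \<cdot> QM (Suc 0) f = v \<and> g \<cdot> h = w \<and>
           (\<forall>e\<in>T. h \<cdot> inc e (Cod M f) = u e)"
      using m(2,3) Qf[OF h(1)] inc_Y[OF _ h(1)] by auto
  qed
  show "lifts M L g" if lift: "end_lifts T f g"
    unfolding lifts_def D(2,3)
  proof (intro ballI impI)
    fix m w assume m: "m \<in> Hom M P (Dom M g)" and w: "w \<in> Hom M (QO (Suc 0) (Cod M f)) (Cod M g)"
      and gm: "g \<cdot> m = w \<cdot> L"
    have "g \<cdot> (m \<cdot> a) = w \<cdot> QM (Suc 0) f"
    proof -
      have "g \<cdot> (m \<cdot> a) = (g \<cdot> m) \<cdot> a" using m g C(1-5) by (simp add: Hom_def)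
      then show ?thesis using gm Qf[OF w] by simp
    qed
    moreover have "m \<cdot> c e \<in> Hom M (Cod M f) (Dom M g) \<and>
        m \<cdot> c e \<cdot> f = (m \<cdot> a) \<cdot> inc e (Dom M f) \<and> g \<cdot> (m \<cdot> c e) = w \<cdot> inc e (Cod M f)" if e: "e \<in> T" for e
    proof (intro conjI)
      show "m \<cdot> c e \<in> Hom M (Cod M f) (Dom M g)" using m C(1-8) e by (simp add: Hom_def)
      show "m \<cdot> c e \<cdot> f = (m \<cdot> a) \<cdot> inc e (Dom M f)" using m C e by (simp add: Hom_def)
      have "g \<cdot> (m \<cdot> c e) = (g \<cdot> m) \<cdot> c e" using m g C(1-8) e by (simp add: Hom_def)
      then show "g \<cdot> (m \<cdot> c e) = w \<cdot> inc e (Cod M f)" using gm inc_Y[OF e w] by simp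
    qed
    moreover have "m \<cdot> a \<in> Hom M (QO (Suc 0) (Dom M f)) (Dom M g)"
      using m C by (simp add: Hom_def)
    ultimately obtain h where h: "h \<in> Hom M (QO (Suc 0) (Cod M f)) (Dom M g)" "h \<cdot> QM (Suc 0) f = m \<cdot> a"
      "g \<cdot> h = w" "\<forall>e\<in>T. h \<cdot> inc e (Cod M f) = m \<cdot> c e"
      using lift[unfolded end_lifts_iff[OF C(1) g], rule_format, of "\<lambda>e. m \<cdot> c e" "m \<cdot> a" w] w by blast
    have "h \<cdot> L = m"
    proof (rule corner_eqI_0[OF c])
      show "h \<cdot> L \<in> Hom M P (Dom M g)" using h(1) D(1-3) by (simp add: Hom_def)
      show "h \<cdot> L \<cdot> a = m \<cdot> a" using Qf[OF h(1)] h(2) by simp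
      show "h \<cdot> L \<cdot> c e = m \<cdot> c e" if "e \<in> T" for e using inc_Y[OF that h(1)] h(4) that by simp
    qed (rule m)
    then show "\<exists>h\<in>Hom M (QO (Suc 0) (Cod M f)) (Dom M g). h \<cdot> L = m \<and> g \<cdot> h = w"
      using h by blast
  qed
qed

text \<open>The structure map \<open>a\<close> is an iterated cobase change of \<open>f\<close>.\<close>

lemma lifts_corner:
  assumes c: "corner T f P a c" "corner_univ 0 T f P a c" and g: "g \<in> Mor M" and lift: "lifts M f g"
  shows "lifts M a g"
proof -
  note C = cornerD[OF c(1)]
  show ?thesis
    unfolding lifts_def C(4,5)
  proof (intro ballI impI)
    fix v w assume v: "v \<in> Hom M (QO (Suc 0) (Dom M f)) (Dom M g)" and w: "w \<in> Hom M P (Cod M g)"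
      and gv: "g \<cdot> v = w \<cdot> a"
    have "\<exists>t. t \<in> Hom M (Cod M f) (Dom M g) \<and> t \<cdot> f = v \<cdot> inc e (Dom M f) \<and> g \<cdot> t = w \<cdot> c e"
      if e: "e \<in> T" for e
    proof -
      have "g \<cdot> (v \<cdot> inc e (Dom M f)) = (g \<cdot> v) \<cdot> inc e (Dom M f)"
        using v g C(1) by (simp add: Hom_def)
      also have "\<dots> = w \<cdot> (a \<cdot> inc e (Dom M f))" unfolding gv using w C(1-5) by (simp add: Hom_def)
      also have "\<dots> = w \<cdot> (c e \<cdot> f)" using C(9) e by simp
      also have "\<dots> = (w \<cdot> c e) \<cdot> f" using w C(1-8) e by (simp add: Hom_def)
      finally have "g \<cdot> (v \<cdot> inc e (Dom M f)) = (w \<cdot> c e) \<cdot> f" .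
      moreover have "v \<cdot> inc e (Dom M f) \<in> Hom M (Dom M f) (Dom M g)" "w \<cdot> c e \<in> Hom M (Cod M f) (Cod M g)"
        using v w C(1-8) e by (simp_all add: Hom_def)
      ultimately show ?thesis using lift unfolding lifts_def by blast
    qed
    then obtain t where t: "\<And>e. e \<in> T \<Longrightarrow> t e \<in> Hom M (Cod M f) (Dom M g)"
      "\<And>e. e \<in> T \<Longrightarrow> t e \<cdot> f = v \<cdot> inc e (Dom M f)" "\<And>e. e \<in> T \<Longrightarrow> g \<cdot> t e = w \<cdot> c e" by metis
    obtain h where h: "h \<in> Hom M P (Dom M g)" "h \<cdot> a = v" "\<And>e. e \<in> T \<Longrightarrow> h \<cdot> c e = t e"
      using corner_univ_0[OF c(2,1) v, of t] t by blast
    have "g \<cdot> h = w"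
    proof (rule corner_eqI_0[OF c])
      show "g \<cdot> h \<in> Hom M P (Cod M g)" using h(1) g by (simp add: Hom_def)
      have "g \<cdot> h \<cdot> a = g \<cdot> (h \<cdot> a)" using h(1) g C(1-5) by (simp add: Hom_def)
      then show "g \<cdot> h \<cdot> a = w \<cdot> a" using h(2) gv by simp
      fix e assume e: "e \<in> T"
      have "g \<cdot> h \<cdot> c e = g \<cdot> (h \<cdot> c e)" using h(1) g C(1-8) e by (simp add: Hom_def)
      then show "g \<cdot> h \<cdot> c e = w \<cdot> c e" using h(3) t(3) e by simp
    qed (rule w)
    then show "\<exists>h\<in>Hom M P (Dom M g). h \<cdot> a = v \<and> g \<cdot> h = w" using h by blast
  qed
qed

text \<open>Lifting \<open>f\<close> against \<open>g\<close> at the opposite end supplies the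
  missing value, which turns a problem with one end into a problem with both. Applied to acyclic
  fibrations, this shows that corner maps with one end are cofibrations.\<close>

lemma end_lifts_single:
  assumes f: "f \<in> Mor M" and g: "g \<in> Mor M" and lift: "lifts M f g" and ends: "end_lifts UNIV f g"
  shows "end_lifts {e} f g"
  unfolding end_lifts_iff[OF f g]
proof (intro allI impI; elim conjE)
  fix u v w
  assume u: "\<forall>e\<in>{e}. u e \<in> Hom M (Cod M f) (Dom M g) \<and>
        u e \<cdot> f = v \<cdot> inc e (Dom M f) \<and> g \<cdot> u e = w \<cdot> inc e (Cod M f)"
    and v: "v \<in> Hom M (QO (Suc 0) (Dom M f)) (Dom M g)"
    and w: "w \<in> Hom M (QO (Suc 0) (Cod M f)) (Cod M g)"
    and gv: "g \<cdot> v = w \<cdot> QM (Suc 0) f"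
  let ?i = "inc (\<not> e)"
  have "g \<cdot> (v \<cdot> ?i (Dom M f)) = (g \<cdot> v) \<cdot> ?i (Dom M f)"
    using v g f by (simp add: Hom_def)
  also have "\<dots> = w \<cdot> (QM (Suc 0) f \<cdot> ?i (Dom M f))" unfolding gv using w f by (simp add: Hom_def)
  also have "\<dots> = w \<cdot> (?i (Cod M f) \<cdot> f)" using inc_natural[of f] f by (simp add: Hom_def)
  also have "\<dots> = (w \<cdot> ?i (Cod M f)) \<cdot> f" using w f by (simp add: Hom_def)
  finally have "g \<cdot> (v \<cdot> ?i (Dom M f)) = (w \<cdot> ?i (Cod M f)) \<cdot> f" .
  moreover have "v \<cdot> ?i (Dom M f) \<in> Hom M (Dom M f) (Dom M g)" "w \<cdot> ?i (Cod M f) \<in> Hom M (Cod M f) (Cod M g)"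
    using v w f by (simp_all add: Hom_def)
  ultimately obtain t where t: "t \<in> Hom M (Cod M f) (Dom M g)" "t \<cdot> f = v \<cdot> ?i (Dom M f)" "g \<cdot> t = w \<cdot> ?i (Cod M f)"
    using lift unfolding lifts_def by blast
  have "\<forall>e'\<in>UNIV. (u(\<not> e := t)) e' \<in> Hom M (Cod M f) (Dom M g) \<and>
      (u(\<not> e := t)) e' \<cdot> f = v \<cdot> inc e' (Dom M f) \<and> g \<cdot> (u(\<not> e := t)) e' = w \<cdot> inc e' (Cod M f)"
  proof
    fix e' show "(u(\<not> e := t)) e' \<in> Hom M (Cod M f) (Dom M g) \<and>
      (u(\<not> e := t)) e' \<cdot> f = v \<cdot> inc e' (Dom M f) \<and> g \<cdot> (u(\<not> e := t)) e' = w \<cdot> inc e' (Cod M f)"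
      using t u by (cases "e' = e") auto
  qed
  then obtain h where h: "h\<in>Hom M (QO (Suc 0) (Cod M f)) (Dom M g)" "h \<cdot> QM (Suc 0) f = v" "g \<cdot> h = w"
    "\<forall>e'\<in>UNIV. h \<cdot> inc e' (Cod M f) = (u(\<not> e := t)) e'"
    using ends[unfolded end_lifts_iff[OF f g], rule_format, of "u(\<not> e := t)" v w] v w gv by blast
  have "h \<cdot> inc e (Cod M f) = u e" using h(4) by simp
  then show "\<exists>h\<in>Hom M (QO (Suc 0) (Cod M f)) (Dom M g). h \<cdot> QM (Suc 0) f = v \<and> g \<cdot> h = w \<and>
           (\<forall>e\<in>{e}. h \<cdot> inc e (Cod M f) = u e)" using h by blast
qed

text \<open>Recognises the map of the first condition as a corner map: the two ends are
  \<open>b\<close> composed with the coprojections of \<open>Y\<close>, the first coprojection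
  belonging to the end \<open>False\<close>.\<close>

lemma coproduct_corner:
  fixes b k l
  defines "c \<equiv> \<lambda>e. if e then b \<cdot> l else b \<cdot> k"
  assumes f: "f \<in> Hom M X Y" and ij: "is_coproduct M X X i j" and kl: "is_coproduct M Y Y k l"
    and po: "is_pushout M (induced M i j (inc False X) (inc True X)) (induced M i j (k \<cdot> f) (l \<cdot> f)) a b"
  shows "corner UNIV f (Cod M a) a c" "corner_univ 0 UNIV f (Cod M a) a c"
    "corner_map UNIV f (Cod M a) a c
      (induced M a b (QM (Suc 0) f) (induced M k l (inc False Y) (inc True Y)))"
proof -
  define sX ff sY where "sX = induced M i j (inc False X) (inc True X)"
    and "ff = induced M i j (k \<cdot> f) (l \<cdot> f)" and "sY = induced M k l (inc False Y) (inc True Y)"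
  note I = coproductD[OF ij] and K = coproductD[OF kl] and A = pushoutD[OF po, folded sX_def ff_def]
  have XY: "f \<in> Mor M" "Dom M f = X" "Cod M f = Y" "X \<in> Obj M" "Y \<in> Obj M" using f by (auto simp: Hom_def)
  have "inc e X \<in> Hom M X (QO (Suc 0) X)" "inc e Y \<in> Hom M Y (QO (Suc 0) Y)" for e
    using XY by (simp_all add: Hom_def)
  from induced_coproduct[OF ij this(1) this(1), of False True, folded sX_def]
    induced_coproduct[OF kl this(2) this(2), of False True, folded sY_def]
  have sX: "sX \<in> Mor M" "Dom M sX = Cod M i" "Cod M sX = QO (Suc 0) X" "sX \<cdot> i = inc False X" "sX \<cdot> j = inc True X"
    and sY: "sY \<in> Mor M" "Dom M sY = Cod M k" "Cod M sY = QO (Suc 0) Y" "sY \<cdot> k = inc False Y" "sY \<cdot> l = inc True Y"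
    by (simp_all add: Hom_def)
  have "k \<cdot> f \<in> Hom M X (Cod M k)" "l \<cdot> f \<in> Hom M X (Cod M k)"
    using K XY by (simp_all add: Hom_def)
  from induced_coproduct[OF ij this, folded ff_def]
  have ff: "ff \<in> Mor M" "Dom M ff = Cod M i" "Cod M ff = Cod M k" "ff \<cdot> i = k \<cdot> f" "ff \<cdot> j = l \<cdot> f"
    by (simp_all add: Hom_def)
  note arr = I K A(4,5,6,7,8) XY sX(1-3) sY(1-3) ff(1-3)
  have c: "c e \<in> Mor M" "Dom M (c e) = Y" "Cod M (c e) = Cod M a" for e
    using arr by (auto simp: c_def)
  have "c e \<cdot> f = a \<cdot> inc e X" for e
  proof -
    have "(b \<cdot> ff) \<cdot> x = (a \<cdot> sX) \<cdot> x" for x using A(9) by simp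
    then have "b \<cdot> (ff \<cdot> i) = a \<cdot> (sX \<cdot> i)" "b \<cdot> (ff \<cdot> j) = a \<cdot> (sX \<cdot> j)" using arr by (metis Comp_assoc_simp)+
    then show ?thesis using ff(4,5) sX(4,5) arr by (simp add: c_def)
  qed
  then show corner: "corner UNIV f (Cod M a) a c"
    using arr c by (simp add: corner_def Hom_def)
  have hc: "h \<cdot> c e = (h \<cdot> b) \<cdot> (if e then l else k)" if "h \<in> Mor M" "Dom M h = Cod M a" for h e
    using that arr by (simp add: c_def)
  show "corner_univ 0 UNIV f (Cod M a) a c"
    unfolding corner_univ_def
  proof (intro allI impI)
    fix Z v u
    assume v: "v \<in> Hom M (QO (Suc 0) (Dom M f)) Z"
      and "\<forall>e\<in>UNIV. u e \<in> Hom M (QO 0 (Cod M f)) Z \<and> u e \<cdot> QM 0 f = v \<cdot> QM 0 (inc e (Dom M f))"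
    then have u: "u e \<in> Hom M Y Z" "u e \<cdot> f = v \<cdot> inc e X" for e
      using XY by auto
    define t where "t = induced M k l (u False) (u True)"
    have t: "t \<in> Hom M (Cod M k) Z" "t \<cdot> k = u False" "t \<cdot> l = u True"
      using induced_coproduct[OF kl u(1) u(1), of False True] by (simp_all add: t_def)
    have v': "v \<in> Mor M" "Dom M v = QO (Suc 0) X" "Cod M v = Z" using v XY by (simp_all add: Hom_def)
    have t': "t \<in> Mor M" "Dom M t = Cod M k" "Cod M t = Z" using t by (simp_all add: Hom_def)
    have "v \<cdot> sX = t \<cdot> ff"
    proof (rule coproduct_eqI[OF ij])
      show "v \<cdot> sX \<in> Hom M (Cod M i) Z" "t \<cdot> ff \<in> Hom M (Cod M i) Z"
        using arr v' t' by (simp_all add: Hom_def)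
      have "v \<cdot> sX \<cdot> i = v \<cdot> (sX \<cdot> i)" "t \<cdot> ff \<cdot> i = t \<cdot> (ff \<cdot> i)" "t \<cdot> (k \<cdot> f) = (t \<cdot> k) \<cdot> f"
        using arr v' t' by simp_all
      then show "v \<cdot> sX \<cdot> i = t \<cdot> ff \<cdot> i" using sX(4) ff(4) t(2) u(2)[of False] by simp
      have "v \<cdot> sX \<cdot> j = v \<cdot> (sX \<cdot> j)" "t \<cdot> ff \<cdot> j = t \<cdot> (ff \<cdot> j)" "t \<cdot> (l \<cdot> f) = (t \<cdot> l) \<cdot> f"
        using arr v' t' by simp_all
      then show "v \<cdot> sX \<cdot> j = t \<cdot> ff \<cdot> j" using sX(5) ff(5) t(3) u(2)[of True] by simp
    qed
    then have ex1: "\<exists>!h. h \<in> Hom M (Cod M a) Z \<and> h \<cdot> a = v \<and> h \<cdot> b = t"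
      using arr v' t' by (intro pushout_ex1[OF po[folded sX_def ff_def]]) (simp_all add: Hom_def)
    have iff: "(\<forall>e. h \<cdot> c e = u e) \<longleftrightarrow> h \<cdot> b = t" if h: "h \<in> Hom M (Cod M a) Z" for h
    proof -
      have "h \<cdot> b \<in> Hom M (Cod M k) Z" using h arr by (simp add: Hom_def)
      then have "h \<cdot> b = t \<longleftrightarrow> (h \<cdot> b) \<cdot> k = u False \<and> (h \<cdot> b) \<cdot> l = u True"
        using coproduct_eqI[OF kl, of "h \<cdot> b" Z t] t by auto
      also have "\<dots> \<longleftrightarrow> (\<forall>e. h \<cdot> c e = u e)"
        using hc[of h] h by (auto simp: Hom_def all_bool_eq)
      finally show ?thesis ..
    qed
    have "QM 0 a = a" "QO 0 (Cod M a) = Cod M a" "QM 0 (c e) = c e" for e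
      using A(4) c(1) by simp_all
    then have "(h \<in> Hom M (QO 0 (Cod M a)) Z \<and> h \<cdot> QM 0 a = v \<and> (\<forall>e\<in>UNIV. h \<cdot> QM 0 (c e) = u e)) \<longleftrightarrow>
        h \<in> Hom M (Cod M a) Z \<and> h \<cdot> a = v \<and> h \<cdot> b = t" for h
      using iff[of h] by auto
    then show "\<exists>!h. h \<in> Hom M (QO 0 (Cod M a)) Z \<and> h \<cdot> QM 0 a = v \<and> (\<forall>e\<in>UNIV. h \<cdot> QM 0 (c e) = u e)"
      using ex1 by presburger
  qed
  have "QM (Suc 0) f \<cdot> sX = sY \<cdot> ff"
  proof (rule coproduct_eqI[OF ij])
    show "QM (Suc 0) f \<cdot> sX \<in> Hom M (Cod M i) (QO (Suc 0) Y)" "sY \<cdot> ff \<in> Hom M (Cod M i) (QO (Suc 0) Y)"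
      using arr by (simp_all add: Hom_def)
    have "QM (Suc 0) f \<cdot> sX \<cdot> i = QM (Suc 0) f \<cdot> (sX \<cdot> i)" "sY \<cdot> ff \<cdot> i = sY \<cdot> (ff \<cdot> i)" "sY \<cdot> (k \<cdot> f) = (sY \<cdot> k) \<cdot> f"
      using arr by simp_all
    then show "QM (Suc 0) f \<cdot> sX \<cdot> i = sY \<cdot> ff \<cdot> i" using sX(4) ff(4) sY(4) inc_natural[OF f] by simp
    have "QM (Suc 0) f \<cdot> sX \<cdot> j = QM (Suc 0) f \<cdot> (sX \<cdot> j)" "sY \<cdot> ff \<cdot> j = sY \<cdot> (ff \<cdot> j)" "sY \<cdot> (l \<cdot> f) = (sY \<cdot> l) \<cdot> f"
      using arr by simp_all
    then show "QM (Suc 0) f \<cdot> sX \<cdot> j = sY \<cdot> ff \<cdot> j" using sX(5) ff(5) sY(5) inc_natural[OF f] by simp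
  qed
  then have L: "induced M a b (QM (Suc 0) f) sY \<in> Hom M (Cod M a) (QO (Suc 0) Y)"
    "induced M a b (QM (Suc 0) f) sY \<cdot> a = QM (Suc 0) f" "induced M a b (QM (Suc 0) f) sY \<cdot> b = sY"
    using arr induced_pushout[OF po[folded sX_def ff_def], of "QM (Suc 0) f" "QO (Suc 0) Y" sY]
    by (simp_all add: Hom_def)
  then have "induced M a b (QM (Suc 0) f) sY \<cdot> c e = inc e Y" for e
    using hc[of "induced M a b (QM (Suc 0) f) sY" e] sY(4,5) by (auto simp: Hom_def)
  then show "corner_map UNIV f (Cod M a) a c
      (induced M a b (QM (Suc 0) f) (induced M k l (inc False Y) (inc True Y)))"
    unfolding sY_def[symmetric] using L XY by (simp add: corner_map_def)
qed

text \<open>The same for the map of the second condition, with a single end.\<close>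

lemma pushout_corner:
  assumes f: "f \<in> Hom M X Y" and po: "is_pushout M (inc e X) f a b"
  shows "corner {e} f (Cod M a) a (\<lambda>_. b)" "corner_univ 0 {e} f (Cod M a) a (\<lambda>_. b)"
    "corner_map {e} f (Cod M a) a (\<lambda>_. b) (induced M a b (QM (Suc 0) f) (inc e Y))"
proof -
  note A = pushoutD[OF po]
  have XY: "f \<in> Mor M" "Dom M f = X" "Cod M f = Y" "X \<in> Obj M" "Y \<in> Obj M" using f by (auto simp: Hom_def)
  show "corner {e} f (Cod M a) a (\<lambda>_. b)"
    using A XY by (simp add: corner_def Hom_def)
  show "corner_univ 0 {e} f (Cod M a) a (\<lambda>_. b)"
    unfolding corner_univ_def
  proof (intro allI impI)
    fix Z v u
    assume v: "v \<in> Hom M (QO (Suc 0) (Dom M f)) Z"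
      and u: "\<forall>e\<in>{e}. u e \<in> Hom M (QO 0 (Cod M f)) Z \<and> u e \<cdot> QM 0 f = v \<cdot> QM 0 (inc e (Dom M f))"
    have "\<exists>!h. h \<in> Hom M (Cod M a) Z \<and> h \<cdot> a = v \<and> h \<cdot> b = u e"
      using u v XY by (intro pushout_ex1[OF po]) auto
    then show "\<exists>!h. h \<in> Hom M (QO 0 (Cod M a)) Z \<and> h \<cdot> QM 0 a = v \<and> (\<forall>e\<in>{e}. h \<cdot> QM 0 b = u e)"
      using A by simp
  qed
  have "QM (Suc 0) f \<in> Hom M (Cod M (inc e X)) (QO (Suc 0) Y)" "inc e Y \<in> Hom M (Cod M f) (QO (Suc 0) Y)"
    using XY by (simp_all add: Hom_def)
  from induced_pushout[OF po this inc_natural[OF f]] show "corner_map {e} f (Cod M a) a (\<lambda>_. b) (induced M a b (QM (Suc 0) f) (inc e Y))"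
    using XY by (simp add: corner_map_def)
qed

text \<open>\<open>L \<cdot> a = QM (Suc 0) f\<close>, and \<open>a\<close> is an acyclic
  cofibration by \<open>lifts_corner\<close>, so two-out-of-three applies.\<close>

lemma corner_weq:
  assumes f: "f \<in> cof M \<inter> weq M" and c: "corner T f P a c" "corner_univ 0 T f P a c"
    and L: "corner_map T f P a c L"
  shows "L \<in> weq M \<longleftrightarrow> QM (Suc 0) f \<in> weq M"
proof -
  have "a \<in> weq M"
    using lifts_corner[OF c] f fib_Mor acyclic_cof_iff cornerD(3)[OF c(1)] by blast
  then show ?thesis
    using two_out_of_three[of a L] cornerD[OF c(1)] corner_mapD[OF L] by auto
qed

text \<open>Literally the right-hand side of the theorem, named so that it can serve as a context
  assumption.\<close>

definition cylinder_conditions :: bool where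
  "cylinder_conditions \<longleftrightarrow>
    (\<forall>X Y f i j k l a b.
       f \<in> cof M \<and> f \<in> Hom M X Y \<and>
       is_coproduct M X X i j \<and> is_coproduct M Y Y k l \<and>
       is_pushout M (induced M i j (cyl_incl Q False X) (cyl_incl Q True X))
                    (induced M i j (k \<cdot>\<^bsub>M\<^esub> f) (l \<cdot>\<^bsub>M\<^esub> f)) a b \<longrightarrow>
       induced M a b (mmap (cyl Q) f)
         (induced M k l (cyl_incl Q False Y) (cyl_incl Q True Y)) \<in> cof M) \<and>
    (\<forall>X Y f e a b.
       f \<in> cof M \<and> f \<in> Hom M X Y \<and> is_pushout M (cyl_incl Q e X) f a b \<longrightarrow>
       induced M a b (mmap (cyl Q) f) (cyl_incl Q e Y) \<in> weq M) \<and>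
    (\<forall>f. f \<in> cof M \<inter> weq M \<longrightarrow> mmap (cyl Q) f \<in> weq M)"

lemmas cylinder_conditions_inc =
  cylinder_conditions_def[folded inc_cyl_incl omap_E_1(1)]

text \<open>Corner maps inherit their lifting properties from \<open>end_lifts\<close>, and lifting
  properties characterise cofibrations and acyclic cofibrations.\<close>

lemma cylinder_conditionsI:
  assumes both: "\<And>f g. f \<in> cof M \<Longrightarrow> g \<in> fib M \<inter> weq M \<Longrightarrow> end_lifts UNIV f g"
    and one: "\<And>f g e. f \<in> cof M \<Longrightarrow> g \<in> fib M \<Longrightarrow> end_lifts {e} f g"
  shows cylinder_conditions
  unfolding cylinder_conditions_inc
proof (intro conjI allI impI; (elim conjE)?)
  fix X Y f i j k l a b
  assume f: "f \<in> cof M" "f \<in> Hom M X Y" and *: "is_coproduct M X X i j" "is_coproduct M Y Y k l"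
    "is_pushout M (induced M i j (inc False X) (inc True X)) (induced M i j (k \<cdot> f) (l \<cdot> f)) a b"
  note c = coproduct_corner[OF f(2) *]
  show "induced M a b (QM (Suc 0) f) (induced M k l (inc False Y) (inc True Y)) \<in> cof M"
    using cof_iff lifts_corner_map_iff[OF c] both[OF f(1)] fib_Mor corner_mapD(1)[OF c(3)] by blast
next
  fix X Y f e a b
  assume f: "f \<in> cof M" "f \<in> Hom M X Y" and *: "is_pushout M (inc e X) f a b"
  note c = pushout_corner[OF f(2) *]
  show "induced M a b (QM (Suc 0) f) (inc e Y) \<in> weq M"
    using acyclic_cof_iff lifts_corner_map_iff[OF c] one[OF f(1)] fib_Mor corner_mapD(1)[OF c(3)] by blast
next
  \<comment> \<open>Either single end would do: with one end \<open>L\<close> is an acyclic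
    cofibration, and \<open>corner_weq\<close> passes this on to
    \<open>QM (Suc 0) f\<close>.\<close>
  fix f assume f: "f \<in> cof M \<inter> weq M"
  then obtain P a c where c: "corner {True} f P a c" "corner_univ 0 {True} f P a c"
    using corner_exists cof_Mor by blast
  then obtain L where L: "corner_map {True} f P a c L" using corner_map_exists by blast
  have "L \<in> weq M"
    using acyclic_cof_iff lifts_corner_map_iff[OF c L] one[of f] f fib_Mor corner_mapD(1)[OF L] by blast
  then show "QM (Suc 0) f \<in> weq M" using corner_weq[OF f c L] by simp
qed

section \<open>From the three conditions to lifting in all dimensions\<close>

context
  assumes conditions: cylinder_conditions
begin

lemma end_lifts_both:
  assumes f: "f \<in> cof M" and g: "g \<in> fib M \<inter> weq M"
  shows "end_lifts UNIV f g"
proof -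
  define X Y where "X = Dom M f" and "Y = Cod M f"
  have fXY: "f \<in> Mor M" "f \<in> Hom M X Y" "X \<in> Obj M" "Y \<in> Obj M"
    using cof_Mor[OF f] by (simp_all add: Hom_def X_def Y_def)
  obtain i j k l where ij: "is_coproduct M X X i j" and kl: "is_coproduct M Y Y k l"
    using coproduct_exists[OF finite_colimits] fXY by blast
  note I = coproductD[OF ij] and K = coproductD[OF kl]
  have "inc e X \<in> Hom M X (QO (Suc 0) X)" for e using fXY by (simp add: Hom_def)
  note s = induced_coproduct(1)[OF ij this this, of False True]
  have "k \<cdot> f \<in> Hom M X (Cod M k)" "l \<cdot> f \<in> Hom M X (Cod M k)"
    using K fXY by (simp_all add: Hom_def)
  note ff = induced_coproduct(1)[OF ij this]
  obtain a b where po: "is_pushout M (induced M i j (inc False X) (inc True X)) (induced M i j (k \<cdot> f) (l \<cdot> f)) a b"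
    using pushout_exists[OF finite_colimits, of "induced M i j (inc False X) (inc True X)" "induced M i j (k \<cdot> f) (l \<cdot> f)"]
      s ff by (auto simp: Hom_def)
  have "induced M a b (QM (Suc 0) f) (induced M k l (inc False Y) (inc True Y)) \<in> cof M"
    using conditions f fXY(2) ij kl po unfolding cylinder_conditions_inc by blast
  then show ?thesis
    using lifts_corner_map_iff[OF coproduct_corner[OF fXY(2) ij kl po]] g fib_Mor cof_iff by blast
qed

lemma end_lifts_one:
  assumes f: "f \<in> cof M" and g: "g \<in> fib M"
  shows "end_lifts {e} f g"
proof -
  define X Y where "X = Dom M f" and "Y = Cod M f"
  have fXY: "f \<in> Mor M" "f \<in> Hom M X Y" "X \<in> Obj M" "Y \<in> Obj M"
    using cof_Mor[OF f] by (simp_all add: Hom_def X_def Y_def)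
  obtain a b where po: "is_pushout M (inc e X) f a b"
    using pushout_exists[OF finite_colimits, of "inc e X" f] fXY by (auto simp: Hom_def)
  note c = pushout_corner[OF fXY(2) po]
  let ?L = "induced M a b (QM (Suc 0) f) (inc e Y)"
  \<comment> \<open>The second condition gives no more than this. That \<open>?L\<close> is a
    cofibration is obtained next, from \<open>end_lifts_single\<close> and the first
    condition.\<close>
  have "?L \<in> weq M"
    using conditions f fXY(2) po unfolding cylinder_conditions_inc by blast
  moreover have "lifts M ?L p" if p: "p \<in> fib M \<inter> weq M" for p
    using lifts_corner_map_iff[OF c] end_lifts_single[OF fXY(1)] end_lifts_both[OF f p] p f fib_Mor cof_iff by blast
  then have "?L \<in> cof M" using cof_iff corner_mapD(1)[OF c(3)] by blast
  ultimately show ?thesis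
    using lifts_corner_map_iff[OF c] g fib_Mor acyclic_cof_iff by blast
qed

text \<open>The first condition concerns corners built from coproducts. Passing through
  \<open>end_lifts\<close>, which mentions no corner, carries it over to any other corner;
  acyclicity comes from the third condition through \<open>corner_weq\<close>.\<close>

lemma corner_map_cof:
  assumes f: "f \<in> cof M" and c: "corner UNIV f P a c" "corner_univ 0 UNIV f P a c" and L: "corner_map UNIV f P a c L"
  shows "L \<in> cof M" "f \<in> weq M \<Longrightarrow> L \<in> weq M"
proof -
  show "L \<in> cof M"
    using cof_iff lifts_corner_map_iff[OF c L] end_lifts_both[OF f] fib_Mor corner_mapD(1)[OF L] by blast
  show "L \<in> weq M" if "f \<in> weq M"
    using corner_weq[OF _ c L] f that conditions unfolding cylinder_conditions_inc by blast
qed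

lemma corner_map_acyclic_cof:
  assumes f: "f \<in> cof M" and c: "corner {e} f P a c" "corner_univ 0 {e} f P a c" and L: "corner_map {e} f P a c L"
  shows "L \<in> cof M \<inter> weq M"
  using acyclic_cof_iff lifts_corner_map_iff[OF c L] end_lifts_one[OF f] fib_Mor corner_mapD(1)[OF L] by blast

text \<open>The hypotheses survive the passage from \<open>f\<close> to \<open>L\<close>: it is a
  cofibration, acyclic if \<open>f\<close> is, and \<open>g\<close> stays fixed. In dimension 0 the
  lifting axioms remain.\<close>

lemma boundary_lifts:
  assumes "f \<in> cof M" "g \<in> fib M" "f \<in> weq M \<or> g \<in> weq M"
  shows "box_lifts n ({..<n} \<times> UNIV) f g"
  using assms
proof (induction n arbitrary: f)
  case 0
  then have "lifts M f g" using cof_iff acyclic_cof_iff by blast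
  then show ?case using box_lifts_0 cof_Mor fib_Mor 0 by simp
next
  case (Suc n)
  obtain P a c where c: "corner UNIV f P a c" "\<And>n. corner_univ n UNIV f P a c"
    using corner_exists[OF cof_Mor[OF Suc.prems(1)]] by blast
  obtain L where L: "corner_map UNIV f P a c L" using corner_map_exists[OF c] by blast
  have "box_lifts n ({..<n} \<times> UNIV) L g"
    using Suc corner_map_cof[OF Suc.prems(1) c L] by blast
  then have "box_lifts (Suc n) ({..<n} \<times> UNIV \<union> {n} \<times> UNIV) f g"
    using Suc.prems by (intro box_lifts_step[OF fib_Mor _ c L]) auto
  moreover have "{..<n} \<times> UNIV \<union> {n} \<times> UNIV = {..<Suc n} \<times> (UNIV :: bool set)" by auto
  ultimately show ?case by simp
qed

lemma open_box_lifts: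
  assumes "f \<in> cof M" "g \<in> fib M" "k < n"
  shows "box_lifts n ({..<n} \<times> UNIV - {(k, e)}) f g"
  using assms
proof (induction n arbitrary: f)
  case (Suc n)
  show ?case
  proof (cases "k < n")
    case True
    obtain P a c where c: "corner UNIV f P a c" "\<And>n. corner_univ n UNIV f P a c"
      using corner_exists[OF cof_Mor[OF Suc.prems(1)]] by blast
    obtain L where L: "corner_map UNIV f P a c L" using corner_map_exists[OF c] by blast
    have "box_lifts n ({..<n} \<times> UNIV - {(k, e)}) L g"
      using Suc True corner_map_cof[OF Suc.prems(1) c L] by blast
    then have "box_lifts (Suc n) (({..<n} \<times> UNIV - {(k, e)}) \<union> {n} \<times> UNIV) f g"
      using Suc.prems by (intro box_lifts_step[OF fib_Mor _ c L]) auto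
    moreover have "({..<n} \<times> UNIV - {(k, e)}) \<union> {n} \<times> UNIV = {..<Suc n} \<times> UNIV - {(k, e)}"
      using True by auto
    ultimately show ?thesis by simp
  next
    \<comment> \<open>The missing face lies in the last direction, so only the opposite end is
      glued. The resulting \<open>L\<close> is acyclic, which pays for the full boundary that is
      left in dimension \<open>n\<close>.\<close>
    case False
    then have k: "k = n" using Suc.prems by simp
    obtain P a c where c: "corner {\<not> e} f P a c" "\<And>n. corner_univ n {\<not> e} f P a c"
      using corner_exists[OF cof_Mor[OF Suc.prems(1)]] by blast
    obtain L where L: "corner_map {\<not> e} f P a c L" using corner_map_exists[OF c] by blast
    have "box_lifts n ({..<n} \<times> UNIV) L g"
      using boundary_lifts Suc.prems corner_map_acyclic_cof[OF Suc.prems(1) c L] by blast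
    then have "box_lifts (Suc n) ({..<n} \<times> UNIV \<union> {n} \<times> {\<not> e}) f g"
      using Suc.prems by (intro box_lifts_step[OF fib_Mor _ c L]) auto
    moreover have "{..<n} \<times> UNIV \<union> {n} \<times> {\<not> e} = {..<Suc n} \<times> UNIV - {(k, e)}"
      using k by auto
    ultimately show ?thesis by simp
  qed
qed simp

end

end

section \<open>Lifting problems of cubical sets\<close>

lemma cube_comp_Mor:
  assumes "\<theta> \<in> cube_maps" "\<phi> \<in> cube_maps" "fst (snd \<theta>) = fst \<phi>"
  shows "cube_comp \<phi> \<theta> \<in> cube_maps" "fst (cube_comp \<phi> \<theta>) = fst \<theta>" "fst (snd (cube_comp \<phi> \<theta>)) = fst (snd \<phi>)"
  using cube_maps.comp[OF assms] by (simp_all add: cube_comp_def split: prod.splits)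

lemma cube_comp_assoc:
  assumes "\<theta> \<in> cube_maps" "\<phi> \<in> cube_maps" "\<psi> \<in> cube_maps" "fst (snd \<theta>) = fst \<phi>" "fst (snd \<phi>) = fst \<psi>"
  shows "cube_comp (cube_comp \<psi> \<phi>) \<theta> = cube_comp \<psi> (cube_comp \<phi> \<theta>)"
proof -
  obtain u v w where w: "\<theta> = word_map u" "\<phi> = word_map v" "\<psi> = word_map w"
    using assms(1-3) by (auto simp: cube_maps_eq)
  have "tgt u = src v" "tgt v = src w" using assms(4,5) by (simp_all add: w)
  then have "word_map (word_comp (word_comp w v) u) = word_map (word_comp w (word_comp v u))"
    by (simp add: word_map_eq_iff src_tgt_word_comp word_fun_comp)
  then show ?thesis
    using \<open>tgt u = src v\<close> \<open>tgt v = src w\<close> by (simp add: w word_map_comp src_tgt_word_comp)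
qed

lemma cube_comp_id:
  assumes "\<theta> \<in> cube_maps"
  shows "fst \<theta> = n \<Longrightarrow> cube_comp \<theta> (cube_id n) = \<theta>" "fst (snd \<theta>) = n \<Longrightarrow> cube_comp (cube_id n) \<theta> = \<theta>"
proof -
  obtain w where w: "\<theta> = word_map w" using assms by (auto simp: cube_maps_eq)
  have "word_map (word_comp w (replicate (src w) Wire)) = word_map w"
    "word_map (word_comp (replicate (tgt w) Wire) w) = word_map w"
    by (simp_all add: word_map_eq_iff src_tgt_word_comp word_fun_comp word_fun_only_wires)
  then show "fst \<theta> = n \<Longrightarrow> cube_comp \<theta> (cube_id n) = \<theta>" "fst (snd \<theta>) = n \<Longrightarrow> cube_comp (cube_id n) \<theta> = \<theta>"
    by (auto simp: w cube_id_word word_map_comp)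
qed

lemma cube_id_Mor [simp]: "cube_id n \<in> cube_maps" "fst (cube_id n) = n" "fst (snd (cube_id n)) = n"
  by (simp_all add: cube_maps.id) (simp_all add: cube_id_def)

text \<open>Covers standard cubes and unions of their faces together, since maps of cubes act on
  both by precomposition.\<close>

lemma is_cubical_set_sub_cube:
  assumes "\<And>m x. x \<in> cells K m \<Longrightarrow> x \<in> cube_maps \<and> fst x = m" "act K = (\<lambda>\<theta> x. cube_comp x \<theta>)"
    and "\<And>\<theta> x. \<theta> \<in> cube_maps \<Longrightarrow> x \<in> cells K (fst (snd \<theta>)) \<Longrightarrow> cube_comp x \<theta> \<in> cells K (fst \<theta>)"
  shows "is_cubical_set K"
  unfolding is_cubical_set_def
proof (intro conjI allI ballI impI)
  fix \<theta> x assume "\<theta> \<in> Mor cube" "x \<in> cells K (Cod cube \<theta>)"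
  then show "act K \<theta> x \<in> cells K (Dom cube \<theta>)" using assms(2,3) by simp
next
  fix n x assume "x \<in> cells K n"
  then show "act K (Id cube n) x = x" using assms(1)[of x n] assms(2) by (simp add: cube_comp_id)
next
  fix \<theta> \<phi> x assume "\<theta> \<in> Mor cube" "\<phi> \<in> Mor cube" "Cod cube \<theta> = Dom cube \<phi>" "x \<in> cells K (Cod cube \<phi>)"
  then show "act K (\<phi> \<cdot>\<^bsub>cube\<^esub> \<theta>) x = act K \<theta> (act K \<phi> x)"
    using assms(1)[of x] assms(2) by (simp add: cube_comp_assoc)
qed

lemma std_cube_cells: "x \<in> cells (std_cube n) m \<longleftrightarrow> x \<in> cube_maps \<and> fst x = m \<and> fst (snd x) = n"
  by (auto simp: std_cube_def Hom_def)

lemma std_cube_act: "act (std_cube n) = (\<lambda>\<theta> x. cube_comp x \<theta>)"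
  by (simp add: std_cube_def)

lemma is_cubical_set_std_cube: "is_cubical_set (std_cube n)"
  by (rule is_cubical_set_sub_cube) (auto simp: std_cube_cells std_cube_act cube_comp_Mor)

lemma coface_union_cells:
  "a \<in> cells (coface_union n S) m \<longleftrightarrow>
    (\<exists>k e x. (k, e) \<in> S \<and> x \<in> cube_maps \<and> fst x = m \<and> fst (snd x) = n - 1 \<and> a = cube_comp (coface n k e) x)"
  unfolding coface_union_def by (auto simp: Hom_def)

lemma coface_union_act: "act (coface_union n S) = (\<lambda>\<theta> x. cube_comp x \<theta>)"
  by (simp add: coface_union_def)

lemma is_cubical_set_coface_union:
  assumes "S \<subseteq> {..<n} \<times> UNIV"
  shows "is_cubical_set (coface_union n S)"
proof (rule is_cubical_set_sub_cube)
  fix m a assume "a \<in> cells (coface_union n S) m"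
  then show "a \<in> cube_maps \<and> fst a = m"
    using assms unfolding coface_union_cells by (auto simp: cube_comp_Mor coface_Mor)
next
  fix \<theta> a assume \<theta>: "\<theta> \<in> cube_maps" and "a \<in> cells (coface_union n S) (fst (snd \<theta>))"
  then obtain k e x where x: "(k, e) \<in> S" "x \<in> cube_maps" "fst x = fst (snd \<theta>)" "fst (snd x) = n - 1"
    "a = cube_comp (coface n k e) x"
    unfolding coface_union_cells by auto
  moreover have "k < n" using x(1) assms by auto
  ultimately have "cube_comp a \<theta> = cube_comp (coface n k e) (cube_comp x \<theta>)"
    using \<theta> by (simp add: cube_comp_assoc coface_Mor)
  then show "cube_comp a \<theta> \<in> cells (coface_union n S) (fst \<theta>)"
    unfolding coface_union_cells using x \<theta> cube_comp_Mor[of \<theta> x]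
    by (intro exI[of _ k] exI[of _ e] exI[of _ "cube_comp x \<theta>"]) simp
qed (rule coface_union_act)

text \<open>The map from \<box>[m] to the terminal object \<box>[0] of the cube category.\<close>

definition collapse :: "nat \<Rightarrow> cube_map" where
  "collapse m = word_map (replicate m Drop)"

lemma collapse_Mor [simp]: "collapse m \<in> cube_maps" "fst (collapse m) = m" "fst (snd (collapse m)) = 0"
  by (simp_all add: collapse_def cube_maps_eq)

lemma collapse_unique: "x \<in> cube_maps \<Longrightarrow> fst (snd x) = 0 \<Longrightarrow> x = collapse (fst x)"
proof -
  assume "x \<in> cube_maps" "fst (snd x) = 0"
  then obtain w where w: "x = word_map w" "tgt w = 0" by (auto simp: cube_maps_eq)
  have "word_fun w xs = []" for xs using w(2) by (simp flip: length_0_conv)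
  then show ?thesis using w word_fun_drops[of "src w" "[]"] by (simp add: collapse_def word_map_eq_iff)
qed

text \<open>A cell in a union of ends does not record its end. Evaluating it at the vertex with all
  coordinates \<open>False\<close> recovers the end.\<close>

definition end_of :: "cube_map \<Rightarrow> bool" where
  "end_of a = hd (snd (snd a) (replicate (fst a) False))"

lemma end_of_delta: "end_of (cube_comp (delta e) (collapse m)) = e"
proof -
  have "cube_comp (delta e) (collapse m) = word_map (word_comp [Point e] (replicate m Drop))"
    by (simp add: collapse_def word_map_letters(4)[symmetric] word_map_comp del: word_comp.simps)
  moreover have "src (word_comp [Point e] (replicate m Drop)) = m"
    using src_tgt_word_comp[of "replicate m Drop" "[Point e]"] by simp
  ultimately show ?thesis
    by (simp add: end_of_def word_map_def cube_pts_def)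
qed

lemma coface_union_1_cells:
  "a \<in> cells (coface_union (Suc 0) ({0} \<times> T)) m \<longleftrightarrow> (\<exists>e\<in>T. a = cube_comp (delta e) (collapse m))"
proof
  assume "a \<in> cells (coface_union (Suc 0) ({0} \<times> T)) m"
  then obtain e x where "e \<in> T" "x \<in> cube_maps" "fst x = m" "fst (snd x) = 0" "a = cube_comp (delta e) x"
    unfolding coface_union_cells by (auto simp: coface_1)
  then show "\<exists>e\<in>T. a = cube_comp (delta e) (collapse m)" using collapse_unique by metis
next
  assume "\<exists>e\<in>T. a = cube_comp (delta e) (collapse m)"
  then obtain e where "e \<in> T" "a = cube_comp (delta e) (collapse m)" by blast
  then show "a \<in> cells (coface_union (Suc 0) ({0} \<times> T)) m"
    unfolding coface_union_cells
    by (intro exI[of _ 0] exI[of _ e] exI[of _ "collapse m"]) (simp add: coface_1)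
qed

context model_cylinder
begin

section \<open>Mapping cubical sets and the pullback-hom map\<close>

lemma is_cubical_set_mapping:
  assumes "X \<in> Obj M"
  shows "is_cubical_set (mapping_cset M E X Y)"
  unfolding is_cubical_set_def
proof (intro conjI allI ballI impI)
  fix \<theta> \<phi> x assume "\<theta> \<in> Mor cube" "\<phi> \<in> Mor cube" "Cod cube \<theta> = Dom cube \<phi>"
    and "x \<in> cells (mapping_cset M E X Y) (Cod cube \<phi>)"
  then show "act (mapping_cset M E X Y) (\<phi> \<cdot>\<^bsub>cube\<^esub> \<theta>) x = act (mapping_cset M E X Y) \<theta> (act (mapping_cset M E X Y) \<phi> x)"
    using assms by (simp add: mapping_cset_def Hom_def NT_comp)
qed (use assms in \<open>simp_all add: mapping_cset_def Hom_def\<close>)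

context
  fixes f g X Y Z Z'
  assumes fg: "f \<in> Hom M X Y" "g \<in> Hom M Z Z'"
begin

lemma fg_simps [simp]:
  "f \<in> Mor M" "g \<in> Mor M" "Dom M f = X" "Cod M f = Y" "Dom M g = Z" "Cod M g = Z'"
  "X \<in> Obj M" "Y \<in> Obj M" "Z \<in> Obj M" "Z' \<in> Obj M"
  using fg by (auto simp: Hom_def)

lemma target_cells:
  "z \<in> cells (pullback_hom_target M E f g) n \<longleftrightarrow>
    (\<exists>x y. z = (x, y) \<and> x \<in> Hom M (QO n X) Z \<and> y \<in> Hom M (QO n Y) Z' \<and> g \<cdot> x = y \<cdot> QM n f)"
  by (auto simp: pullback_hom_target_def cubical_pullback_def mapping_cset_def)

lemma target_act: "act (pullback_hom_target M E f g) \<theta> (x, y) = (x \<cdot> NT \<theta> X, y \<cdot> NT \<theta> Y)"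
  by (simp add: pullback_hom_target_def cubical_pullback_def mapping_cset_def)

lemma target_act_cells:
  assumes \<theta>: "\<theta> \<in> cube_maps" and "x \<in> Hom M (QO (fst (snd \<theta>)) X) Z" "y \<in> Hom M (QO (fst (snd \<theta>)) Y) Z'"
    and eq: "g \<cdot> x = y \<cdot> QM (fst (snd \<theta>)) f"
  shows "(x \<cdot> NT \<theta> X, y \<cdot> NT \<theta> Y) \<in> cells (pullback_hom_target M E f g) (fst \<theta>)"
proof -
  have xy: "x \<in> Mor M" "Dom M x = QO (fst (snd \<theta>)) X" "Cod M x = Z"
    "y \<in> Mor M" "Dom M y = QO (fst (snd \<theta>)) Y" "Cod M y = Z'" using assms by (simp_all add: Hom_def)
  have "g \<cdot> (x \<cdot> NT \<theta> X) = y \<cdot> (QM (fst (snd \<theta>)) f \<cdot> NT \<theta> X)"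
    using Comp_reduce[OF eq, of "NT \<theta> X"] xy \<theta> by simp
  also have "\<dots> = (y \<cdot> NT \<theta> Y) \<cdot> QM (fst \<theta>) f"
    unfolding NT_natural[OF \<theta> fg(1)] using xy \<theta> by simp
  finally show ?thesis using xy \<theta> by (simp add: target_cells Hom_def)
qed

lemma is_cubical_set_target: "is_cubical_set (pullback_hom_target M E f g)"
  unfolding is_cubical_set_def
proof (intro conjI allI ballI impI)
  fix \<theta> z assume "\<theta> \<in> Mor cube" "z \<in> cells (pullback_hom_target M E f g) (Cod cube \<theta>)"
  then show "act (pullback_hom_target M E f g) \<theta> z \<in> cells (pullback_hom_target M E f g) (Dom cube \<theta>)"
    using target_act_cells[of \<theta>] by (auto simp: target_cells[of _ "fst (snd \<theta>)"] target_act)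
next
  fix n z assume "z \<in> cells (pullback_hom_target M E f g) n"
  then show "act (pullback_hom_target M E f g) (Id cube n) z = z"
    by (auto simp: target_cells target_act Hom_def)
next
  fix \<theta> \<phi> z assume "\<theta> \<in> Mor cube" "\<phi> \<in> Mor cube" "Cod cube \<theta> = Dom cube \<phi>"
    and "z \<in> cells (pullback_hom_target M E f g) (Cod cube \<phi>)"
  then show "act (pullback_hom_target M E f g) (\<phi> \<cdot>\<^bsub>cube\<^esub> \<theta>) z =
      act (pullback_hom_target M E f g) \<theta> (act (pullback_hom_target M E f g) \<phi> z)"
    by (auto simp: target_cells target_act Hom_def NT_comp)
qed

lemma is_cubical_map_pullback_hom:
  "is_cubical_map (mapping_cset M E Y Z) (pullback_hom_target M E f g) (pullback_hom M E f g)"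
  unfolding is_cubical_map_def
proof (intro conjI allI ballI)
  fix n x assume "x \<in> cells (mapping_cset M E Y Z) n"
  then show "pullback_hom M E f g n x \<in> cells (pullback_hom_target M E f g) n"
    by (simp add: pullback_hom_def target_cells mapping_cset_def Hom_def)
next
  fix \<theta> x assume \<theta>: "\<theta> \<in> Mor cube" and "x \<in> cells (mapping_cset M E Y Z) (Cod cube \<theta>)"
  then show "pullback_hom M E f g (Dom cube \<theta>) (act (mapping_cset M E Y Z) \<theta> x) =
      act (pullback_hom_target M E f g) \<theta> (pullback_hom M E f g (Cod cube \<theta>) x)"
    using NT_natural[of \<theta>, OF _ fg(1)] by (simp add: pullback_hom_def mapping_cset_def target_act Hom_def)
qed (simp_all add: is_cubical_set_mapping is_cubical_set_target)

text \<open>The Yoneda lemma: \<open>v\<close> is determined by its value on the identity cell and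
  \<open>u\<close> by its values on the cofaces. These values form a box problem, and precomposing
  its solution with the structure maps \<open>NT\<close> gives a map on the whole cube.\<close>

lemma cubical_rlp_if_box_lifts:
  assumes S: "S \<subseteq> {..<n} \<times> UNIV" and lift: "box_lifts n S f g"
  shows "cubical_rlp (coface_union n S) (std_cube n) (mapping_cset M E Y Z)
    (pullback_hom_target M E f g) (pullback_hom M E f g)"
  unfolding cubical_rlp_def
proof (intro allI impI; elim conjE)
  fix u v
  assume u: "is_cubical_map (coface_union n S) (mapping_cset M E Y Z) u"
    and v: "is_cubical_map (std_cube n) (pullback_hom_target M E f g) v"
    and uv: "\<forall>m. \<forall>a\<in>cells (coface_union n S) m. pullback_hom M E f g m (u m a) = v m a"
  have u_cells: "u m a \<in> Hom M (QO m Y) Z" if "a \<in> cells (coface_union n S) m" for m a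
    using u that by (simp add: is_cubical_map_def mapping_cset_def)
  have u_act: "u (fst \<theta>) (cube_comp a \<theta>) = u (fst (snd \<theta>)) a \<cdot> NT \<theta> Y"
    if "\<theta> \<in> cube_maps" "a \<in> cells (coface_union n S) (fst (snd \<theta>))" for \<theta> a
    using u that by (simp add: is_cubical_map_def mapping_cset_def coface_union_act)
  have u_v: "u m a \<cdot> QM m f = fst (v m a)" "g \<cdot> u m a = snd (v m a)" if "a \<in> cells (coface_union n S) m" for m a
    using uv that by (simp_all add: pullback_hom_def flip: prod.inject)
      (metis fst_conv, metis snd_conv)
  have "cube_id n \<in> cells (std_cube n) n" by (simp add: std_cube_cells)
  then have "v n (cube_id n) \<in> cells (pullback_hom_target M E f g) n"
    using v by (simp add: is_cubical_map_def)
  then obtain v1 v2 where v12: "v n (cube_id n) = (v1, v2)" "v1 \<in> Hom M (QO n X) Z" "v2 \<in> Hom M (QO n Y) Z'"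
    "g \<cdot> v1 = v2 \<cdot> QM n f"
    by (auto simp: target_cells)
  have v_eq: "v (fst \<theta>) \<theta> = (v1 \<cdot> NT \<theta> X, v2 \<cdot> NT \<theta> Y)" if "\<theta> \<in> cube_maps" "fst (snd \<theta>) = n" for \<theta>
  proof -
    have "v (fst \<theta>) (act (std_cube n) \<theta> (cube_id n)) = act (pullback_hom_target M E f g) \<theta> (v n (cube_id n))"
      using v that \<open>cube_id n \<in> cells (std_cube n) n\<close> unfolding is_cubical_map_def by auto
    then show ?thesis using that by (simp add: std_cube_act cube_comp_id v12 target_act)
  qed
  have coface_cell: "coface n k e \<in> cells (coface_union n S) (n - 1)" "k < n" if "(k, e) \<in> S" for k e
  proof -
    show kn: "k < n" using that S by auto
    then have "coface n k e = cube_comp (coface n k e) (cube_id (n - 1))"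
      by (simp add: cube_comp_id coface_Mor)
    then show "coface n k e \<in> cells (coface_union n S) (n - 1)"
      unfolding coface_union_cells using that cube_id_Mor by blast
  qed
  have NT_face: "NT (coface n k e) = face (n - 1) k e" if "k < n" for k e
    using that by (cases n) (simp_all add: face_def)
  let ?u = "\<lambda>k e. u (n - 1) (coface n k e)"
  have "box_problem n S f g ?u v1 v2"
    unfolding box_problem_def
  proof (intro conjI allI impI)
    fix k e assume ke: "(k, e) \<in> S"
    note c = coface_cell[OF ke]
    show "?u k e \<in> Hom M (QO (n - 1) (Cod M f)) (Dom M g)" using u_cells[OF c(1)] by simp
    have "v (n - 1) (coface n k e) = (v1 \<cdot> face (n - 1) k e X, v2 \<cdot> face (n - 1) k e Y)"
      using v_eq[of "coface n k e"] c(2) by (simp add: coface_Mor NT_face)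
    then show "?u k e \<cdot> QM (n - 1) f = v1 \<cdot> face (n - 1) k e (Dom M f)"
      "g \<cdot> ?u k e = v2 \<cdot> face (n - 1) k e (Cod M f)"
      using u_v[OF c(1)] by simp_all
    fix l e' assume l: "(l, e') \<in> S" "k < l"
    note d = coface_cell[OF l(1)]
    obtain j where n: "n = Suc (Suc j)" using d(2) l(2) by (cases n; cases "n - 1") auto
    obtain i where i: "l = Suc i" using l(2) by (cases l) auto
    have ij: "k \<le> i" "i \<le> j" using n i l d by auto
    \<comment> \<open>Both composites of cofaces are the same cell, on which \<open>u\<close> has a
      single value.\<close>
    have "?u l e' \<cdot> NT (coface (Suc j) k e) Y = u j (cube_comp (coface n l e') (coface (Suc j) k e))"
      using u_act[of "coface (Suc j) k e" "coface n l e'"] d n ij by (simp add: coface_Mor)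
    also have "\<dots> = u j (cube_comp (coface n k e) (coface (Suc j) i e'))"
      unfolding n i coface_coface[OF ij] ..
    also have "\<dots> = ?u k e \<cdot> NT (coface (Suc j) i e') Y"
      using u_act[of "coface (Suc j) i e'" "coface n k e"] c n ij by (simp add: coface_Mor)
    finally show "?u l e' \<cdot> face (n - 2) k e (Cod M f) = ?u k e \<cdot> face (n - 2) (l - 1) e' (Cod M f)"
      using n i by (simp add: face_def)
  qed (use v12 in simp_all)
  then obtain h where "h \<in> Hom M (QO n (Cod M f)) (Dom M g)" "h \<cdot> QM n f = v1" "g \<cdot> h = v2"
    and "\<forall>k e. (k, e) \<in> S \<longrightarrow> h \<cdot> face (n - 1) k e (Cod M f) = ?u k e"
    using lift unfolding box_lifts_def by blast
  then have h: "h \<in> Mor M" "Dom M h = QO n Y" "Cod M h = Z" "h \<cdot> QM n f = v1" "g \<cdot> h = v2"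
    and hu: "\<And>k e. (k, e) \<in> S \<Longrightarrow> h \<cdot> face (n - 1) k e Y = ?u k e"
    by (auto simp: Hom_def)
  define H where "H m \<theta> = h \<cdot> NT \<theta> Y" for m :: nat and \<theta>
  have "is_cubical_map (std_cube n) (mapping_cset M E Y Z) H"
    using h(1-3) unfolding is_cubical_map_def
    by (intro conjI is_cubical_set_std_cube is_cubical_set_mapping)
      (simp_all add: std_cube_cells mapping_cset_def H_def Hom_def std_cube_act NT_comp)
  moreover have "H m a = u m a" if a: "a \<in> cells (coface_union n S) m" for m a
  proof -
    obtain k e x where x: "(k, e) \<in> S" "x \<in> cube_maps" "fst x = m" "fst (snd x) = n - 1"
      "a = cube_comp (coface n k e) x"
      using a unfolding coface_union_cells by blast
    note c = coface_cell[OF x(1)]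
    have "H m a = h \<cdot> (NT (coface n k e) Y \<cdot> NT x Y)"
      using x c by (simp add: H_def NT_comp coface_Mor)
    also have "\<dots> = ?u k e \<cdot> NT x Y"
      using Comp_reduce[OF hu[OF x(1)], of "NT x Y"] h(1-3) c x by (simp add: NT_face)
    also have "\<dots> = u m a"
      using u_act[of x "coface n k e"] x c by simp
    finally show ?thesis .
  qed
  moreover have "pullback_hom M E f g m (H m \<theta>) = v m \<theta>" if "\<theta> \<in> cells (std_cube n) m" for m \<theta>
  proof -
    have \<theta>: "\<theta> \<in> cube_maps" "fst \<theta> = m" "fst (snd \<theta>) = n" using that by (simp_all add: std_cube_cells)
    have "h \<cdot> NT \<theta> Y \<cdot> QM m f = h \<cdot> (QM n f \<cdot> NT \<theta> X)"
      using NT_natural[OF \<theta>(1) fg(1)] h(1-3) \<theta> by simp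
    also have "\<dots> = v1 \<cdot> NT \<theta> X" using Comp_reduce[OF h(4), of "NT \<theta> X"] h(1-3) \<theta> by simp
    finally have 1: "h \<cdot> NT \<theta> Y \<cdot> QM m f = v1 \<cdot> NT \<theta> X" .
    have "g \<cdot> (h \<cdot> NT \<theta> Y) = v2 \<cdot> NT \<theta> Y" using Comp_reduce[OF h(5), of "NT \<theta> Y"] h(1-3) \<theta> by simp
    with 1 show ?thesis using v_eq[OF \<theta>(1,3)] \<theta>(2) by (simp only: pullback_hom_def H_def)
  qed
  ultimately show "\<exists>h. is_cubical_map (std_cube n) (mapping_cset M E Y Z) h \<and>
      (\<forall>m. \<forall>a\<in>cells (coface_union n S) m. h m a = u m a) \<and>
      (\<forall>m. \<forall>b\<in>cells (std_cube n) m. pullback_hom M E f g m (h m b) = v m b)" by blast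
qed

text \<open>In dimension one the faces are the ends, which are disjoint, so a map from their union
  can be given end by end without conditions on intersections.\<close>

lemma end_lifts_if_cubical_rlp:
  assumes rlp: "cubical_rlp (coface_union (Suc 0) ({0} \<times> T)) (std_cube (Suc 0)) (mapping_cset M E Y Z)
    (pullback_hom_target M E f g) (pullback_hom M E f g)"
  shows "end_lifts T f g"
  unfolding end_lifts_iff[OF fg_simps(1,2)] fg_simps
proof (intro allI impI; elim conjE)
  fix s v w
  assume s: "\<forall>e\<in>T. s e \<in> Hom M Y Z \<and> s e \<cdot> f = v \<cdot> inc e X \<and> g \<cdot> s e = w \<cdot> inc e Y"
    and v: "v \<in> Hom M (QO (Suc 0) X) Z" and w: "w \<in> Hom M (QO (Suc 0) Y) Z'"
    and gv: "g \<cdot> v = w \<cdot> QM (Suc 0) f"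
  have v': "v \<in> Mor M" "Dom M v = QO (Suc 0) X" "Cod M v = Z"
    and w': "w \<in> Mor M" "Dom M w = QO (Suc 0) Y" "Cod M w = Z'" using v w by (simp_all add: Hom_def)
  have s': "s e \<in> Mor M" "Dom M (s e) = Y" "Cod M (s e) = Z" "s e \<cdot> f = v \<cdot> inc e X" "g \<cdot> s e = w \<cdot> inc e Y"
    if "e \<in> T" for e using s that by (simp_all add: Hom_def)
  \<comment> \<open>All cells of an end are degeneracies of its vertex, so \<open>s e\<close>
    extends to them along \<open>collapse m\<close>.\<close>
  define u where "u m a = s (end_of a) \<cdot> NT (collapse m) Y" for m a
  define V where "V m \<theta> = (v \<cdot> NT \<theta> X, w \<cdot> NT \<theta> Y)" for m :: nat and \<theta>
  let ?A = "coface_union (Suc 0) ({0} \<times> T)"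
  have u_eq: "u m (cube_comp (delta e) (collapse m)) = s e \<cdot> NT (collapse m) Y" for e m
    by (simp add: u_def end_of_delta)
  have collapse: "cube_comp (collapse m) \<theta> = collapse (fst \<theta>)" if "\<theta> \<in> cube_maps" "fst (snd \<theta>) = m" for \<theta> m
    using collapse_unique[of "cube_comp (collapse m) \<theta>"] cube_comp_Mor[of \<theta> "collapse m"] that by simp
  have "is_cubical_map ?A (mapping_cset M E Y Z) u"
    unfolding is_cubical_map_def
  proof (intro conjI allI ballI)
    fix m a assume "a \<in> cells ?A m"
    then show "u m a \<in> cells (mapping_cset M E Y Z) m"
      using s' by (auto simp: coface_union_1_cells u_eq mapping_cset_def Hom_def)
  next
    fix \<theta> a assume \<theta>: "\<theta> \<in> Mor cube" and "a \<in> cells ?A (Cod cube \<theta>)"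
    then obtain e where e: "e \<in> T" "a = cube_comp (delta e) (collapse (fst (snd \<theta>)))"
      by (auto simp: coface_union_1_cells)
    have "cube_comp a \<theta> = cube_comp (delta e) (collapse (fst \<theta>))"
      using \<theta> e collapse[of \<theta>] by (simp add: cube_comp_assoc cube_maps.delta)
    moreover have "NT (collapse (fst \<theta>)) Y = NT (collapse (fst (snd \<theta>))) Y \<cdot> NT \<theta> Y"
      using NT_comp[of \<theta> "collapse (fst (snd \<theta>))" Y] \<theta> collapse[of \<theta>] by simp
    ultimately show "u (Dom cube \<theta>) (act ?A \<theta> a) = act (mapping_cset M E Y Z) \<theta> (u (Cod cube \<theta>) a)"
      using e s'(1-3)[OF e(1)] \<theta> by (simp add: coface_union_act u_eq mapping_cset_def)
  qed (auto intro!: is_cubical_set_coface_union is_cubical_set_mapping)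
  moreover have "is_cubical_map (std_cube (Suc 0)) (pullback_hom_target M E f g) V"
    unfolding is_cubical_map_def
  proof (intro conjI allI ballI)
    fix m \<theta> assume "\<theta> \<in> cells (std_cube (Suc 0)) m"
    then show "V m \<theta> \<in> cells (pullback_hom_target M E f g) m"
      using target_act_cells[of \<theta> v w] v w gv by (auto simp: V_def std_cube_cells)
  next
    fix \<theta> x assume "\<theta> \<in> Mor cube" "x \<in> cells (std_cube (Suc 0)) (Cod cube \<theta>)"
    then show "V (Dom cube \<theta>) (act (std_cube (Suc 0)) \<theta> x) = act (pullback_hom_target M E f g) \<theta> (V (Cod cube \<theta>) x)"
      using v' w' by (simp add: V_def std_cube_cells std_cube_act target_act NT_comp)
  qed (simp_all add: is_cubical_set_std_cube is_cubical_set_target)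
  moreover have "pullback_hom M E f g m (u m a) = V m a" if "a \<in> cells ?A m" for m a
  proof -
    obtain e where e: "e \<in> T" "a = cube_comp (delta e) (collapse m)"
      using \<open>a \<in> cells ?A m\<close> by (auto simp: coface_union_1_cells)
    note se = s'[OF e(1)]
    have NTa: "NT a x = inc e x \<cdot> NT (collapse m) x" if "x \<in> Obj M" for x
      using that e by (simp add: NT_comp cube_maps.delta inc_def)
    have "s e \<cdot> NT (collapse m) Y \<cdot> QM m f = s e \<cdot> (f \<cdot> NT (collapse m) X)"
      using NT_natural[of "collapse m", OF _ fg(1)] se(1-3) by simp
    also have "\<dots> = v \<cdot> NT a X"
      using Comp_reduce[OF se(4), of "NT (collapse m) X"] se(1-3) v' by (simp add: NTa)
    finally have 1: "s e \<cdot> NT (collapse m) Y \<cdot> QM m f = v \<cdot> NT a X" .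
    have "g \<cdot> (s e \<cdot> NT (collapse m) Y) = w \<cdot> NT a Y"
      using Comp_reduce[OF se(5), of "NT (collapse m) Y"] se(1-3) w' by (simp add: NTa)
    with 1 show ?thesis unfolding pullback_hom_def V_def unfolding e(2) u_eq by simp
  qed
  ultimately obtain H where H: "is_cubical_map (std_cube (Suc 0)) (mapping_cset M E Y Z) H"
    "\<forall>m. \<forall>a\<in>cells ?A m. H m a = u m a"
    "\<forall>m. \<forall>b\<in>cells (std_cube (Suc 0)) m. pullback_hom M E f g m (H m b) = V m b"
    using rlp unfolding cubical_rlp_def by blast
  let ?i = "cube_id (Suc 0)"
  have i: "?i \<in> cells (std_cube (Suc 0)) (Suc 0)" by (simp add: std_cube_cells)
  then have h: "H (Suc 0) ?i \<in> Hom M (QO (Suc 0) Y) Z"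
    using H(1) by (simp add: is_cubical_map_def mapping_cset_def)
  have "pullback_hom M E f g (Suc 0) (H (Suc 0) ?i) = V (Suc 0) ?i" using H(3) i by blast
  then have "H (Suc 0) ?i \<cdot> QM (Suc 0) f = v" "g \<cdot> H (Suc 0) ?i = w"
    using v' w' by (simp_all add: pullback_hom_def V_def)
  moreover have "H (Suc 0) ?i \<cdot> inc e Y = s e" if e: "e \<in> T" for e
  proof -
    have "\<forall>\<theta>\<in>cube_maps. \<forall>x\<in>cells (std_cube (Suc 0)) (fst (snd \<theta>)).
        H (fst \<theta>) (cube_comp x \<theta>) = H (fst (snd \<theta>)) x \<cdot> NT \<theta> Y"
      using H(1) by (simp add: is_cubical_map_def mapping_cset_def std_cube_act)
    from this[rule_format, of "delta e" ?i] have "H 0 (cube_comp ?i (delta e)) = H (Suc 0) ?i \<cdot> inc e Y"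
      using i by (simp add: cube_maps.delta inc_def)
    \<comment> \<open>Writes the vertex \<open>delta e\<close> in the form in which
      \<open>u_eq\<close> evaluates \<open>u\<close>.\<close>
    moreover have c0: "collapse 0 = cube_id 0"
      using collapse_unique[of "cube_id 0"] by simp
    moreover have d: "delta e = cube_comp (delta e) (collapse 0)"
      unfolding c0 by (simp add: cube_comp_id cube_maps.delta)
    moreover have "H 0 (delta e) = u 0 (delta e)"
      using H(2) e d coface_union_1_cells by blast
    ultimately show ?thesis
      using u_eq[of 0 e] s'(1-3)[OF e] by (simp add: cube_comp_id cube_maps.delta)
  qed
  ultimately show "\<exists>h\<in>Hom M (QO (Suc 0) Y) Z. h \<cdot> QM (Suc 0) f = v \<and> g \<cdot> h = w \<and> (\<forall>e\<in>T. h \<cdot> inc e Y = s e)"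
    using h by blast
qed

declare fg_simps [simp del]

end

section \<open>Coherence as a family of lifting properties\<close>

lemma cof_fib_Hom:
  assumes "f \<in> cof M" "g \<in> fib M"
  shows "f \<in> Hom M (Dom M f) (Cod M f)" "g \<in> Hom M (Dom M g) (Cod M g)"
  using cof_Mor[OF assms(1)] fib_Mor[OF assms(2)] by (simp_all add: Hom_def)

text \<open>The pullback-hom is always a map of cubical sets, the augmentation has identities as
  components, and \<open>E 0\<close> fixes initial objects, so only the lifting properties are
  left.\<close>

lemma coherent_iff:
  "coherent M Q \<longleftrightarrow>
    (\<forall>f\<in>cof M. \<forall>g\<in>fib M.
      (\<forall>n k e. k < n \<longrightarrow> cubical_rlp (open_box n k e) (std_cube n) (mapping_cset M E (Cod M f) (Dom M g))
        (pullback_hom_target M E f g) (pullback_hom M E f g)) \<and>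
      (f \<in> weq M \<or> g \<in> weq M \<longrightarrow>
        (\<forall>n. cubical_rlp (boundary n) (std_cube n) (mapping_cset M E (Cod M f) (Dom M g))
        (pullback_hom_target M E f g) (pullback_hom M E f g))))"
proof -
  have cmap: "is_cubical_map (mapping_cset M E (Cod M f) (Dom M g)) (pullback_hom_target M E f g) (pullback_hom M E f g)"
    if "f \<in> cof M" "g \<in> fib M" for f g
    using is_cubical_map_pullback_hom[OF cof_fib_Hom[OF that]] .
  have aug: "nt_at (Id (Fun M M) (id_functor M)) X \<in> weq M" if "X \<in> Obj M" for X
    using wide[of "weq M"] that by (simp add: Fun_def wide_subcategory_with_isos_def)
  have init: "is_cofibrant M (omap (omap E 0) I)" if I: "is_initial M I" for I
  proof -
    have "I \<in> Obj M" using I by (simp add: is_initial_def)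
    moreover have "Hom M J I \<subseteq> cof M" if "is_initial M J" for J
      using initial_Hom_iso[OF that I] wide[of "cof M"] by (auto simp: wide_subcategory_with_isos_def)
    ultimately show ?thesis by (simp add: is_cofibrant_def)
  qed
  show ?thesis
    unfolding coherent_def homotopical_def E_def[symmetric]
    by (simp add: cubical_fibration_def cubical_acyclic_fibration_def cmap aug init del: omap_E_0 cong: ball_cong)
qed

lemma coherent_iff_cylinder_conditions: "coherent M Q \<longleftrightarrow> cylinder_conditions"
proof
  assume coh: "coherent M Q"
  show cylinder_conditions
  proof (rule cylinder_conditionsI)
    fix f g assume f: "f \<in> cof M" and g: "g \<in> fib M \<inter> weq M"
    have "boundary (Suc 0) = coface_union (Suc 0) ({0} \<times> UNIV)"
      by (simp add: boundary_def lessThan_Suc)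
    moreover have "cubical_rlp (boundary (Suc 0)) (std_cube (Suc 0)) (mapping_cset M E (Cod M f) (Dom M g))
        (pullback_hom_target M E f g) (pullback_hom M E f g)"
      using coh f g unfolding coherent_iff by blast
    ultimately show "end_lifts UNIV f g"
      using end_lifts_if_cubical_rlp[OF cof_fib_Hom[OF f, of g], of UNIV] g by simp
  next
    fix f g e assume f: "f \<in> cof M" and g: "g \<in> fib M"
    \<comment> \<open>Taking the opposite end away from \<box>[1] leaves the end
      \<open>e\<close>.\<close>
    have "{..<Suc 0} \<times> UNIV - {(0, \<not> e)} = {0} \<times> {e}" by auto
    then have "open_box (Suc 0) 0 (\<not> e) = coface_union (Suc 0) ({0} \<times> {e})"
      by (simp add: open_box_def)
    moreover have "cubical_rlp (open_box (Suc 0) 0 (\<not> e)) (std_cube (Suc 0)) (mapping_cset M E (Cod M f) (Dom M g))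
        (pullback_hom_target M E f g) (pullback_hom M E f g)"
      using coh f g unfolding coherent_iff by blast
    ultimately show "end_lifts {e} f g"
      using end_lifts_if_cubical_rlp[OF cof_fib_Hom[OF f g], of "{e}"] by simp
  qed
next
  assume cond: cylinder_conditions
  show "coherent M Q"
    unfolding coherent_iff
  proof (intro ballI conjI allI impI)
    fix f g assume fg: "f \<in> cof M" "g \<in> fib M"
    note rlp = cubical_rlp_if_box_lifts[OF cof_fib_Hom[OF fg]]
    show "cubical_rlp (open_box n k e) (std_cube n) (mapping_cset M E (Cod M f) (Dom M g))
        (pullback_hom_target M E f g) (pullback_hom M E f g)" if "k < n" for n k e
      unfolding open_box_def by (rule rlp) (use open_box_lifts[OF cond fg that] in auto)
    show "cubical_rlp (boundary n) (std_cube n) (mapping_cset M E (Cod M f) (Dom M g))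
        (pullback_hom_target M E f g) (pullback_hom M E f g)" if "f \<in> weq M \<or> g \<in> weq M" for n
      unfolding boundary_def by (rule rlp) (use boundary_lifts[OF cond fg that] in auto)
  qed
qed

end

theorem corollary5:
  fixes M :: "('o, 'm) model_category" and Q :: "('o, 'm) cube_action"
  assumes "model_category M"
    and "natural_cylinder M Q"
    and "preserves_finite_colimits M M (cyl Q)"
  shows "coherent M Q \<longleftrightarrow>
    (\<forall>X Y f i j k l a b.
       f \<in> cof M \<and> f \<in> Hom M X Y \<and>
       is_coproduct M X X i j \<and> is_coproduct M Y Y k l \<and>
       is_pushout M (induced M i j (cyl_incl Q False X) (cyl_incl Q True X))
                    (induced M i j (k \<cdot>\<^bsub>M\<^esub> f) (l \<cdot>\<^bsub>M\<^esub> f)) a b \<longrightarrow>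
       induced M a b (mmap (cyl Q) f)
         (induced M k l (cyl_incl Q False Y) (cyl_incl Q True Y)) \<in> cof M) \<and>
    (\<forall>X Y f e a b.
       f \<in> cof M \<and> f \<in> Hom M X Y \<and> is_pushout M (cyl_incl Q e X) f a b \<longrightarrow>
       induced M a b (mmap (cyl Q) f) (cyl_incl Q e Y) \<in> weq M) \<and>
    (\<forall>f. f \<in> cof M \<inter> weq M \<longrightarrow> mmap (cyl Q) f \<in> weq M)"
proof -
  interpret model_category M by fact
  interpret model_cylinder M Q by unfold_locales (fact assms)+
  show ?thesis
    using coherent_iff_cylinder_conditions unfolding cylinder_conditions_def .
qed

end
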